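(* Let $V_0$ be a closed subspace of $L^2(\mathbb{H}^n)$. Let $\varphi\in L^2(\mathbb{H}^n)$ satisfy Condition C and suppose that $\{L_{(2k,l,m)}\varphi:(k,l,m)\in\mathbb{Z}^n\times\mathbb{Z}^n\times\mathbb{Z}\}$ is a frame for $V_0$. Suppose that, for each $(k,l)\in\mathbb{Z}^{2n}$ and any $\{c_m\}\in \ell^2(\mathbb{Z})$, the series $\sum_{m\in\mathbb{Z}}c_m L_{(2k,l,m)}\varphi$ converges pointwise on $\mathbb{H}^n$ to a continuous function. Further, suppose there exists a function $\psi\in L^2(\mathbb{H}^n)$ satisfying Condition C such that $\{L_{(2k,l,m)}\psi:(k,l,m)\in\mathbb{Z}^n\times\mathbb{Z}^n\times\mathbb{Z}\}$ is a frame for $V_0$ and \[f=\sum_{(k,l,m)\in\mathbb{Z}^{2n+1}}f(2k,l,m)\,L_{(2k,l,m)}\psi,\quad\forall\, f\in V_0,\] with convergence in $L^2(\mathbb{H}^n)$. Then: (i) $\varphi\in C(\mathbb{H}^n)$ (i.e. $\varphi$ is continuous on $\mathbb{H}^n$); (ii) for each $(k,l)\in\mathbb{Z}^{2n}$, \[\sup_{(x,y,t)\in\mathbb{T}^{2n+1}}\sum_{m\in\mathbb{Z}}|L_{(2k,l,m)}\varphi(x,y,t)|^2<\infty;\] (iii) there exist constants $A,B>0$ such that \[A\chi_{\Omega_{\varphi}}(\lambda)\leq \|P(\lambda)\|^2_{\ell^2(\mathbb{Z}^{2n})}\leq B\chi_{\Omega_{\varphi}}(\lambda)\quad \text{for a.e.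 }\lambda\in\mathbb{R},\] where $P(\lambda)=\{P_{k,l}(\lambda)\}_{(k,l)\in\mathbb{Z}^{2n}}$ with $P_{k,l}(\lambda)=\sum_{m\in\mathbb{Z}}\varphi(2k,l,m)e^{2\pi im\lambda}$, and $\Omega_{\varphi}=\{\lambda\in\mathbb{R}:G^{\varphi}_{0,0}(\lambda)>0\}$.
   Context: The Heisenberg group $\mathbb{H}^n$ is $\mathbb{R}^n\times\mathbb{R}^n\times\mathbb{R}$ with group law $(x,y,t)(u,v,s)=(x+u,\,y+v,\,t+s+\frac12(u\cdot y-v\cdot x))$ and Haar measure the Lebesgue measure $dx\,dy\,dt$. For $k,l\in\mathbb{Z}^n$, $m\in\mathbb{Z}$, the left translation is \[L_{(2k,l,m)}\varphi(x,y,t)=\varphi((2k,l,m)^{-1}(x,y,t))=\varphi\left(x-2k,\,y-l,\,t-m+\tfrac12(y\cdot 2k-x\cdot l)\right).\] For $\lambda\in\mathbb{R}^\ast=\mathbb{R}\setminus\{0\}$, $\pi_\lambda$ is the unitary representation on $L^2(\mathbb{R}^n)$ given by $\pi_\lambda(x,y,t)\phi(\xi)=e^{2\pi i\lambda t}e^{2\pi i\lambda(x\cdot\xi+\frac12 x\cdot y)}\phi(\xi+y)$. The group Fourier transform is $\hat f(\lambda)=\int_{\mathbb{H}^n}f(x,y,t)\pi_\lambda(x,y,t)\,dx\,dy\,dt$ for $f\in L^1(\mathbb{H}^n)$. It is extended by density to $L^2(\mathbb{H}^n)$, giving for a.e. $\lambda$ an operator $\hat f(\lambda)\in\mathcal{B}_2$,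 the Hilbert–Schmidt operators on $L^2(\mathbb{R}^n)$, with $\int_{\mathbb{R}^\ast}\|\hat f(\lambda)\|_{\mathcal{B}_2}^2|\lambda|^n d\lambda=\|f\|_{L^2(\mathbb{H}^n)}^2$. For $\varphi\in L^2(\mathbb{H}^n)$ and $k,l\in\mathbb{Z}^n$, \[G_{k,l}^{\varphi}(\lambda)=\sum_{r\in\mathbb{Z}}\langle\widehat{\varphi}(\lambda+r),\widehat{L_{(2k,l,0)}\varphi}(\lambda+r)\rangle_{\mathcal{B}_{2}}|\lambda+r|^{n},\] defined for a.e. $\lambda\in(0,1]$. For $(k,l)=(0,0)$ the same formula defines a $1$-periodic function $G^\varphi_{0,0}$ for a.e. $\lambda\in\mathbb{R}$. The function $\varphi$ satisfies Condition C if $G^\varphi_{k,l}(\lambda)=0$ for a.e. $\lambda\in(0,1]$, for all $(k,l)\in\mathbb{Z}^{2n}\setminus\{(0,0)\}$. A sequence $\{f_j\}$ is a frame for a Hilbert space $\mathcal{H}$ if it lies in $\mathcal{H}$ and there are $A,B>0$ with $A\|f\|^2\le\sum_j|\langle f,f_j\rangle|^2\le B\|f\|^2$ for all $f\in\mathcal{H}$. $\chi_E$ is the indicator function of $E$. $\mathbb{T}^{2n+1}$ denotes the unit cube $[0,1)^{2n+1}\subset\mathbb{R}^{2n+1}=\mathbb{H}^n$. The function $\varphi$ is given as an everywhere-defined function. The sampling hypothesis presupposes that the values $f(2k,l,m)$ are defined for every $f\in V_0$; when the class $f$ has a continuous representative (necessarily unique), $f(2k,l,m)$ is the value of that representative.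 The series $P_{k,l}$ is a Fourier series in $\lambda$ (sum in $L^2(0,1)$, extended $1$-periodically). *)

theory Defs
  imports "HOL-Analysis.Analysis"
begin

text \<open>
  Elements of \<open>L\<^sup>2\<close> are represented by functions. Every class has a Borel representative, so Borel
  functions and \<^const>\<open>lborel\<close> are used throughout; identities between classes hold almost everywhere.
\<close>

definition L2 :: "'a measure \<Rightarrow> ('a \<Rightarrow> complex) set" where
  "L2 M = {f \<in> borel_measurable M. integrable M (\<lambda>x. (cmod (f x))\<^sup>2)}"

definition l2_inner :: "'a measure \<Rightarrow> ('a \<Rightarrow> complex) \<Rightarrow> ('a \<Rightarrow> complex) \<Rightarrow> complex" where
  "l2_inner M f g = (LINT x|M. f x * cnj (g x))"

definition l2_norm :: "'a measure \<Rightarrow> ('a \<Rightarrow> complex) \<Rightarrow> real" where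
  "l2_norm M f = sqrt (LINT x|M. (cmod (f x))\<^sup>2)"

text \<open>Unconditional convergence in \<open>L\<^sup>2\<close>: along the net of all finite sets of indices.\<close>

definition l2_has_sum :: "'a measure \<Rightarrow> ('j \<Rightarrow> 'a \<Rightarrow> complex) \<Rightarrow> ('a \<Rightarrow> complex) \<Rightarrow> bool" where
  "l2_has_sum M f g \<longleftrightarrow>
     ((\<lambda>J. l2_norm M (\<lambda>x. g x - (\<Sum>j\<in>J. f j x))) \<longlongrightarrow> 0) (finite_subsets_at_top UNIV)"

text \<open>
  The limit in the last clause is any representative of the limit class, so a closed subspace
  contains with a function all square integrable functions that agree with it almost everywhere.
\<close>

definition l2_closed_subspace :: "'a measure \<Rightarrow> ('a \<Rightarrow> complex) set \<Rightarrow> bool" where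
  "l2_closed_subspace M V \<longleftrightarrow>
     V \<subseteq> L2 M \<and> (\<lambda>x. 0) \<in> V \<and>
     (\<forall>f\<in>V. \<forall>g\<in>V. (\<lambda>x. f x + g x) \<in> V) \<and>
     (\<forall>c. \<forall>f\<in>V. (\<lambda>x. c * f x) \<in> V) \<and>
     (\<forall>h f. (\<forall>j::nat. h j \<in> V) \<and> f \<in> L2 M \<and>
        (\<lambda>j. l2_norm M (\<lambda>x. h j x - f x)) \<longlonglongrightarrow> 0 \<longrightarrow> f \<in> V)"

definition l2_frame :: "'a measure \<Rightarrow> ('a \<Rightarrow> complex) set \<Rightarrow> ('j \<Rightarrow> 'a \<Rightarrow> complex) \<Rightarrow> bool" where
  "l2_frame M V e \<longleftrightarrow>
     (\<forall>j. e j \<in> V) \<and>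
     (\<exists>A>0. \<exists>B>0. \<forall>f\<in>V.
        ennreal (A * (l2_norm M f)\<^sup>2) \<le> (\<Sum>\<^sub>\<infinity>j. ennreal ((cmod (l2_inner M f (e j)))\<^sup>2)) \<and>
        (\<Sum>\<^sub>\<infinity>j. ennreal ((cmod (l2_inner M f (e j)))\<^sup>2)) \<le> ennreal (B * (l2_norm M f)\<^sup>2))"

definition l2_onb :: "'a measure \<Rightarrow> (nat \<Rightarrow> 'a \<Rightarrow> complex) \<Rightarrow> bool" where
  "l2_onb M e \<longleftrightarrow>
     (\<forall>j. e j \<in> L2 M) \<and>
     (\<forall>i j. l2_inner M (e i) (e j) = (if i = j then 1 else 0)) \<and>
     (\<forall>f\<in>L2 M. (\<forall>j. l2_inner M f (e j) = 0) \<longrightarrow> (AE x in M. f x = 0))"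


section \<open>Hilbert--Schmidt operators on \<open>L\<^sup>2(\<real>\<^sup>n)\<close>\<close>

type_synonym 'n op = "(real^'n \<Rightarrow> complex) \<Rightarrow> (real^'n \<Rightarrow> complex)"

text \<open>Linearity and boundedness imply that the operator respects equality almost everywhere.\<close>

definition l2_bounded_op :: "'n::finite op \<Rightarrow> bool" where
  "l2_bounded_op T \<longleftrightarrow>
     (\<forall>a\<in>L2 lborel. T a \<in> L2 lborel) \<and>
     (\<forall>a\<in>L2 lborel. \<forall>b\<in>L2 lborel. \<forall>c d.
        AE x in lborel. T (\<lambda>z. c * a z + d * b z) x = c * T a x + d * T b x) \<and>
     (\<exists>C. \<forall>a\<in>L2 lborel. l2_norm lborel (T a) \<le> C * l2_norm lborel a)"

text \<open>
  The Hilbert--Schmidt norm and inner product do not depend on the orthonormal basis; a fixed one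
  is chosen.
\<close>

definition some_onb :: "nat \<Rightarrow> real^'n::finite \<Rightarrow> complex" where
  "some_onb = (SOME e. l2_onb lborel e)"

definition hs_norm_sq :: "'n::finite op \<Rightarrow> ennreal" where
  "hs_norm_sq T = (\<Sum>j. ennreal ((l2_norm lborel (T (some_onb j)))\<^sup>2))"

definition hilbert_schmidt :: "'n::finite op \<Rightarrow> bool" where
  "hilbert_schmidt T \<longleftrightarrow> l2_bounded_op T \<and> hs_norm_sq T < \<infinity>"

definition hs_inner :: "'n::finite op \<Rightarrow> 'n op \<Rightarrow> complex" where
  "hs_inner T S = (\<Sum>j. l2_inner lborel (T (some_onb j)) (S (some_onb j)))"


section \<open>The Heisenberg group and its Fourier transform\<close>

type_synonym 'n heis = "(real^'n) \<times> (real^'n) \<times> real"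

fun heis_mult :: "'n::finite heis \<Rightarrow> 'n heis \<Rightarrow> 'n heis" where
  "heis_mult (x, y, t) (u, v, s) = (x + u, y + v, t + s + (1/2) * (u \<bullet> y - v \<bullet> x))"

fun heis_inv :: "'n::finite heis \<Rightarrow> 'n heis" where
  "heis_inv (x, y, t) = (- x, - y, - t)"

definition ltrans :: "'n::finite heis \<Rightarrow> ('n heis \<Rightarrow> complex) \<Rightarrow> 'n heis \<Rightarrow> complex" where
  "ltrans g f p = f (heis_mult (heis_inv g) p)"

fun lattice_pt :: "(int^'n::finite) \<times> (int^'n) \<times> int \<Rightarrow> 'n heis" where
  "lattice_pt (k, l, m) = ((\<chi> i. 2 * of_int (k $ i)), (\<chi> i. of_int (l $ i)), of_int m)"

lemma ltrans_lattice_pt: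
  "ltrans (lattice_pt (k, l, m)) f (x, y, t) =
     f (x - (\<chi> i. 2 * of_int (k $ i)), y - (\<chi> i. of_int (l $ i)),
        t - of_int m + (1/2) * (y \<bullet> (\<chi> i. 2 * of_int (k $ i)) - x \<bullet> (\<chi> i. of_int (l $ i))))"
  by (simp add: ltrans_def algebra_simps)

fun schroedinger_rep :: "real \<Rightarrow> 'n::finite heis \<Rightarrow> 'n op" where
  "schroedinger_rep \<omega> (x, y, t) a \<xi> =
     exp (2 * of_real pi * \<i> * of_real (\<omega> * t)) *
     exp (2 * of_real pi * \<i> * of_real (\<omega> * (x \<bullet> \<xi> + (1/2) * (x \<bullet> y)))) * a (\<xi> + y)"

text \<open>
  The operator-valued integral of an integrable \<open>f\<close>, applied to \<open>a \<in> L\<^sup>2(\<real>\<^sup>n)\<close>: the integral at \<open>\<xi>\<close>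
  converges absolutely for almost every \<open>\<xi>\<close>, and the resulting function is (by Fubini) the weak
  integral of the vectors \<open>f(g) \<pi>\<^sub>\<omega>(g) a\<close>.
\<close>

definition gft_L1 :: "('n::finite heis \<Rightarrow> complex) \<Rightarrow> real \<Rightarrow> 'n op" where
  "gft_L1 f \<omega> a \<xi> = (LINT g|lborel. f g * schroedinger_rep \<omega> g a \<xi>)"

text \<open>
  Extension by density: \<open>F\<close> is a weakly measurable field of Hilbert--Schmidt operators that is, in
  the norm of \<open>L\<^sup>2(\<real>\<^sup>*, \<B>\<^sub>2; |\<omega>|\<^sup>n d\<omega>)\<close>, the limit of the transforms of functions \<open>h j\<close> in
  \<open>L\<^sup>1 \<inter> L\<^sup>2\<close> that tend to \<open>f\<close> in \<open>L\<^sup>2\<close>. By the Plancherel formula such an \<open>F\<close> exists for every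
  \<open>f \<in> L\<^sup>2\<close> and is unique up to equality of operators for almost every \<open>\<omega>\<close>.
\<close>

definition is_gft :: "('n::finite heis \<Rightarrow> complex) \<Rightarrow> (real \<Rightarrow> 'n op) \<Rightarrow> bool" where
  "is_gft f F \<longleftrightarrow>
     (AE \<omega> in lborel. hilbert_schmidt (F \<omega>)) \<and>
     (\<forall>a\<in>L2 lborel. \<forall>b\<in>L2 lborel.
        (\<lambda>\<omega>. l2_inner lborel (F \<omega> a) b) \<in> borel_measurable lborel) \<and>
     (\<exists>h :: nat \<Rightarrow> 'n heis \<Rightarrow> complex.
        (\<forall>j. integrable lborel (h j) \<and> h j \<in> L2 lborel) \<and>
        (\<lambda>j. l2_norm lborel (\<lambda>p. h j p - f p)) \<longlonglongrightarrow> 0 \<and>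
        (\<lambda>j. \<integral>\<^sup>+ \<omega>. hs_norm_sq (\<lambda>a \<xi>. gft_L1 (h j) \<omega> a \<xi> - F \<omega> a \<xi>) *
               ennreal (\<bar>\<omega>\<bar> ^ CARD('n)) \<partial>lborel) \<longlonglongrightarrow> 0)"

definition gft :: "('n::finite heis \<Rightarrow> complex) \<Rightarrow> real \<Rightarrow> 'n op" where
  "gft f = (SOME F. is_gft f F)"


section \<open>Shift-invariance notions\<close>

definition G :: "('n::finite heis \<Rightarrow> complex) \<Rightarrow> int^'n \<Rightarrow> int^'n \<Rightarrow> real \<Rightarrow> complex" where
  "G \<phi> k l \<omega> =
     (\<Sum>\<^sub>\<infinity>r::int. hs_inner (gft \<phi> (\<omega> + of_int r)) (gft (ltrans (lattice_pt (k, l, 0)) \<phi>) (\<omega> + of_int r)) *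
        of_real (\<bar>\<omega> + of_int r\<bar> ^ CARD('n)))"

definition condition_C :: "('n::finite heis \<Rightarrow> complex) \<Rightarrow> bool" where
  "condition_C \<phi> \<longleftrightarrow>
     (\<forall>k l. (k, l) \<noteq> (0, 0) \<longrightarrow> (AE \<omega> in lborel. \<omega> \<in> {0<..1} \<longrightarrow> G \<phi> k l \<omega> = 0))"

text \<open>For almost every \<open>\<omega>\<close> the value \<open>G \<phi> 0 0 \<omega>\<close> is a sum of squared norms, hence real.\<close>

definition Omega :: "('n::finite heis \<Rightarrow> complex) \<Rightarrow> real set" where
  "Omega \<phi> = {\<omega>. Re (G \<phi> 0 0 \<omega>) > 0}"

text \<open>
  \<open>ev f p\<close> is the value at the lattice point \<open>p\<close> of the class of \<open>f\<close>. Such values are given for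
  every class in \<open>V\<close>; if the class has a continuous representative, its values are meant.
\<close>

definition lattice_values ::
    "('n::finite heis \<Rightarrow> complex) set \<Rightarrow> (('n heis \<Rightarrow> complex) \<Rightarrow> 'n heis \<Rightarrow> complex) \<Rightarrow> bool" where
  "lattice_values V ev \<longleftrightarrow>
     (\<forall>f\<in>V. \<forall>g\<in>V. (AE p in lborel. f p = g p) \<longrightarrow>
        (\<forall>j. ev f (lattice_pt j) = ev g (lattice_pt j))) \<and>
     (\<forall>f\<in>V. continuous_on UNIV f \<longrightarrow> (\<forall>j. ev f (lattice_pt j) = f (lattice_pt j)))"

definition unit_cube :: "'n::finite heis set" where
  "unit_cube = {(x, y, t). (\<forall>i. x $ i \<in> {0..<1}) \<and> (\<forall>i. y $ i \<in> {0..<1}) \<and> t \<in> {0..<1}}"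

text \<open>\<open>F\<close> is (a representative of) the 1-periodic sum of the Fourier series with coefficients \<open>c\<close>.\<close>

definition fourier_series_sum :: "(int \<Rightarrow> complex) \<Rightarrow> (real \<Rightarrow> complex) \<Rightarrow> bool" where
  "fourier_series_sum c F \<longleftrightarrow>
     (\<forall>\<omega>. F (\<omega> + 1) = F \<omega>) \<and>
     F \<in> L2 (restrict_space lborel {0<..<1}) \<and>
     l2_has_sum (restrict_space lborel {0<..<1})
       (\<lambda>m \<omega>. c m * exp (2 * of_real pi * \<i> * of_int m * of_real \<omega>)) F"

end

(*
  On the Fourier side the operator phi^(lambda) is the integral operator whose kernel is the
  Fourier transform of phi in (x, t), evaluated at (lambda (xi + eta) / 2, eta - xi, lambda).
  Plancherel's theorem in (x, t) therefore shows that the Fourier coefficients of G_{k,l} are the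
  inner products of phi with its lattice translates. Condition C makes translates with different
  (k,l) orthogonal, and G_{0,0} is the weight w_phi with
    || sum_m c_m L_(0,0,m) phi ||^2 = int_0^1 w_phi |sum_m c_m e^{2 pi i m lambda}|^2 d lambda;
  the frame property says that w_phi lies between two positive constants wherever it is nonzero.
  Part (ii) is the uniform boundedness principle on l^2. Sampling f = phi gives
  w_phi = ||P||^2 w_psi, hence the bounds of (iii) on Omega_phi. Outside Omega_phi: if c is the
  coefficient sequence of the indicator of the complement, then sum_m c_m L_(0,0,m) phi is
  continuous with norm 0, so it vanishes at all lattice points, which forces P_{k,l} = 0 there.
*)
theory Submission
  imports Defs
begin


section \<open>The space of square integrable functions\<close>

text \<open>The obstacle is that the objects are known only weakly. \<open>gft\<close> is a choice,
  pinned down for almost every frequency and there only on the basis functions, and a periodized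
  weight is merely integrable. Three devices answer this. A kernel operator has Hilbert--Schmidt
  norm equal to the L2 norm of its kernel, and the Jacobian of the kernel substitution is exactly
  |lambda|^n, so the weight of the Plancherel measure is absorbed. Uniqueness of Fourier
  coefficients is proved for integrable functions, so two weights agree as soon as their
  coefficients do. And a weight is treated as a possibly unbounded multiplication operator until the
  frame inequality, tested on finite combinations of central translates, bounds it. The identity
  w_phi = ||P||^2 w_psi is likewise read off from coefficients: orthogonality makes <phi, L_(2k,l,m)
  psi> the m-th coefficient of w_psi P_(k,l), and a second Parseval sum produces the coefficients of
  w_phi. Dividing by w_psi gives the constants A_phi / B_psi and B_phi / A_psi.\<close>

lemma borel_measurable_cnj [measurable (raw)]:
  "f \<in> borel_measurable M \<Longrightarrow> (\<lambda>x. cnj (f x)) \<in> borel_measurable M"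
  by (rule borel_measurable_continuous_on[OF continuous_on_cnj[OF continuous_on_id]])

lemma L2_measurable [measurable_dest]: "f \<in> L2 M \<Longrightarrow> f \<in> borel_measurable M"
  by (simp add: L2_def)

lemma L2_lborel_measurable: "f \<in> L2 lborel \<Longrightarrow> f \<in> borel_measurable borel"
  by (simp add: L2_def)

lemma L2_integrable: "f \<in> L2 M \<Longrightarrow> integrable M (\<lambda>x. (cmod (f x))\<^sup>2)"
  by (simp add: L2_def)

lemma L2_iff_nn_integral:
  "f \<in> L2 M \<longleftrightarrow> f \<in> borel_measurable M \<and> (\<integral>\<^sup>+x. ennreal ((cmod (f x))\<^sup>2) \<partial>M) < \<infinity>"
  unfolding L2_def by (auto simp: integrable_iff_bounded)

lemma L2_inner_integrable:
  assumes "f \<in> L2 M" "g \<in> L2 M"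
  shows "integrable M (\<lambda>x. f x * cnj (g x))"
proof (rule Bochner_Integration.integrable_bound)
  show "integrable M (\<lambda>x. (cmod (f x))\<^sup>2 + (cmod (g x))\<^sup>2)"
    using assms by (intro Bochner_Integration.integrable_add L2_integrable)
  show "(\<lambda>x. f x * cnj (g x)) \<in> borel_measurable M"
    using assms[THEN L2_measurable] by measurable
  have "2 * (cmod (f x) * cmod (g x)) \<le> (cmod (f x))\<^sup>2 + (cmod (g x))\<^sup>2" for x
    using sum_squares_bound[of "cmod (f x)" "cmod (g x)"] by simp
  moreover have "0 \<le> cmod (f x) * cmod (g x)" for x by simp
  ultimately show "AE x in M. norm (f x * cnj (g x)) \<le> norm ((cmod (f x))\<^sup>2 + (cmod (g x))\<^sup>2)"
    by (intro AE_I2) (smt (verit) complex_mod_cnj norm_mult real_norm_def)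
qed

lemma L2_cnj: "f \<in> L2 M \<Longrightarrow> (\<lambda>x. cnj (f x)) \<in> L2 M"
  unfolding L2_def by auto

lemma L2_mult_integrable:
  assumes "f \<in> L2 M" "g \<in> L2 M"
  shows "integrable M (\<lambda>x. f x * g x)"
  using L2_inner_integrable[OF assms(1) L2_cnj[OF assms(2)]] by simp

lemma L2_zero [simp, intro]: "(\<lambda>x. 0) \<in> L2 M"
  by (simp add: L2_def)

lemma L2_add:
  assumes "f \<in> L2 M" "g \<in> L2 M"
  shows "(\<lambda>x. f x + g x) \<in> L2 M"
  unfolding L2_def
proof (safe)
  show "(\<lambda>x. f x + g x) \<in> borel_measurable M" 
    using assms[THEN L2_measurable] by measurable
  show "integrable M (\<lambda>x. (cmod (f x + g x))\<^sup>2)"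
  proof (rule Bochner_Integration.integrable_bound)
    show "integrable M (\<lambda>x. 2 * ((cmod (f x))\<^sup>2 + (cmod (g x))\<^sup>2))"
      using assms by (intro integrable_mult_right Bochner_Integration.integrable_add L2_integrable)
    show "(\<lambda>x. (cmod (f x + g x))\<^sup>2) \<in> borel_measurable M"
      using assms[THEN L2_measurable] by measurable
    have "(cmod (f x + g x))\<^sup>2 \<le> 2 * ((cmod (f x))\<^sup>2 + (cmod (g x))\<^sup>2)" for x
    proof -
      have "(cmod (f x + g x))\<^sup>2 \<le> (cmod (f x) + cmod (g x))\<^sup>2"
        by (intro power_mono norm_triangle_ineq) auto
      also have "\<dots> \<le> 2 * ((cmod (f x))\<^sup>2 + (cmod (g x))\<^sup>2)"
        using sum_squares_bound[of "cmod (f x)" "cmod (g x)"] by (simp add: power2_sum)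
      finally show ?thesis .
    qed
    then show "AE x in M. norm ((cmod (f x + g x))\<^sup>2) \<le> norm (2 * ((cmod (f x))\<^sup>2 + (cmod (g x))\<^sup>2))"
      by auto
  qed
qed

lemma L2_scale: "f \<in> L2 M \<Longrightarrow> (\<lambda>x. c * f x) \<in> L2 M"
  unfolding L2_def by (auto simp: norm_mult power_mult_distrib)

lemma L2_diff:
  assumes "f \<in> L2 M" "g \<in> L2 M"
  shows "(\<lambda>x. f x - g x) \<in> L2 M"
  using L2_add[OF assms(1) L2_scale[OF assms(2), of "-1"]] by simp

lemma L2_sum: "(\<And>i. i \<in> I \<Longrightarrow> f i \<in> L2 M) \<Longrightarrow> (\<lambda>x. \<Sum>i\<in>I. f i x) \<in> L2 M"
  by (induction I rule: infinite_finite_induct) (auto intro!: L2_add)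

lemma L2_cong_AE:
  assumes "f \<in> L2 M" "g \<in> borel_measurable M" "AE x in M. f x = g x"
  shows "g \<in> L2 M"
proof -
  have "(\<integral>\<^sup>+x. ennreal ((cmod (g x))\<^sup>2) \<partial>M) = (\<integral>\<^sup>+x. ennreal ((cmod (f x))\<^sup>2) \<partial>M)"
    using assms(3) by (intro nn_integral_cong_AE) auto
  then show ?thesis using assms by (auto simp: L2_iff_nn_integral)
qed

lemma L2_bounded_mult:
  assumes "f \<in> L2 M" "b \<in> borel_measurable M" "\<And>x. x \<in> space M \<Longrightarrow> cmod (b x) \<le> C"
  shows "(\<lambda>x. b x * f x) \<in> L2 M"
  unfolding L2_def
proof (safe)
  show "(\<lambda>x. b x * f x) \<in> borel_measurable M" 
    using assms(2) assms(1)[THEN L2_measurable] by measurable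
  show "integrable M (\<lambda>x. (cmod (b x * f x))\<^sup>2)"
  proof (rule Bochner_Integration.integrable_bound)
    show "integrable M (\<lambda>x. C\<^sup>2 * (cmod (f x))\<^sup>2)"
      using assms by (intro integrable_mult_right L2_integrable)
    show "(\<lambda>x. (cmod (b x * f x))\<^sup>2) \<in> borel_measurable M"
      using assms(2) assms(1)[THEN L2_measurable] by measurable
    show "AE x in M. norm ((cmod (b x * f x))\<^sup>2) \<le> norm (C\<^sup>2 * (cmod (f x))\<^sup>2)"
      using assms(3) by (auto simp: norm_mult power_mult_distrib intro!: mult_right_mono power_mono)
  qed
qed

lemma l2_inner_commute: "l2_inner M g f = cnj (l2_inner M f g)"
  unfolding l2_inner_def using Bochner_Integration.integral_cnj[of M "\<lambda>x. f x * cnj (g x)"] by (simp add: mult.commute)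

lemma l2_inner_add_left:
  assumes "f \<in> L2 M" "g \<in> L2 M" "h \<in> L2 M"
  shows "l2_inner M (\<lambda>x. f x + g x) h = l2_inner M f h + l2_inner M g h"
  unfolding l2_inner_def
  using assms by (simp add: ring_distribs L2_inner_integrable)

lemma l2_inner_scale_left: "l2_inner M (\<lambda>x. c * f x) h = c * l2_inner M f h"
  unfolding l2_inner_def by (simp add: mult.assoc)

lemma l2_inner_scale_right: "l2_inner M f (\<lambda>x. c * h x) = cnj c * l2_inner M f h"
  by (subst (1 2) l2_inner_commute) (simp add: l2_inner_scale_left)

lemma l2_inner_diff_left:
  assumes "f \<in> L2 M" "g \<in> L2 M" "h \<in> L2 M"
  shows "l2_inner M (\<lambda>x. f x - g x) h = l2_inner M f h - l2_inner M g h"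
  unfolding l2_inner_def
  using assms by (simp add: ring_distribs L2_inner_integrable)

lemma l2_inner_add_right:
  assumes "f \<in> L2 M" "g \<in> L2 M" "h \<in> L2 M"
  shows "l2_inner M h (\<lambda>x. f x + g x) = l2_inner M h f + l2_inner M h g"
  unfolding l2_inner_def
  using assms by (simp add: ring_distribs L2_inner_integrable)

lemma l2_inner_diff_right:
  assumes "f \<in> L2 M" "g \<in> L2 M" "h \<in> L2 M"
  shows "l2_inner M h (\<lambda>x. f x - g x) = l2_inner M h f - l2_inner M h g"
  unfolding l2_inner_def
  using assms by (simp add: ring_distribs L2_inner_integrable)

lemma l2_inner_zero [simp]: "l2_inner M (\<lambda>x. 0) f = 0" "l2_inner M f (\<lambda>x. 0) = 0"
  by (simp_all add: l2_inner_def)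

lemma l2_inner_sum_left:
  assumes "\<And>i. i \<in> I \<Longrightarrow> f i \<in> L2 M" "h \<in> L2 M"
  shows "l2_inner M (\<lambda>x. \<Sum>i\<in>I. f i x) h = (\<Sum>i\<in>I. l2_inner M (f i) h)"
  using assms
  by (induction I rule: infinite_finite_induct) (auto simp: l2_inner_add_left L2_sum)

lemma l2_inner_sum_right:
  assumes "\<And>i. i \<in> I \<Longrightarrow> f i \<in> L2 M" "h \<in> L2 M"
  shows "l2_inner M h (\<lambda>x. \<Sum>i\<in>I. f i x) = (\<Sum>i\<in>I. l2_inner M h (f i))"
  using assms
  by (induction I rule: infinite_finite_induct) (auto simp: l2_inner_add_right L2_sum)

lemma l2_inner_cong_AE:
  assumes "f \<in> borel_measurable M" "f' \<in> borel_measurable M" "g \<in> borel_measurable M" "g' \<in> borel_measurable M"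
    and "AE x in M. f x = f' x" "AE x in M. g x = g' x"
  shows "l2_inner M f g = l2_inner M f' g'"
  unfolding l2_inner_def using assms
  by (intro integral_cong_AE) auto

lemma l2_norm_nonneg [simp]: "0 \<le> l2_norm M f"
  by (simp add: l2_norm_def)

lemma l2_norm_sq: "(l2_norm M f)\<^sup>2 = (LINT x|M. (cmod (f x))\<^sup>2)"
  by (simp add: l2_norm_def)

lemma l2_inner_self: "l2_inner M f f = of_real ((l2_norm M f)\<^sup>2)"
  unfolding l2_norm_sq l2_inner_def
  by (simp only: complex_norm_square[symmetric] integral_complex_of_real)

lemma nn_integral_l2_norm:
  "f \<in> L2 M \<Longrightarrow> (\<integral>\<^sup>+x. ennreal ((cmod (f x))\<^sup>2) \<partial>M) = ennreal ((l2_norm M f)\<^sup>2)"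
  unfolding l2_norm_sq by (intro nn_integral_eq_integral L2_integrable) auto

lemma l2_norm_cong_AE:
  assumes "f \<in> borel_measurable M" "g \<in> borel_measurable M" "AE x in M. f x = g x"
  shows "l2_norm M f = l2_norm M g"
  unfolding l2_norm_def using assms by (intro arg_cong[where f=sqrt] integral_cong_AE) auto

lemma l2_norm_zero [simp]: "l2_norm M (\<lambda>x. 0) = 0"
  by (simp add: l2_norm_def)

lemma l2_norm_scale: "l2_norm M (\<lambda>x. c * f x) = cmod c * l2_norm M f"
  unfolding l2_norm_def by (simp add: norm_mult power_mult_distrib real_sqrt_mult)

lemma l2_norm_minus_commute: "l2_norm M (\<lambda>x. f x - g x) = l2_norm M (\<lambda>x. g x - f x)"
  unfolding l2_norm_def by (simp add: norm_minus_commute)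

lemma l2_norm_add_sq:
  assumes "f \<in> L2 M" "g \<in> L2 M"
  shows "(l2_norm M (\<lambda>x. f x + g x))\<^sup>2 = (l2_norm M f)\<^sup>2 + 2 * Re (l2_inner M f g) + (l2_norm M g)\<^sup>2"
proof -
  have "complex_of_real ((l2_norm M (\<lambda>x. f x + g x))\<^sup>2) = 
     l2_inner M f f + l2_inner M f g + cnj (l2_inner M f g) + l2_inner M g g"
    using assms unfolding l2_inner_self[symmetric]
    by (simp add: l2_inner_add_left l2_inner_add_right L2_add l2_inner_commute[of M g f])
  from arg_cong[OF this, of Re] show ?thesis
    by (simp add: l2_inner_self del: of_real_power)
qed

lemma l2_norm_diff_sq:
  assumes "f \<in> L2 M" "g \<in> L2 M"
  shows "(l2_norm M (\<lambda>x. f x - g x))\<^sup>2 = (l2_norm M f)\<^sup>2 - 2 * Re (l2_inner M f g) + (l2_norm M g)\<^sup>2"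
  using l2_norm_add_sq[OF assms(1) L2_scale[OF assms(2), of "-1"]]
  by (simp add: l2_norm_scale[of M "-1", simplified] l2_inner_scale_right[of M f "-1", simplified])

text \<open>The quadratic ||f - t <f,g> g||^2 is nonnegative for every real t. Functions stand for
  classes, so ||g|| = 0 does not give g = 0 and needs its own choice of t.\<close>

lemma l2_Cauchy_Schwarz:
  assumes f: "f \<in> L2 M" and g: "g \<in> L2 M"
  shows "cmod (l2_inner M f g) \<le> l2_norm M f * l2_norm M g"
proof -
  let ?z = "l2_inner M f g"
  have *: "0 \<le> (l2_norm M f)\<^sup>2 - 2 * t * (cmod ?z)\<^sup>2 + t\<^sup>2 * (cmod ?z)\<^sup>2 * (l2_norm M g)\<^sup>2" for t :: real
  proof -
    have "Re (cnj (of_real t * ?z) * ?z) = t * (cmod ?z)\<^sup>2"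
      by (simp add: cmod_power2) (simp add: power2_eq_square algebra_simps)
    moreover have "(cmod ?z)\<^sup>2 = Re ?z * Re ?z + Im ?z * Im ?z"
      using cmod_power2[of ?z] by (simp only: power2_eq_square)
    ultimately show ?thesis
      using l2_norm_diff_sq[OF f L2_scale[OF g], of "of_real t * ?z"]
        zero_le_power2[of "l2_norm M (\<lambda>x. f x - of_real t * ?z * g x)"]
      by (simp add: l2_norm_scale l2_inner_scale_right norm_mult power_mult_distrib mult.assoc del: zero_le_power2)
  qed
  show ?thesis
  proof (cases "l2_norm M g = 0")
    case True
    have "?z = 0"
    proof (rule ccontr)
      assume "?z \<noteq> 0"
      then have p: "(cmod ?z)\<^sup>2 > 0" by simp
      \<comment> \<open>With ||g|| = 0 this t makes the quadratic equal to -1.\<close>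
      with *[of "((l2_norm M f)\<^sup>2 + 1) / (2 * (cmod ?z)\<^sup>2)"] True \<open>?z \<noteq> 0\<close> show False
        by simp
    qed
    then show ?thesis by simp
  next
    case False
    then have p: "(l2_norm M g)\<^sup>2 > 0" by simp
    have "F - 2 * (1 / G) * Z + (1 / G)\<^sup>2 * Z * G = F - Z / G" if "G \<noteq> 0" for F G Z :: real
      using that by (simp add: power2_eq_square)
    from *[of "1 / (l2_norm M g)\<^sup>2"] this[of "(l2_norm M g)\<^sup>2" "(l2_norm M f)\<^sup>2" "(cmod ?z)\<^sup>2"] p
    have "(cmod ?z)\<^sup>2 / (l2_norm M g)\<^sup>2 \<le> (l2_norm M f)\<^sup>2"
      by simp
    then have "(cmod ?z)\<^sup>2 \<le> (l2_norm M f * l2_norm M g)\<^sup>2"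
      using p by (simp add: field_simps power_mult_distrib)
    then show ?thesis
      by (meson l2_norm_nonneg mult_nonneg_nonneg power2_le_imp_le)
  qed
qed

lemma l2_norm_triangle:
  assumes "f \<in> L2 M" "g \<in> L2 M"
  shows "l2_norm M (\<lambda>x. f x + g x) \<le> l2_norm M f + l2_norm M g"
proof (rule power2_le_imp_le)
  have "Re (l2_inner M f g) \<le> l2_norm M f * l2_norm M g"
    using l2_Cauchy_Schwarz[OF assms] complex_Re_le_cmod order_trans by blast
  then show "(l2_norm M (\<lambda>x. f x + g x))\<^sup>2 \<le> (l2_norm M f + l2_norm M g)\<^sup>2"
    using l2_norm_add_sq[OF assms] by (simp add: power2_sum)
qed auto

lemma l2_norm_triangle_diff:
  assumes "f \<in> L2 M" "g \<in> L2 M" "h \<in> L2 M"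
  shows "l2_norm M (\<lambda>x. f x - h x) \<le> l2_norm M (\<lambda>x. f x - g x) + l2_norm M (\<lambda>x. g x - h x)"
  using l2_norm_triangle[OF L2_diff[OF assms(1,2)] L2_diff[OF assms(2,3)]] by simp

lemma l2_norm_triangle':
  assumes "f \<in> L2 M" "g \<in> L2 M"
  shows "\<bar>l2_norm M f - l2_norm M g\<bar> \<le> l2_norm M (\<lambda>x. f x - g x)"
  using l2_norm_triangle_diff[OF assms L2_zero] l2_norm_triangle_diff[OF assms(2,1) L2_zero]
    l2_norm_minus_commute[of M f g] by simp

lemma l2_norm_cmod_eq: "l2_norm M (\<lambda>x. of_real (cmod (f x))) = l2_norm M f"
  by (simp add: l2_norm_def)

lemma l2_norm_sum:
  assumes "\<And>i. i \<in> I \<Longrightarrow> f i \<in> L2 M"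
  shows "l2_norm M (\<lambda>x. \<Sum>i\<in>I. f i x) \<le> (\<Sum>i\<in>I. l2_norm M (f i))"
  using assms
proof (induction I rule: infinite_finite_induct)
  case (insert i I)
  then show ?case 
    using l2_norm_triangle[of "f i" M "\<lambda>x. \<Sum>i\<in>I. f i x"] L2_sum[of I f M] by fastforce
qed auto

section \<open>Limits in L2 and completeness\<close>

lemma tendsto_l2_inner:
  assumes lim: "((\<lambda>i. l2_norm M (\<lambda>x. f i x - g x)) \<longlongrightarrow> 0) F"
    and ev: "\<forall>\<^sub>F i in F. f i \<in> L2 M" and g: "g \<in> L2 M" and h: "h \<in> L2 M"
  shows "((\<lambda>i. l2_inner M (f i) h) \<longlongrightarrow> l2_inner M g h) F"
proof (subst tendsto_dist_iff, rule Lim_null_comparison)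
  show "((\<lambda>i. l2_norm M (\<lambda>x. f i x - g x) * l2_norm M h) \<longlongrightarrow> 0) F"
    using tendsto_mult_right[OF lim, of "l2_norm M h"] by simp
  show "\<forall>\<^sub>F i in F. norm (dist (l2_inner M (f i) h) (l2_inner M g h)) \<le> l2_norm M (\<lambda>x. f i x - g x) * l2_norm M h"
    using ev
  proof eventually_elim
    case (elim i)
    show ?case using l2_Cauchy_Schwarz[OF L2_diff[OF elim g] h] l2_inner_diff_left[OF elim g h]
      by (simp add: dist_norm)
  qed
qed

lemma tendsto_l2_inner2:
  assumes lim: "((\<lambda>i. l2_norm M (\<lambda>x. f i x - g x)) \<longlongrightarrow> 0) F"
    and lim': "((\<lambda>i. l2_norm M (\<lambda>x. f' i x - g' x)) \<longlongrightarrow> 0) F"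
    and L: "\<And>i. f i \<in> L2 M" "g \<in> L2 M" "\<And>i. f' i \<in> L2 M" "g' \<in> L2 M"
  shows "((\<lambda>i. l2_inner M (f i) (f' i)) \<longlongrightarrow> l2_inner M g g') F"
proof -
  \<comment> \<open>The inner product is split into one with a fixed right factor, a product of two
    null sequences, and one with a fixed left factor.\<close>
  have "((\<lambda>i. l2_inner M (f i) g' + l2_inner M (\<lambda>x. f i x - g x) (\<lambda>x. f' i x - g' x) + l2_inner M g (\<lambda>x. f' i x - g' x)) \<longlongrightarrow> l2_inner M g g' + 0 + 0) F"
  proof (intro tendsto_add tendsto_l2_inner[OF lim] always_eventually allI L)
    show "((\<lambda>i. l2_inner M (\<lambda>x. f i x - g x) (\<lambda>x. f' i x - g' x)) \<longlongrightarrow> 0) F"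
      by (rule Lim_null_comparison[OF _ tendsto_mult[OF lim lim', simplified]])
        (auto intro!: always_eventually l2_Cauchy_Schwarz L2_diff L)
    show "((\<lambda>i. l2_inner M g (\<lambda>x. f' i x - g' x)) \<longlongrightarrow> 0) F"
      by (rule Lim_null_comparison[OF _ tendsto_mult[OF tendsto_const[of "l2_norm M g"] lim', simplified]])
        (auto intro!: always_eventually l2_Cauchy_Schwarz L2_diff L)
  qed
  moreover have "l2_inner M (f i) g' + l2_inner M (\<lambda>x. f i x - g x) (\<lambda>x. f' i x - g' x) + l2_inner M g (\<lambda>x. f' i x - g' x)
     = l2_inner M (f i) (f' i)" for i
    by (simp add: l2_inner_diff_left l2_inner_diff_right L L2_diff)
  ultimately show ?thesis by simp
qed

lemma tendsto_l2_norm: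
  assumes lim: "((\<lambda>i. l2_norm M (\<lambda>x. f i x - g x)) \<longlongrightarrow> 0) F"
    and L: "\<forall>\<^sub>F i in F. f i \<in> L2 M" "g \<in> L2 M"
  shows "((\<lambda>i. l2_norm M (f i)) \<longlongrightarrow> l2_norm M g) F"
proof (subst tendsto_dist_iff, rule Lim_null_comparison[OF _ lim])
  show "\<forall>\<^sub>F i in F. norm (dist (l2_norm M (f i)) (l2_norm M g)) \<le> l2_norm M (\<lambda>x. f i x - g x)"
    using L(1) by eventually_elim (use l2_norm_triangle' L in \<open>auto simp: dist_real_def\<close>)
qed

lemma l2_AE_subseq:
  assumes L: "\<And>i. f i \<in> L2 M" "g \<in> L2 M"
    and lim: "(\<lambda>i. l2_norm M (\<lambda>x. f i x - g x)) \<longlonglongrightarrow> 0"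
  shows "\<exists>r::nat\<Rightarrow>nat. strict_mono r \<and> (AE x in M. (\<lambda>n. f (r n) x) \<longlonglongrightarrow> g x)"
proof -
  have "\<exists>r::nat\<Rightarrow>nat. strict_mono r \<and> (AE x in M. (\<lambda>n. (cmod (f (r n) x - g x))\<^sup>2) \<longlonglongrightarrow> 0)"
  proof (rule tendsto_L1_AE_subseq)
    show "integrable M (\<lambda>x. (cmod (f n x - g x))\<^sup>2)" for n
      by (intro L2_integrable L2_diff L)
    show "(\<lambda>n. LINT x|M. norm ((cmod (f n x - g x))\<^sup>2)) \<longlonglongrightarrow> 0"
      using tendsto_power[OF lim, of 2] by (simp add: l2_norm_sq)
  qed
  then obtain r :: "nat \<Rightarrow> nat" where r: "strict_mono r" "AE x in M. (\<lambda>n. (cmod (f (r n) x - g x))\<^sup>2) \<longlonglongrightarrow> 0"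
    by blast
  have "(\<lambda>n. f (r n) x) \<longlonglongrightarrow> g x" if "(\<lambda>n. (cmod (f (r n) x - g x))\<^sup>2) \<longlonglongrightarrow> 0" for x
    using tendsto_real_sqrt[OF that] by (simp add: tendsto_norm_zero_iff LIM_zero_iff)
  with r show ?thesis by (auto elim!: AE_mp)
qed

text \<open>Lets a norm bound survive a limit that is known only pointwise almost everywhere. Square
  integrability of the limit is part of the conclusion, which is how it is obtained for functions
  not yet known to be in \<open>L2\<close>.\<close>

lemma l2_Fatou:
  assumes f: "\<And>i. f i \<in> L2 M" and b: "\<And>i. l2_norm M (f i) \<le> C"
    and g: "g \<in> borel_measurable M" and lim: "AE x in M. (\<lambda>i. f i x) \<longlonglongrightarrow> g x"
  shows "g \<in> L2 M" "l2_norm M g \<le> C"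
proof -
  have C: "0 \<le> C" using b[of 0] l2_norm_nonneg[of M "f 0"] by linarith
  have "(\<integral>\<^sup>+x. ennreal ((cmod (g x))\<^sup>2) \<partial>M) \<le> (\<integral>\<^sup>+x. liminf (\<lambda>i. ennreal ((cmod (f i x))\<^sup>2)) \<partial>M)"
    using lim
  proof (intro nn_integral_mono_AE, eventually_elim)
    case (elim x)
    then have "(\<lambda>i. ennreal ((cmod (f i x))\<^sup>2)) \<longlonglongrightarrow> ennreal ((cmod (g x))\<^sup>2)"
      by (intro tendsto_intros)
    from lim_imp_Liminf[OF sequentially_bot this] show ?case by simp
  qed
  also have "\<dots> \<le> liminf (\<lambda>i. \<integral>\<^sup>+x. ennreal ((cmod (f i x))\<^sup>2) \<partial>M)"
    using f[THEN L2_measurable] by (intro nn_integral_liminf) measurable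
  also have "\<dots> \<le> ennreal (C\<^sup>2)"
    unfolding nn_integral_l2_norm[OF f]
    by (intro Liminf_le always_eventually allI ennreal_leI power_mono b) auto
  finally have *: "(\<integral>\<^sup>+x. ennreal ((cmod (g x))\<^sup>2) \<partial>M) \<le> ennreal (C\<^sup>2)" .
  then show gL: "g \<in> L2 M"
    using g by (auto simp: L2_iff_nn_integral order_le_less_trans)
  show "l2_norm M g \<le> C"
    using * unfolding nn_integral_l2_norm[OF gL] using C by (auto intro: power2_le_imp_le)
qed

text \<open>With geometrically small increments the sequence converges almost everywhere, because
  the sum of the moduli of the increments is square integrable and hence finite almost
  everywhere.\<close>

lemma Riesz_Fischer_fast:
  assumes f: "\<And>i. f i \<in> L2 M" and b: "\<And>i. l2_norm M (\<lambda>x. f (Suc i) x - f i x) \<le> (1/2)^i"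
  shows "\<exists>g\<in>L2 M. (\<lambda>i. l2_norm M (\<lambda>x. f i x - g x)) \<longlonglongrightarrow> 0"
proof -
  note [measurable] = f[THEN L2_measurable]
  \<comment> \<open>An increasing majorant of the telescoping series. The geometric series bounds
    its norm by 2 uniformly in n, so monotone convergence applies to its square.\<close>
  define S where "S n x = (\<Sum>i<n. cmod (f (Suc i) x - f i x))" for n x
  have SL: "(\<lambda>x. of_real (S n x)) \<in> L2 M" and Sn: "l2_norm M (\<lambda>x. of_real (S n x)) \<le> 2" for n
  proof -
    have L: "(\<lambda>x. of_real (cmod (f (Suc i) x - f i x))) \<in> L2 M" for i
      using L2_diff[OF f f, of "Suc i" i] unfolding L2_def by auto
    show "(\<lambda>x. of_real (S n x)) \<in> L2 M"
      unfolding S_def of_real_sum by (intro L2_sum L)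
    have "l2_norm M (\<lambda>x. of_real (S n x)) \<le> (\<Sum>i<n. l2_norm M (\<lambda>x. of_real (cmod (f (Suc i) x - f i x))))"
      unfolding S_def of_real_sum by (intro l2_norm_sum L)
    also have "\<dots> \<le> (\<Sum>i<n. (1/2)^i)"
      unfolding l2_norm_cmod_eq by (intro sum_mono b)
    also have "\<dots> \<le> 2"
      by (simp add: sum_gp_strict)
    finally show "l2_norm M (\<lambda>x. of_real (S n x)) \<le> 2" .
  qed
  have "(\<integral>\<^sup>+x. (SUP n. ennreal ((S n x)\<^sup>2)) \<partial>M) = (SUP n. \<integral>\<^sup>+x. ennreal ((S n x)\<^sup>2) \<partial>M)"
  proof (rule nn_integral_monotone_convergence_SUP)
    show "incseq (\<lambda>n x. ennreal ((S n x)\<^sup>2))"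
      by (auto simp: incseq_def le_fun_def S_def intro!: ennreal_leI power_mono sum_mono2 sum_nonneg)
  qed (simp add: S_def)
  also have "\<dots> \<le> ennreal 4"
  proof (rule SUP_least)
    fix n
    have "(\<integral>\<^sup>+x. ennreal ((S n x)\<^sup>2) \<partial>M) = ennreal ((l2_norm M (\<lambda>x. of_real (S n x)))\<^sup>2)"
      using nn_integral_l2_norm[OF SL[of n]] by simp
    also have "\<dots> \<le> ennreal (2\<^sup>2)"
      by (intro ennreal_leI power_mono Sn) auto
    finally show "(\<integral>\<^sup>+x. ennreal ((S n x)\<^sup>2) \<partial>M) \<le> ennreal 4" by simp
  qed
  finally have "(\<integral>\<^sup>+x. (SUP n. ennreal ((S n x)\<^sup>2)) \<partial>M) \<noteq> \<infinity>"
    by (auto simp: top_unique)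
  then have "AE x in M. (SUP n. ennreal ((S n x)\<^sup>2)) \<noteq> \<infinity>"
    by (intro nn_integral_noteq_infinite) (auto simp: S_def)
  then have conv: "AE x in M. convergent (\<lambda>n. f n x)"
  proof eventually_elim
    case (elim x)
    then obtain K where K: "(SUP n. ennreal ((S n x)\<^sup>2)) = ennreal K" "0 \<le> K"
      by (cases "SUP n. ennreal ((S n x)\<^sup>2)") auto
    have "(S n x)\<^sup>2 \<le> K" for n
      using SUP_upper[of n UNIV "\<lambda>n. ennreal ((S n x)\<^sup>2)"] K by auto
    then have SK: "S n x \<le> sqrt K" for n
      by (meson real_le_rsqrt)
    have "summable (\<lambda>i. cmod (f (Suc i) x - f i x))"
      by (rule summableI_nonneg_bounded[where x="sqrt K"]) (use SK in \<open>auto simp: S_def\<close>)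
    then have "summable (\<lambda>i. f (Suc i) x - f i x)"
      by (rule summable_norm_cancel)
    then have "convergent (\<lambda>n. \<Sum>i<n. f (Suc i) x - f i x)"
      by (simp add: summable_iff_convergent)
    moreover have "(\<lambda>n. \<Sum>i<n. f (Suc i) x - f i x) = (\<lambda>n. f n x - f 0 x)"
      by (rule ext) (rule sum_lessThan_telescope)
    ultimately have "convergent (\<lambda>n. f n x - f 0 x)"
      by simp
    then have "convergent (\<lambda>n. (f n x - f 0 x) + f 0 x)"
      by (intro convergent_add convergent_const)
    then show ?case by simp
  qed
  define g where "g x = lim (\<lambda>n. f n x)" for x
  have gm[measurable]: "g \<in> borel_measurable M" unfolding g_def by measurable
  have lim: "AE x in M. (\<lambda>n. f n x) \<longlonglongrightarrow> g x"
    using conv by eventually_elim (simp add: g_def convergent_LIMSEQ_iff)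
  \<comment> \<open>The bound is uniform in k, so Fatou in k turns it into a bound for the distance
    from \<open>f n\<close> to the limit.\<close>
  have tail: "l2_norm M (\<lambda>x. f (n + k) x - f n x) \<le> 2 * (1/2)^n" for n k
  proof -
    have "l2_norm M (\<lambda>x. \<Sum>i<k. f (Suc (n + i)) x - f (n + i) x) \<le> (\<Sum>i<k. l2_norm M (\<lambda>x. f (Suc (n + i)) x - f (n + i) x))"
      by (intro l2_norm_sum L2_diff f)
    also have "\<dots> \<le> (\<Sum>i<k. (1/2)^(n+i))" by (intro sum_mono b)
    also have "\<dots> = (1/2)^n * (\<Sum>i<k. (1/2)^i)" by (simp add: power_add sum_distrib_left)
    also have "\<dots> \<le> (1/2)^n * 2" by (intro mult_left_mono) (auto simp: sum_gp_strict)
    finally have "l2_norm M (\<lambda>x. \<Sum>i<k. f (Suc (n + i)) x - f (n + i) x) \<le> (1/2)^n * 2" .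
    moreover have "(\<Sum>i<k. f (Suc (n + i)) x - f (n + i) x) = f (n + k) x - f n x" for x
      using sum_lessThan_telescope[of "\<lambda>i. f (n + i) x" k] by simp
    ultimately show ?thesis by (simp add: mult.commute)
  qed
  have d: "(\<lambda>x. f n x - g x) \<in> L2 M" "l2_norm M (\<lambda>x. f n x - g x) \<le> 2 * (1/2)^n" for n
  proof -
    have "AE x in M. (\<lambda>k. f n x - f (n + k) x) \<longlonglongrightarrow> f n x - g x"
      using lim
    proof eventually_elim
      case (elim x)
      then have "(\<lambda>k. f (k + n) x) \<longlonglongrightarrow> g x" by (rule LIMSEQ_ignore_initial_segment)
      then show ?case by (intro tendsto_diff tendsto_const) (simp add: add.commute)
    qed
    note lim' = this
    have a: "l2_norm M (\<lambda>x. f n x - f (n + k) x) \<le> 2 * (1/2)^n" for k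
      using tail[of n k] by (subst l2_norm_minus_commute)
    have b: "(\<lambda>x. f n x - f (n + k) x) \<in> L2 M" for k by (rule L2_diff[OF f f])
    have c: "(\<lambda>x. f n x - g x) \<in> borel_measurable M" by measurable
    show "(\<lambda>x. f n x - g x) \<in> L2 M" by (rule l2_Fatou(1)[OF b a c lim'])
    show "l2_norm M (\<lambda>x. f n x - g x) \<le> 2 * (1/2)^n" by (rule l2_Fatou(2)[OF b a c lim'])
  qed
  have "g \<in> L2 M" using L2_diff[OF f d(1), of 0 0] by simp
  moreover have "(\<lambda>n. l2_norm M (\<lambda>x. f n x - g x)) \<longlonglongrightarrow> 0"
  proof (rule Lim_null_comparison)
    show "(\<lambda>n. 2 * (1/2::real)^n) \<longlonglongrightarrow> 0"
      by (intro tendsto_mult_right_zero LIMSEQ_power_zero) auto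
  qed (use d(2) in auto)
  ultimately show ?thesis by blast
qed

theorem Riesz_Fischer:
  assumes f: "\<And>i::nat. f i \<in> L2 M"
    and C: "\<And>e. 0 < e \<Longrightarrow> \<exists>N. \<forall>m\<ge>N. \<forall>n\<ge>N. l2_norm M (\<lambda>x. f m x - f n x) < e"
  obtains g where "g \<in> L2 M" "(\<lambda>i. l2_norm M (\<lambda>x. f i x - g x)) \<longlonglongrightarrow> 0"
proof -
  obtain N where N: "\<And>k m n. m \<ge> N k \<Longrightarrow> n \<ge> N k \<Longrightarrow> l2_norm M (\<lambda>x. f m x - f n x) < (1/2)^k"
    using C[of "(1/2)^_"] by (metis zero_less_power half_gt_zero zero_less_one)
  \<comment> \<open>Partial sums of N make the indices nondecreasing while keeping
    \<open>r k\<close> at least \<open>N k\<close>.\<close>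
  define r where "r k = (\<Sum>i\<le>k. N i)" for k
  have r: "r (Suc k) \<ge> r k" "r k \<ge> N k" for k
    by (auto simp: r_def intro: member_le_sum)
  have "\<exists>g\<in>L2 M. (\<lambda>i. l2_norm M (\<lambda>x. f (r i) x - g x)) \<longlonglongrightarrow> 0"
  proof (intro Riesz_Fischer_fast f)
    fix k
    have "N k \<le> r (Suc k)" using r[of k] by simp
    then show "l2_norm M (\<lambda>x. f (r (Suc k)) x - f (r k) x) \<le> (1/2)^k"
      by (rule less_imp_le[OF N[OF _ r(2)]])
  qed
  then obtain g where g: "g \<in> L2 M" "(\<lambda>i. l2_norm M (\<lambda>x. f (r i) x - g x)) \<longlonglongrightarrow> 0" by blast
  have "(\<lambda>i. l2_norm M (\<lambda>x. f i x - g x)) \<longlonglongrightarrow> 0"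
  proof (rule LIMSEQ_I)
    fix e :: real assume e: "0 < e"
    have "(\<lambda>k. (1/2::real)^k + l2_norm M (\<lambda>x. f (r k) x - g x)) \<longlonglongrightarrow> 0 + 0"
      by (intro tendsto_add g LIMSEQ_power_zero) auto
    then have "\<forall>\<^sub>F k in sequentially. (1/2::real)^k + l2_norm M (\<lambda>x. f (r k) x - g x) < e"
      using e by (intro order_tendstoD(2)) auto
    then obtain k where k: "(1/2::real)^k + l2_norm M (\<lambda>x. f (r k) x - g x) < e"
      by (auto simp: eventually_sequentially)
    have "norm (l2_norm M (\<lambda>x. f i x - g x) - 0) < e" if "i \<ge> N k" for i
      using l2_norm_triangle_diff[OF f f g(1), of i "r k"] N[OF that r(2)] k by simp
    then show "\<exists>no. \<forall>n\<ge>no. norm (l2_norm M (\<lambda>x. f n x - g x) - 0) < e" by blast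
  qed
  with g(1) that show ?thesis by blast
qed

section \<open>Orthonormal families\<close>

definition l2_orthonormal :: "'a measure \<Rightarrow> 'i set \<Rightarrow> ('i \<Rightarrow> 'a \<Rightarrow> complex) \<Rightarrow> bool" where
  "l2_orthonormal M I e \<longleftrightarrow>
     (\<forall>i\<in>I. e i \<in> L2 M) \<and> (\<forall>i\<in>I. \<forall>j\<in>I. l2_inner M (e i) (e j) = (if i = j then 1 else 0))"

definition l2_total :: "'a measure \<Rightarrow> 'i set \<Rightarrow> ('i \<Rightarrow> 'a \<Rightarrow> complex) \<Rightarrow> bool" where
  "l2_total M I e \<longleftrightarrow> (\<forall>f\<in>L2 M. (\<forall>i\<in>I. l2_inner M f (e i) = 0) \<longrightarrow> (AE x in M. f x = 0))"

lemma l2_orthonormalD: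
  assumes "l2_orthonormal M I e"
  shows "i \<in> I \<Longrightarrow> e i \<in> L2 M"
    and "i \<in> I \<Longrightarrow> j \<in> I \<Longrightarrow> l2_inner M (e i) (e j) = (if i = j then 1 else 0)"
  using assms by (auto simp: l2_orthonormal_def)

context
  fixes M :: "'a measure" and I :: "'i set" and e :: "'i \<Rightarrow> 'a \<Rightarrow> complex"
  assumes on: "l2_orthonormal M I e"
begin

lemma orthonormal_sum_L2: "J \<subseteq> I \<Longrightarrow> (\<lambda>x. \<Sum>j\<in>J. c j * e j x) \<in> L2 M"
  using l2_orthonormalD[OF on] by (intro L2_sum L2_scale) auto

lemma orthonormal_sum_inner:
  assumes "J \<subseteq> I" "finite J" "g \<in> L2 M"
  shows "l2_inner M (\<lambda>x. \<Sum>j\<in>J. c j * e j x) g = (\<Sum>j\<in>J. c j * l2_inner M (e j) g)"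
  using assms l2_orthonormalD[OF on]
  by (subst l2_inner_sum_left) (auto simp: l2_inner_scale_left intro!: L2_scale)

lemma orthonormal_sum_coeff:
  assumes "J \<subseteq> I" "finite J" "i \<in> I"
  shows "l2_inner M (\<lambda>x. \<Sum>j\<in>J. c j * e j x) (e i) = (if i \<in> J then c i else 0)"
proof -
  have "l2_inner M (\<lambda>x. \<Sum>j\<in>J. c j * e j x) (e i) = (\<Sum>j\<in>J. c j * (if j = i then 1 else 0))"
    using assms l2_orthonormalD[OF on]
    by (subst orthonormal_sum_inner) (auto intro!: sum.cong)
  also have "\<dots> = (if i \<in> J then c i else 0)"
    using assms by (simp add: if_distrib sum.delta cong: if_cong)
  finally show ?thesis .
qed

lemma orthonormal_sum_norm:
  assumes "J \<subseteq> I" "finite J"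
  shows "(l2_norm M (\<lambda>x. \<Sum>j\<in>J. c j * e j x))\<^sup>2 = (\<Sum>j\<in>J. (cmod (c j))\<^sup>2)"
proof -
  let ?f = "\<lambda>x. \<Sum>j\<in>J. c j * e j x"
  have "l2_inner M ?f ?f = (\<Sum>j\<in>J. c j * l2_inner M (e j) ?f)"
    by (intro orthonormal_sum_inner orthonormal_sum_L2 assms)
  also have "\<dots> = (\<Sum>j\<in>J. c j * cnj (c j))"
    using assms by (intro sum.cong refl) (subst l2_inner_commute, subst orthonormal_sum_coeff, auto)
  finally have "complex_of_real ((l2_norm M ?f)\<^sup>2) = of_real (\<Sum>j\<in>J. (cmod (c j))\<^sup>2)"
    by (simp only: l2_inner_self complex_norm_square[symmetric] of_real_sum)
  then show ?thesis using of_real_eq_iff by blast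
qed

lemma orthonormal_diff_norm:
  assumes "J \<subseteq> I" "finite J" "f \<in> L2 M"
  shows "(l2_norm M (\<lambda>x. f x - (\<Sum>j\<in>J. l2_inner M f (e j) * e j x)))\<^sup>2
    = (l2_norm M f)\<^sup>2 - (\<Sum>j\<in>J. (cmod (l2_inner M f (e j)))\<^sup>2)"
proof -
  let ?c = "\<lambda>j. l2_inner M f (e j)"
  have "l2_inner M f (\<lambda>x. \<Sum>j\<in>J. ?c j * e j x) = cnj (\<Sum>j\<in>J. ?c j * l2_inner M (e j) f)"
    using assms by (subst l2_inner_commute, subst orthonormal_sum_inner) auto
  also have "\<dots> = cnj (\<Sum>j\<in>J. ?c j * cnj (?c j))"
    by (metis l2_inner_commute)
  also have "\<dots> = complex_of_real (\<Sum>j\<in>J. (cmod (?c j))\<^sup>2)"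
    by (simp only: complex_norm_square[symmetric] of_real_sum[symmetric] complex_cnj_complex_of_real)
  finally show ?thesis
    using l2_norm_diff_sq[OF assms(3) orthonormal_sum_L2[OF assms(1)], of ?c]
      orthonormal_sum_norm[OF assms(1,2), of ?c] by simp
qed

lemma Bessel_finite:
  assumes "J \<subseteq> I" "finite J" "f \<in> L2 M"
  shows "(\<Sum>j\<in>J. (cmod (l2_inner M f (e j)))\<^sup>2) \<le> (l2_norm M f)\<^sup>2"
  using orthonormal_diff_norm[OF assms] zero_le_power2
  by (metis (no_types, lifting) diff_ge_0_iff_ge)

lemma Bessel_summable:
  assumes "f \<in> L2 M"
  shows "(\<lambda>j. (cmod (l2_inner M f (e j)))\<^sup>2) summable_on I"
  by (rule nonneg_bdd_above_summable_on) (auto intro!: bdd_aboveI[where M="(l2_norm M f)\<^sup>2"] Bessel_finite assms)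

text \<open>The index set is arbitrary and convergence is along finite subsets, whereas completeness
  speaks of sequences. A sequence of finite sets with tails below 4^-n is therefore extracted; every
  larger finite set stays within 2^-n of it.\<close>

lemma Riesz_Fischer_orthonormal:
  assumes c: "(\<lambda>i. (cmod (c i))\<^sup>2) summable_on I"
  obtains f where "f \<in> L2 M"
    "((\<lambda>J. l2_norm M (\<lambda>x. (\<Sum>j\<in>J. c j * e j x) - f x)) \<longlongrightarrow> 0) (finite_subsets_at_top I)"
    "\<And>i. i \<in> I \<Longrightarrow> l2_inner M f (e i) = c i"
proof -
  let ?S = "\<lambda>J x. \<Sum>j\<in>J. c j * e j x"
  have tail: "\<exists>J. finite J \<and> J \<subseteq> I \<and> (\<forall>K. finite K \<and> K \<subseteq> I - J \<longrightarrow> (\<Sum>i\<in>K. (cmod (c i))\<^sup>2) < \<epsilon>)" if "0 < \<epsilon>" for \<epsilon>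
  proof -
    let ?s = "infsum (\<lambda>i. (cmod (c i))\<^sup>2) I"
    have "((\<lambda>i. (cmod (c i))\<^sup>2) has_sum ?s) I" using c by simp
    then have "\<forall>\<^sub>F J in finite_subsets_at_top I. (\<Sum>i\<in>J. (cmod (c i))\<^sup>2) > ?s - \<epsilon>"
      unfolding has_sum_def using that by (intro order_tendstoD(1)) auto
    then obtain J where J: "finite J" "J \<subseteq> I" "(\<Sum>i\<in>J. (cmod (c i))\<^sup>2) > ?s - \<epsilon>"
      by (auto simp: eventually_finite_subsets_at_top)
    have "(\<Sum>i\<in>K. (cmod (c i))\<^sup>2) < \<epsilon>" if "finite K" "K \<subseteq> I - J" for K
    proof -
      have "(\<Sum>i\<in>J \<union> K. (cmod (c i))\<^sup>2) \<le> ?s"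
        using that J by (intro finite_sum_le_infsum c) auto
      moreover have "(\<Sum>i\<in>J \<union> K. (cmod (c i))\<^sup>2) = (\<Sum>i\<in>J. (cmod (c i))\<^sup>2) + (\<Sum>i\<in>K. (cmod (c i))\<^sup>2)"
        using that J by (intro sum.union_disjoint) auto
      ultimately show ?thesis using J by linarith
    qed
    with J show ?thesis by blast
  qed
  have "\<exists>J. finite J \<and> J \<subseteq> I \<and> (\<forall>K. finite K \<and> K \<subseteq> I - J \<longrightarrow> (\<Sum>i\<in>K. (cmod (c i))\<^sup>2) < ((1/2)^n)\<^sup>2)" for n :: nat
    by (rule tail) simp
  then obtain J where J: "\<And>n. finite (J n)" "\<And>n. J n \<subseteq> I"
      "\<And>n K. finite K \<Longrightarrow> K \<subseteq> I - J n \<Longrightarrow> (\<Sum>i\<in>K. (cmod (c i))\<^sup>2) < ((1/2)^n)\<^sup>2"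
    by metis
  \<comment> \<open>Unions make the finite sets increasing, so that the sums over them form a Cauchy
    sequence.\<close>
  define K where "K n = (\<Union>i\<le>n. J i)" for n
  have K: "finite (K n)" "K n \<subseteq> I" "J n \<subseteq> K n" "n \<le> m \<Longrightarrow> K n \<subseteq> K m" for n m
    using J(1,2) by (auto simp: K_def) force
  have diff: "l2_norm M (\<lambda>x. ?S L x - ?S (K n) x) < (1/2)^n" if "finite L" "L \<subseteq> I" "K n \<subseteq> L" for L n
  proof -
    have "?S L x - ?S (K n) x = ?S (L - K n) x" for x
      using that by (simp add: sum_diff)
    then have "(l2_norm M (\<lambda>x. ?S L x - ?S (K n) x))\<^sup>2 = (\<Sum>i\<in>L - K n. (cmod (c i))\<^sup>2)"
      using that K by (simp only:, subst orthonormal_sum_norm) auto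
    also have "\<dots> < ((1/2)^n)\<^sup>2"
      using that K(3)[of n] by (intro J(3)) blast+
    finally show ?thesis by (rule power2_less_imp_less) auto
  qed
  have SL: "?S (K n) \<in> L2 M" for n by (intro orthonormal_sum_L2 K)
  obtain f where f: "f \<in> L2 M" "(\<lambda>n. l2_norm M (\<lambda>x. ?S (K n) x - f x)) \<longlonglongrightarrow> 0"
  proof (rule Riesz_Fischer[of "\<lambda>n. ?S (K n)" M])
    fix \<epsilon> :: real assume "0 < \<epsilon>"
    then obtain N where N: "(1/2::real)^N < \<epsilon> / 2"
      using real_arch_pow_inv[of "\<epsilon>/2" "1/2"] by auto
    have "l2_norm M (\<lambda>x. ?S (K m) x - ?S (K n) x) < \<epsilon>" if "m \<ge> N" "n \<ge> N" for m n
      using l2_norm_triangle_diff[OF SL[of m] SL[of N] SL[of n]] N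
        diff[OF K(1,2) K(4)[OF that(1)]] diff[OF K(1,2) K(4)[OF that(2)]]
        l2_norm_minus_commute[of M "?S (K n)" "?S (K N)"] by linarith
    then show "\<exists>N. \<forall>m\<ge>N. \<forall>n\<ge>N. l2_norm M (\<lambda>x. ?S (K m) x - ?S (K n) x) < \<epsilon>" by blast
  qed (rule SL)
  have lim: "((\<lambda>J. l2_norm M (\<lambda>x. ?S J x - f x)) \<longlongrightarrow> 0) (finite_subsets_at_top I)"
  proof (rule tendstoI)
    fix \<epsilon> :: real assume "0 < \<epsilon>"
    have "(\<lambda>n. (1/2)^n + l2_norm M (\<lambda>x. ?S (K n) x - f x)) \<longlonglongrightarrow> 0 + 0"
      by (intro tendsto_add f LIMSEQ_power_zero) auto
    then have "\<forall>\<^sub>F n in sequentially. (1/2)^n + l2_norm M (\<lambda>x. ?S (K n) x - f x) < \<epsilon>"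
      using \<open>0 < \<epsilon>\<close> by (intro order_tendstoD(2)) auto
    then obtain n where n: "(1/2)^n + l2_norm M (\<lambda>x. ?S (K n) x - f x) < \<epsilon>"
      by (auto simp: eventually_sequentially)
    show "\<forall>\<^sub>F J in finite_subsets_at_top I. dist (l2_norm M (\<lambda>x. ?S J x - f x)) 0 < \<epsilon>"
      unfolding eventually_finite_subsets_at_top
    proof (intro exI[of _ "K n"] conjI allI impI K)
      fix L assume L: "finite L \<and> K n \<subseteq> L \<and> L \<subseteq> I"
      then show "dist (l2_norm M (\<lambda>x. ?S L x - f x)) 0 < \<epsilon>"
        using diff[of L n] n l2_norm_triangle_diff[OF orthonormal_sum_L2[of L c] SL[of n] f(1)]
        by (simp add: dist_real_def)
    qed
  qed
  have "l2_inner M f (e i) = c i" if "i \<in> I" for i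
  proof (rule tendsto_unique[OF finite_subsets_at_top_neq_bot])
    show "((\<lambda>J. l2_inner M (?S J) (e i)) \<longlongrightarrow> l2_inner M f (e i)) (finite_subsets_at_top I)"
      using that l2_orthonormalD[OF on]
      by (intro tendsto_l2_inner[OF lim] f eventually_finite_subsets_at_top_weakI orthonormal_sum_L2) auto
    have "\<forall>\<^sub>F J in finite_subsets_at_top I. l2_inner M (?S J) (e i) = c i"
      unfolding eventually_finite_subsets_at_top
      by (intro exI[of _ "{i}"]) (use that in \<open>auto simp: orthonormal_sum_coeff\<close>)
    then show "((\<lambda>J. l2_inner M (?S J) (e i)) \<longlongrightarrow> c i) (finite_subsets_at_top I)"
      by (rule tendsto_eventually)
  qed
  with f(1) lim that show ?thesis by blast
qed

context
  assumes tot: "l2_total M I e"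
begin

text \<open>The expansion converges to some g by Riesz--Fischer; g has the same coefficients as f,
  so totality identifies the two almost everywhere.\<close>

lemma orthonormal_expansion:
  assumes f: "f \<in> L2 M"
  shows "((\<lambda>J. l2_norm M (\<lambda>x. (\<Sum>j\<in>J. l2_inner M f (e j) * e j x) - f x)) \<longlongrightarrow> 0) (finite_subsets_at_top I)"
proof -
  obtain g where g: "g \<in> L2 M"
    "((\<lambda>J. l2_norm M (\<lambda>x. (\<Sum>j\<in>J. l2_inner M f (e j) * e j x) - g x)) \<longlongrightarrow> 0) (finite_subsets_at_top I)"
    "\<And>i. i \<in> I \<Longrightarrow> l2_inner M g (e i) = l2_inner M f (e i)"
    by (rule Riesz_Fischer_orthonormal[OF Bessel_summable[OF f]]) (rule that)
  have "AE x in M. f x - g x = 0"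
    using tot[unfolded l2_total_def, rule_format, OF L2_diff[OF f g(1)]]
      l2_inner_diff_left[OF f g(1) l2_orthonormalD(1)[OF on]] g(3) by simp
  then have AE: "AE x in M. f x = g x" by simp
  have "\<forall>\<^sub>F J in finite_subsets_at_top I. l2_norm M (\<lambda>x. (\<Sum>j\<in>J. l2_inner M f (e j) * e j x) - g x)
     = l2_norm M (\<lambda>x. (\<Sum>j\<in>J. l2_inner M f (e j) * e j x) - f x)"
    using AE by (intro eventually_finite_subsets_at_top_weakI l2_norm_cong_AE L2_measurable L2_diff orthonormal_sum_L2 f g)
      auto
  then show ?thesis using g(2) by (rule tendsto_cong[THEN iffD1])
qed

lemma Parseval_inner:
  assumes f: "f \<in> L2 M" and g: "g \<in> L2 M"
  shows "((\<lambda>i. l2_inner M f (e i) * cnj (l2_inner M g (e i))) has_sum l2_inner M f g) I"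
  unfolding has_sum_def
proof (rule Lim_transform_eventually)
  show "((\<lambda>J. l2_inner M (\<lambda>x. \<Sum>j\<in>J. l2_inner M f (e j) * e j x) g) \<longlongrightarrow> l2_inner M f g) (finite_subsets_at_top I)"
    by (intro tendsto_l2_inner[OF orthonormal_expansion[OF f]] f g eventually_finite_subsets_at_top_weakI orthonormal_sum_L2)
  show "\<forall>\<^sub>F J in finite_subsets_at_top I. l2_inner M (\<lambda>x. \<Sum>j\<in>J. l2_inner M f (e j) * e j x) g 
     = (\<Sum>i\<in>J. l2_inner M f (e i) * cnj (l2_inner M g (e i)))"
    using g by (intro eventually_finite_subsets_at_top_weakI)
     (simp add: orthonormal_sum_inner flip: l2_inner_commute)
qed

lemma Parseval_norm:
  assumes f: "f \<in> L2 M"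
  shows "((\<lambda>i. (cmod (l2_inner M f (e i)))\<^sup>2) has_sum (l2_norm M f)\<^sup>2) I"
proof -
  have "((\<lambda>i. complex_of_real ((cmod (l2_inner M f (e i)))\<^sup>2)) has_sum of_real ((l2_norm M f)\<^sup>2)) I"
    using Parseval_inner[OF f f] by (simp only: l2_inner_self complex_norm_square[symmetric])
  then show ?thesis by (simp only: has_sum_of_real_iff)
qed

end

end

section \<open>Fourier series on the unit cube\<close>

text \<open>The exponent has the sign used in \<open>schroedinger_rep\<close>, so the transforms
  below carry no conjugation.\<close>

definition char_fun :: "'a::euclidean_space \<Rightarrow> 'a \<Rightarrow> complex" where
  "char_fun v x = cis (2 * pi * (v \<bullet> x))"

lemma char_fun_simps:
  "char_fun 0 x = 1" "char_fun v 0 = 1" "cmod (char_fun v x) = 1" "cnj (char_fun v x) = char_fun (- v) x"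
  "char_fun (- v) x = char_fun v (- x)"
  by (auto simp: char_fun_def cis_cnj)

lemma char_fun_add:
  "char_fun v (x + y) = char_fun v x * char_fun v y"
  "char_fun (v + w) x = char_fun v x * char_fun w x"
  by (auto simp: char_fun_def cis_mult inner_simps ring_distribs)

lemma char_fun_commute: "char_fun v x = char_fun x v"
  by (simp add: char_fun_def inner_commute)

lemma borel_measurable_char_fun [measurable (raw)]:
  assumes "f \<in> borel_measurable M" "g \<in> borel_measurable M"
  shows "(\<lambda>x. char_fun (f x) (g x)) \<in> borel_measurable M"
  unfolding char_fun_def cis_conv_exp using assms by measurable

text \<open>Coordinates refer to \<open>Basis\<close>, so one definition serves numbers, vectors and
  products. The lattice occurs both as the set of frequencies and as the set of translations that
  tile space by unit cubes.\<close>

definition int_vecs :: "'a::euclidean_space set" where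
  "int_vecs = {v. \<forall>b\<in>Basis. v \<bullet> b \<in> \<int>}"

lemma int_vecs_closed:
  "0 \<in> int_vecs" "v \<in> int_vecs \<Longrightarrow> w \<in> int_vecs \<Longrightarrow> v + w \<in> int_vecs"
  "v \<in> int_vecs \<Longrightarrow> - v \<in> int_vecs" "v \<in> int_vecs \<Longrightarrow> w \<in> int_vecs \<Longrightarrow> v - w \<in> int_vecs"
  "b \<in> Basis \<Longrightarrow> of_int m *\<^sub>R b \<in> int_vecs"
  by (auto simp: int_vecs_def inner_simps inner_Basis)

lemma int_vecs_real: "(int_vecs :: real set) = \<int>"
  by (simp add: int_vecs_def)

lemma countable_int_vecs: "countable (int_vecs :: 'a::euclidean_space set)"
proof -
  let ?f = "\<lambda>c::'a \<Rightarrow> int. \<Sum>b\<in>Basis. of_int (c b) *\<^sub>R b :: 'a"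
  have "int_vecs \<subseteq> ?f ` (PiE Basis (\<lambda>_. UNIV))"
  proof
    fix v :: 'a assume "v \<in> int_vecs"
    then have "\<forall>b\<in>Basis. \<exists>m. v \<bullet> b = of_int m" by (auto simp: int_vecs_def elim: Ints_cases)
    then obtain c where c: "\<And>b. b \<in> Basis \<Longrightarrow> v \<bullet> b = of_int (c b)" by metis
    have "v = ?f (restrict c Basis)"
      using euclidean_representation[of v] c by simp
    then show "v \<in> ?f ` (PiE Basis (\<lambda>_. UNIV))" by (intro image_eqI[of _ _ "restrict c Basis"]) auto
  qed
  moreover have "countable (PiE (Basis::'a set) (\<lambda>_. UNIV :: int set))"
    by (intro countable_PiE) auto
  ultimately show ?thesis by (rule countable_subset[OF _ countable_image])
qed

lemma infinite_int_vecs: "infinite (int_vecs :: 'a::euclidean_space set)"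
proof
  assume fin: "finite (int_vecs :: 'a set)"
  obtain b :: 'a where b: "b \<in> Basis" using nonempty_Basis by blast
  have "inj (\<lambda>m::int. of_int m *\<^sub>R b)" using b by (auto simp: inj_on_def)
  moreover have "range (\<lambda>m::int. of_int m *\<^sub>R b) \<subseteq> int_vecs" using b by (auto intro: int_vecs_closed)
  ultimately show False using fin finite_subset finite_imageD infinite_UNIV_int by blast
qed

lemma integral_indicator_complex: "(LINT x|M. (indicator A x :: complex)) = of_real (measure M (A \<inter> space M))"
proof -
  have "(LINT x|M. (indicator A x :: complex)) = (LINT x|M. complex_of_real (indicator A x))"
    by (intro Bochner_Integration.integral_cong refl) (simp add: indicator_def)
  then show ?thesis by (simp add: integral_complex_of_real)
qed

lemma integral_cis_unit_interval:
  assumes "c \<in> \<int>"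
  shows "(LINT t|lborel. indicator {0<..<1} t * cis (2 * pi * (c * t))) = (if c = 0 then 1 else 0)"
proof (cases "c = 0")
  case False
  let ?F = "\<lambda>t. cis (2 * pi * (c * t)) / (2 * pi * c * \<i>)"
  have "has_bochner_integral lborel (\<lambda>t. indicator {0..1} t *\<^sub>R cis (2 * pi * (c * t))) (?F 1 - ?F 0)"
  proof (rule has_bochner_integral_FTC_Icc)
    fix t :: real
    have "((\<lambda>z. exp (2 * pi * c * \<i> * z) / (2 * pi * c * \<i>)) has_field_derivative exp (2 * pi * c * \<i> * of_real t)) (at (of_real t))"
      using False by (auto intro!: derivative_eq_intros)
    from has_vector_derivative_real_field[OF this, of "{0..1}"]
    show "(?F has_vector_derivative cis (2 * pi * (c * t))) (at t within {0..1})"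
      by (simp add: cis_conv_exp mult_ac)
  next
    show "continuous_on {0..1} (\<lambda>t. cis (2 * pi * (c * t)))"
      unfolding cis_conv_exp by (intro continuous_intros)
  qed auto
  moreover have "?F 1 - ?F 0 = 0"
    using assms cis_multiple_2pi[of c] by (simp add: algebra_simps)
  ultimately have "(LINT t|lborel. indicator {0..1} t *\<^sub>R cis (2 * pi * (c * t))) = 0"
    using has_bochner_integral_integral_eq by force
  moreover have "(LINT t|lborel. indicator {0<..<1} t * cis (2 * pi * (c * t))) = (LINT t|lborel. indicator {0..1} t *\<^sub>R cis (2 * pi * (c * t)))"
  proof (rule integral_cong_AE)
    show "AE t in lborel. indicator {0<..<1} t * cis (2 * pi * (c * t)) = indicator {0..1} t *\<^sub>R cis (2 * pi * (c * t))"
      using AE_lborel_singleton[of 0] AE_lborel_singleton[of 1]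
      by eventually_elim (auto simp: indicator_def)
  qed (auto simp: cis_conv_exp)
  ultimately show ?thesis using False by simp
qed (simp add: integral_indicator_complex)

text \<open>The open cube differs from the closed one by a null set; in dimension one it is the
  interval \<open>{0<..<1}\<close> that \<open>fourier_series_sum\<close> uses.\<close>

abbreviation unit_box :: "'a::euclidean_space set" where "unit_box \<equiv> box 0 One"

abbreviation torus :: "'a::euclidean_space measure" where "torus \<equiv> restrict_space lborel unit_box"

lemma unit_box_real: "(unit_box :: real set) = {0<..<1}"
  by (simp add: box_real)

lemma integral_torus:
  fixes f :: "'a::euclidean_space \<Rightarrow> complex"
  shows "integral\<^sup>L torus f = (LINT x|lborel. indicator unit_box x * f x)"
  by (subst integral_restrict_space) (auto simp: scaleR_conv_of_real intro!: Bochner_Integration.integral_cong split: split_indicator)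

lemma finite_measure_torus: "finite_measure (torus :: 'a::euclidean_space measure)"
  by (intro finite_measureI) (simp add: emeasure_restrict_space space_restrict_space)

lemma emeasure_torus_space: "emeasure torus (space (torus :: 'a::euclidean_space measure)) = 1"
  by (simp add: emeasure_restrict_space space_restrict_space emeasure_lborel_box_eq)

text \<open>Indicator and character are both products of functions of single coordinates, so the
  integral factors into integrals over the unit interval.\<close>

lemma integral_char_fun:
  fixes v :: "'a::euclidean_space"
  assumes v: "v \<in> int_vecs"
  shows "(LINT x|torus. char_fun v x) = (if v = 0 then 1 else 0)"
proof -
  interpret product_sigma_finite "\<lambda>_::'a. lborel :: real measure" ..
  let ?f = "\<lambda>b t. indicator {0<..<1::real} t * cis (2 * pi * ((v \<bullet> b) * t)) :: complex"
  have eq: "indicator unit_box x * char_fun v x = (\<Prod>b\<in>Basis. ?f b (x \<bullet> b))" for x :: 'a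
  proof -
    have "char_fun v x = (\<Prod>b\<in>Basis. cis (2 * pi * ((v \<bullet> b) * (x \<bullet> b))))"
      unfolding char_fun_def by (subst euclidean_inner) (simp add: cis_conv_exp exp_sum[symmetric] sum_distrib_left)
    moreover have "indicator unit_box x = (\<Prod>b\<in>Basis. indicator {0<..<1::real} (x \<bullet> b) :: complex)"
      by (auto simp: indicator_def box_def prod_zero_iff)
    ultimately show ?thesis by (simp add: prod.distrib)
  qed
  have "(LINT x|torus. char_fun v x) = (LINT x|lborel. (\<Prod>b\<in>Basis. ?f b (x \<bullet> b)))"
    by (simp add: integral_torus eq)
  also have "\<dots> = (LINT g|(\<Pi>\<^sub>M b\<in>Basis. lborel). (\<Prod>b\<in>Basis. ?f b (g b)))"
    by (subst lborel_eq, subst integral_distr) (auto simp: cis_conv_exp)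
  also have "\<dots> = (\<Prod>b\<in>(Basis::'a set). LINT t|lborel. ?f b t)"
  proof (rule product_integral_prod)
    fix b :: 'a
    show "integrable lborel (?f b)"
    proof (rule Bochner_Integration.integrable_bound)
      show "integrable lborel (indicator {0<..<1::real} :: real \<Rightarrow> real)" by simp
    qed (auto simp: cis_conv_exp norm_mult split: split_indicator)
  qed simp
  also have "\<dots> = (\<Prod>b\<in>Basis. if v \<bullet> b = 0 then 1 else 0)"
    using v by (intro prod.cong refl integral_cis_unit_interval) (auto simp: int_vecs_def)
  also have "\<dots> = (if v = 0 then 1 else 0)"
    using euclidean_eq_iff[of v 0] by (auto simp: prod_zero_iff)
  finally show ?thesis .
qed

section \<open>Uniqueness of Fourier coefficients for integrable functions\<close>

inductive trig_poly :: "(real \<Rightarrow> complex) \<Rightarrow> bool" where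
  monom: "trig_poly (\<lambda>x. c * cis (2 * pi * (of_int m * x)))"
| add: "trig_poly p \<Longrightarrow> trig_poly q \<Longrightarrow> trig_poly (\<lambda>x. p x + q x)"

lemma trig_poly_const: "trig_poly (\<lambda>x. c)"
  using trig_poly.monom[of c 0] by simp

lemma trig_poly_mult: 
  assumes "trig_poly p" "trig_poly q"
  shows "trig_poly (\<lambda>x. p x * q x)"
  using assms(1)
proof (induction p)
  case (monom c m)
  from assms(2) show ?case
  proof (induction q)
    case (monom d k)
    show ?case using trig_poly.monom[of "c * d" "m + k"] by (simp add: cis_mult algebra_simps)
  qed (use trig_poly.add in \<open>auto simp: ring_distribs\<close>)
qed (use trig_poly.add in \<open>auto simp: ring_distribs\<close>)

text \<open>On the circle Re z and Im z are a cosine and a sine, hence trigonometric polynomials,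
  and this class is closed under sums and products.\<close>

lemma trig_poly_real_polynomial:
  assumes "real_polynomial_function g"
  shows "trig_poly (\<lambda>x. of_real (g (cis (2 * pi * x))))"
  using assms
proof (induction g)
  case (linear f)
  interpret bounded_linear f by fact
  have "f z = Re z * f 1 + Im z * f \<i>" for z
  proof -
    have "z = Re z *\<^sub>R 1 + Im z *\<^sub>R \<i>" by (simp add: complex_eq_iff)
    then show ?thesis by (metis add scaleR real_scaleR_def)
  qed
  then have f: "f (cis t) = cos t * f 1 + sin t * f \<i>" for t by (metis cis.sel)
  \<comment> \<open>Rewrites a combination of cosine and sine through the two conjugate
    exponentials.\<close>
  have *: "complex_of_real (C * a + S * b) = ((a - \<i> * b) / 2) * Complex C S + ((a + \<i> * b) / 2) * Complex C (- S)" for C S a b :: real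
    by (simp add: complex_eq_iff field_simps)
  have "complex_of_real (f (cis (2 * pi * x))) =
     ((f 1 - \<i> * f \<i>) / 2) * cis (2 * pi * (of_int 1 * x)) + ((f 1 + \<i> * f \<i>) / 2) * cis (2 * pi * (of_int (-1) * x))" for x
    unfolding f * by (simp add: cis.code)
  then show ?case by (simp only: trig_poly.add[OF trig_poly.monom trig_poly.monom])
qed (use trig_poly.add trig_poly_mult trig_poly_const in auto)

text \<open>On the circle in the complex plane, uniform approximation by real polynomials becomes
  approximation by trigonometric polynomials. The indicator is first replaced by continuous
  functions of the distance to the complementary arc.\<close>

lemma indicator_interval_trig_approx:
  fixes a b :: real
  assumes ab: "0 \<le> a" "a < b" "b \<le> 1"
  obtains p where "\<And>n::nat. trig_poly (p n)" "\<And>n x. cmod (p n x) \<le> 2"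
    "\<And>x. 0 < x \<Longrightarrow> x < 1 \<Longrightarrow> (\<lambda>n. p n x) \<longlonglongrightarrow> indicator {a<..<b} x"
proof -
  define C where "C = (\<lambda>x. cis (2 * pi * x)) ` ({0..a} \<union> {b..1})"
  have C: "closed C" "C \<noteq> {}"
  proof -
    have "compact C" unfolding C_def cis_conv_exp
      by (intro compact_continuous_image compact_Un compact_Icc continuous_intros)
    then show "closed C" by (rule compact_imp_closed)
    have "0 \<in> {0..a}" using ab by auto
    then show "C \<noteq> {}" unfolding C_def by blast
  qed
  \<comment> \<open>Vanishes on the closed set C and is eventually 1 at each point off C. Its values
    lie in [0,1] and the approximation error is at most 1, whence the bound 2.\<close>
  define h where "h n z = min 1 (real n * infdist z C)" for n z
  have "\<exists>g. real_polynomial_function g \<and> (\<forall>z\<in>sphere 0 1. \<bar>h n z - g z\<bar> < 1 / Suc n)" for n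
  proof -
    have "continuous_on (sphere 0 1) (h n)"
      unfolding h_def by (intro continuous_intros)
    from Stone_Weierstrass_real_polynomial_function[OF compact_sphere this, of "1 / Suc n"]
    show ?thesis by (metis of_nat_0_less_iff zero_less_Suc zero_less_divide_1_iff)
  qed
  then obtain g where g: "\<And>n. real_polynomial_function (g n)" "\<And>n z. cmod z = 1 \<Longrightarrow> \<bar>h n z - g n z\<bar> < 1 / Suc n"
    by (metis mem_sphere_0)
  show ?thesis
  proof (rule that[of "\<lambda>n x. of_real (g n (cis (2 * pi * x)))"])
    show "trig_poly (\<lambda>x. complex_of_real (g n (cis (2 * pi * x))))" for n
      by (intro trig_poly_real_polynomial g)
    show "cmod (complex_of_real (g n (cis (2 * pi * x)))) \<le> 2" for n x
    proof -
      have "0 \<le> h n z" "h n z \<le> 1" for z by (auto simp: h_def infdist_nonneg)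
      moreover have "1 / Suc n \<le> (1::real)" by simp
      ultimately show ?thesis using g(2)[of "cis (2 * pi * x)" n]
        by (smt (verit) norm_cis norm_of_real)
    qed
    fix x :: real assume x: "0 < x" "x < 1"
    let ?z = "cis (2 * pi * x)"
    have h: "(\<lambda>n. h n ?z) \<longlonglongrightarrow> indicator {a<..<b} x"
    proof (cases "a < x \<and> x < b")
      case True
      have "?z \<notin> C"
      proof
        assume "?z \<in> C"
        then obtain y where y: "cis (2 * pi * x) = cis (2 * pi * y)" "y \<in> {0..a} \<union> {b..1}"
          by (auto simp: C_def)
        then obtain k :: int where "2 * pi * x = 2 * pi * y + 2 * k * pi"
          unfolding cis_conv_exp exp_eq by (auto simp: complex_eq_iff)
        then have "2 * pi * x = 2 * pi * (y + k)" by (simp add: algebra_simps)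
        then have k: "x = y + of_int k" by simp
        \<comment> \<open>x lies strictly inside the unit interval and y in its closure, so their
          integer difference k can only be 0.\<close>
        then have "\<bar>of_int k :: real\<bar> < 1" using x y(2) True ab by auto
        then have "k = 0" by linarith
        with k y(2) True show False by auto
      qed
      then have pos: "0 < infdist ?z C"
        using C infdist_nonneg[of ?z C] in_closed_iff_infdist_zero[OF C, of ?z] by simp
      obtain N :: nat where N: "1 / infdist ?z C < N" using reals_Archimedean2 by blast
      have "\<forall>\<^sub>F n in sequentially. h n ?z = 1"
        using eventually_ge_at_top[of N]
      proof eventually_elim
        case (elim n)
        have "1 \<le> real N * infdist ?z C" using N pos by (simp add: field_simps)
        also have "\<dots> \<le> real n * infdist ?z C" using elim pos by (intro mult_right_mono) auto
        finally show ?case by (simp add: h_def)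
      qed
      then show ?thesis using True tendsto_eventually by fastforce
    next
      case False
      then have "?z \<in> C" unfolding C_def using x by (intro imageI) auto
      then have "h n ?z = 0" for n by (simp add: h_def)
      then show ?thesis using False by simp
    qed
    have "(\<lambda>n. g n ?z - h n ?z) \<longlonglongrightarrow> 0"
    proof (rule Lim_null_comparison)
      show "\<forall>\<^sub>F n in sequentially. norm (g n ?z - h n ?z) \<le> 1 / Suc n"
        using g(2)[of ?z] by (intro always_eventually allI) (simp add: abs_minus_commute less_imp_le)
      show "(\<lambda>n. 1 / real (Suc n)) \<longlonglongrightarrow> 0" using LIMSEQ_inverse_real_of_nat by (simp add: inverse_eq_divide)
    qed
    from tendsto_add[OF this h] have "(\<lambda>n. g n ?z) \<longlonglongrightarrow> indicator {a<..<b} x" by simp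
    then have "(\<lambda>n. complex_of_real (g n ?z)) \<longlonglongrightarrow> of_real (indicator {a<..<b} x)"
      by (rule tendsto_of_real)
    moreover have "complex_of_real (indicator {a<..<b} x) = indicator {a<..<b} x"
      by (simp add: indicator_def)
    ultimately show "(\<lambda>n. complex_of_real (g n ?z)) \<longlonglongrightarrow> indicator {a<..<b} x"
      by metis
  qed
qed


lemma trig_poly_integrable_mult:
  assumes "trig_poly p" "integrable M f" "g \<in> borel_measurable M"
  shows "integrable M (\<lambda>x. p (g x) * f x :: complex)"
  using assms(1)
proof (induction p)
  case (monom c m)
  have "integrable M (\<lambda>x. cis (2 * pi * (of_int m * g x)) * f x)"
  proof (rule Bochner_Integration.integrable_bound[OF assms(2)])
    show "(\<lambda>x. cis (2 * pi * (of_int m * g x)) * f x) \<in> borel_measurable M"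
      unfolding cis_conv_exp using assms(2,3) by measurable
  qed (simp add: norm_mult)
  then show ?case by (simp add: mult.assoc)
qed (simp add: ring_distribs)

lemma integrable_mult_char_fun:
  assumes "integrable lborel F"
  shows "integrable lborel (\<lambda>x. F x * char_fun v x)"
  by (rule Bochner_Integration.integrable_bound[OF assms]) (use assms in \<open>auto simp: norm_mult char_fun_simps\<close>)

lemma integrable_indicator_mult_complex:
  fixes F :: "'a::euclidean_space \<Rightarrow> complex"
  assumes F: "integrable lborel F" and [measurable]: "A \<in> sets borel"
  shows "integrable lborel (\<lambda>x. indicator A x * F x)"
  by (rule Bochner_Integration.integrable_bound[OF F])
    (use F in \<open>auto simp: norm_mult split: split_indicator\<close>)

text \<open>The frequencies are removed one coordinate at a time: an interval indicator in the coordinate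
  \<open>b\<close> is a bounded pointwise limit of trigonometric polynomials.\<close>

lemma box_integral_zero_of_Fourier_zero:
  fixes F :: "'a::euclidean_space \<Rightarrow> complex"
  assumes F: "integrable lborel F" and supp: "\<And>x. x \<notin> unit_box \<Longrightarrow> F x = 0"
    and zero: "\<And>v. v \<in> int_vecs \<Longrightarrow> (LINT x|lborel. F x * char_fun v x) = 0"
    and uw: "\<And>b. b \<in> Basis \<Longrightarrow> 0 \<le> u \<bullet> b \<and> u \<bullet> b < w \<bullet> b \<and> w \<bullet> b \<le> 1"
    and S: "S \<subseteq> Basis" and v: "v \<in> int_vecs"
  shows "(LINT x|lborel. indicator {x. \<forall>b\<in>S. u \<bullet> b < x \<bullet> b \<and> x \<bullet> b < w \<bullet> b} x * (F x * char_fun v x)) = 0"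
  using finite_subset[OF S finite_Basis] S v
proof (induction S arbitrary: v rule: finite_induct)
  case empty
  then show ?case using zero by simp
next
  case (insert b S)
  let ?A = "{x::'a. \<forall>b\<in>S. u \<bullet> b < x \<bullet> b \<and> x \<bullet> b < w \<bullet> b}"
  let ?B = "{x::'a. \<forall>b\<in>insert b S. u \<bullet> b < x \<bullet> b \<and> x \<bullet> b < w \<bullet> b}"
  have b: "b \<in> Basis" using insert.prems by auto
  have A[measurable]: "?A \<in> sets borel"
    using insert.hyps(1) by measurable
  let ?H = "\<lambda>x. indicator ?A x * (F x * char_fun v x)"
  have H: "integrable lborel ?H"
    by (intro integrable_indicator_mult_complex integrable_mult_char_fun F A)
  obtain p where p: "\<And>n::nat. trig_poly (p n)" "\<And>n x. cmod (p n x) \<le> 2"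
    "\<And>x. 0 < x \<Longrightarrow> x < 1 \<Longrightarrow> (\<lambda>n. p n x) \<longlonglongrightarrow> indicator {u \<bullet> b<..<w \<bullet> b} x"
    by (rule indicator_interval_trig_approx[of "u \<bullet> b" "w \<bullet> b"]) (use uw[OF b] in simp, use uw[OF b] in simp, use uw[OF b] in simp, rule that)
  have int: "integrable lborel (\<lambda>x. q (x \<bullet> b) * ?H x)" if "trig_poly q" for q
    by (intro trig_poly_integrable_mult that H) simp
  have q0: "(LINT x|lborel. q (x \<bullet> b) * ?H x) = 0" if "trig_poly q" for q
    using that
  proof induction
    case (monom c m)
    \<comment> \<open>A monomial in the coordinate b only shifts the frequency v by m b; this is why
      v is arbitrary in the induction.\<close>
    have "c * cis (2 * pi * (of_int m * (x \<bullet> b))) * ?H x = c * (indicator ?A x * (F x * char_fun (v + of_int m *\<^sub>R b) x))" for x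
      unfolding char_fun_add by (simp add: char_fun_def inner_commute mult_ac)
    moreover have "(LINT x|lborel. indicator ?A x * (F x * char_fun (v + of_int m *\<^sub>R b) x)) = 0"
      using insert b by (intro insert.IH) (auto intro: int_vecs_closed)
    ultimately show ?case by (simp only: integral_mult_right_zero mult_zero_right)
  next
    case (add p q)
    then show ?case using int by (simp add: ring_distribs)
  qed
  have "(\<lambda>n. LINT x|lborel. p n (x \<bullet> b) * ?H x) \<longlonglongrightarrow> (LINT x|lborel. indicator ?B x * (F x * char_fun v x))"
  proof (rule integral_dominated_convergence[where w="\<lambda>x. 2 * cmod (?H x)"])
    show "(\<lambda>x. indicator ?B x * (F x * char_fun v x)) \<in> borel_measurable lborel"
    proof -
      have "finite (insert b S)" using insert.hyps(1) by simp
      then have "?B \<in> sets borel" by measurable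
      then show ?thesis using F by measurable
    qed
    show "(\<lambda>x. p n (x \<bullet> b) * ?H x) \<in> borel_measurable lborel" for n
      using int[OF p(1)] by (rule borel_measurable_integrable)
    show "integrable lborel (\<lambda>x. 2 * cmod (?H x))"
      using H by (intro integrable_mult_right integrable_norm)
    show "AE x in lborel. norm (p n (x \<bullet> b) * ?H x) \<le> 2 * cmod (?H x)" for n
      using p(2) by (intro AE_I2) (simp add: norm_mult mult_right_mono)
    show "AE x in lborel. (\<lambda>n. p n (x \<bullet> b) * ?H x) \<longlonglongrightarrow> indicator ?B x * (F x * char_fun v x)"
    proof (intro AE_I2)
      fix x :: 'a
      show "(\<lambda>n. p n (x \<bullet> b) * ?H x) \<longlonglongrightarrow> indicator ?B x * (F x * char_fun v x)"
      proof (cases "x \<in> unit_box")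
        case True
        then have "(\<lambda>n. p n (x \<bullet> b)) \<longlonglongrightarrow> indicator {u \<bullet> b<..<w \<bullet> b} (x \<bullet> b)"
          using b by (intro p(3)) (auto simp: mem_box)
        from tendsto_mult_right[OF this, of "?H x"]
        show ?thesis by (auto simp: indicator_def split: if_splits)
      qed (simp add: supp)
    qed
  qed
  then show ?case
    unfolding q0[OF p(1)] by (simp add: LIMSEQ_const_iff)
qed

text \<open>Integrals of F over boxes vanish; boxes are stable under intersection and generate the
  Borel sets, so the integral over every Borel set vanishes. The statement is for integrable F
  because the periodized weights are not known to be square integrable.\<close>

theorem Fourier_uniqueness_L1:
  fixes F :: "'a::euclidean_space \<Rightarrow> complex"
  assumes F: "integrable lborel F" and supp: "\<And>x. x \<notin> unit_box \<Longrightarrow> F x = 0"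
    and zero: "\<And>v. v \<in> int_vecs \<Longrightarrow> (LINT x|lborel. F x * char_fun v x) = 0"
  shows "AE x in lborel. F x = 0"
proof (rule sigma_finite_measure.density_zero[OF sigma_finite_lborel F])
  have box0: "(LINT x|lborel. indicator (box a b) x * F x) = 0" for a b :: 'a
  proof (cases "\<forall>i\<in>Basis. max (a \<bullet> i) 0 < min (b \<bullet> i) 1")
    case True
    \<comment> \<open>The corners u and w clip the box to the unit cube, outside which F
      vanishes.\<close>
    define u where "u = (\<Sum>i\<in>Basis. max (a \<bullet> i) 0 *\<^sub>R i)"
    define w where "w = (\<Sum>i\<in>Basis. min (b \<bullet> i) 1 *\<^sub>R i)"
    have u: "u \<bullet> i = max (a \<bullet> i) 0" "w \<bullet> i = min (b \<bullet> i) 1" if "i \<in> Basis" for i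
      using that by (auto simp: u_def w_def)
    have "(LINT x|lborel. indicator {x. \<forall>i\<in>Basis. u \<bullet> i < x \<bullet> i \<and> x \<bullet> i < w \<bullet> i} x * (F x * char_fun 0 x)) = 0"
      using True u by (intro box_integral_zero_of_Fourier_zero F supp zero int_vecs_closed) auto
    moreover have "indicator {x. \<forall>i\<in>Basis. u \<bullet> i < x \<bullet> i \<and> x \<bullet> i < w \<bullet> i} x * (F x * char_fun 0 x) = indicator (box a b) x * F x" for x
    proof (cases "x \<in> unit_box")
      case True
      then have "x \<in> {x. \<forall>i\<in>Basis. u \<bullet> i < x \<bullet> i \<and> x \<bullet> i < w \<bullet> i} \<longleftrightarrow> x \<in> box a b"
        using u by (auto simp: mem_box)
      then show ?thesis by (simp add: char_fun_simps indicator_def)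
    qed (simp add: supp)
    ultimately show ?thesis by simp
  next
    case False
    then obtain i where i: "i \<in> Basis" "min (b \<bullet> i) 1 \<le> max (a \<bullet> i) 0" by (auto simp: not_less)
    have "indicator (box a b) x * F x = 0" for x
    proof (cases "x \<in> unit_box")
      case True
      then have "x \<notin> box a b" using i by (force simp: mem_box)
      then show ?thesis by simp
    qed (simp add: supp)
    then have "(\<lambda>x. indicator (box a b) x * F x) = (\<lambda>x. 0)" by (rule ext)
    then show ?thesis by simp
  qed
  have all: "(LINT x|lborel. F x) = 0"
    using zero[OF int_vecs_closed(1)] by (simp add: char_fun_simps)
  fix A :: "'a set" assume "A \<in> sets lborel"
  have "Int_stable (range (\<lambda>(a, b). box a b :: 'a set))"
    by (auto simp: Int_stable_def box_Int_box)
  moreover have "range (\<lambda>(a, b). box a b :: 'a set) \<subseteq> Pow UNIV" by simp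
  moreover have "A \<in> sigma_sets UNIV (range (\<lambda>(a, b). box a b))"
    using \<open>A \<in> sets lborel\<close> by (simp add: borel_eq_box)
  ultimately have "(LINT x|lborel. indicator A x * F x) = 0"
  proof (induction A rule: sigma_sets_induct_disjoint[consumes 3, case_names basic empty compl union])
    case (basic A)
    then show ?case using box0 by auto
  next
    case (compl A)
    then have [measurable]: "A \<in> sets borel" by (simp add: borel_eq_box)
    have "(LINT x|lborel. indicator (UNIV - A) x * F x) = (LINT x|lborel. F x - indicator A x * F x)"
      by (intro Bochner_Integration.integral_cong refl) (simp split: split_indicator)
    also have "\<dots> = 0"
      using compl all by (subst Bochner_Integration.integral_diff) (auto intro: F integrable_indicator_mult_complex)
    finally show ?case .
  next
    case (union A)
    then have [measurable]: "A i \<in> sets borel" for i by (auto simp: borel_eq_box)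
    have "(\<lambda>n. LINT x|lborel. (\<Sum>i<n. indicator (A i) x * F x)) \<longlonglongrightarrow> (LINT x|lborel. indicator (\<Union>i. A i) x * F x)"
    proof (rule integral_dominated_convergence[where w="\<lambda>x. cmod (F x)"])
      have ind: "(\<Sum>i<n. indicator (A i) x * F x) = indicator (\<Union>i<n. A i) x * F x" for n x
        using disjoint_family_on_mono[OF subset_UNIV union(1)]
        by (subst indicator_UN_disjoint) (auto simp: sum_distrib_right)
      show "AE x in lborel. (\<lambda>n. \<Sum>i<n. indicator (A i) x * F x) \<longlonglongrightarrow> indicator (\<Union>i. A i) x * F x"
      proof (intro AE_I2)
        fix x show "(\<lambda>n. \<Sum>i<n. indicator (A i) x * F x) \<longlonglongrightarrow> indicator (\<Union>i. A i) x * F x"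
          unfolding ind by (intro tendsto_mult_right LIMSEQ_indicator_UN)
      qed
      show "AE x in lborel. norm (\<Sum>i<n. indicator (A i) x * F x) \<le> cmod (F x)" for n
        unfolding ind by (intro AE_I2) (simp add: norm_mult split: split_indicator)
    qed (use F in \<open>auto\<close>)
    moreover have "(LINT x|lborel. (\<Sum>i<n. indicator (A i) x * F x)) = 0" for n
      using union by (subst Bochner_Integration.integral_sum) (auto intro!: integrable_indicator_mult_complex F)
    ultimately show ?case by (simp add: LIMSEQ_const_iff)
  qed simp
  then show "set_lebesgue_integral lborel A F = 0"
    unfolding set_lebesgue_integral_def by (simp add: scaleR_conv_of_real of_real_indicator)
qed

lemma L2_torus_iff:
  "f \<in> L2 torus \<longleftrightarrow> (\<lambda>x. indicator unit_box x * f x) \<in> L2 lborel" 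
proof -
  have "(\<lambda>x. indicator unit_box x *\<^sub>R f x) = (\<lambda>x. indicator unit_box x * f x)"
    by (auto simp: indicator_def)
  moreover have "(\<lambda>x. indicator unit_box x *\<^sub>R (cmod (f x))\<^sup>2) = (\<lambda>x. (cmod (indicator unit_box x * f x))\<^sup>2)"
    by (auto simp: indicator_def)
  ultimately show ?thesis
    unfolding L2_def by (simp add: borel_measurable_restrict_space_iff integrable_restrict_space)
qed

lemma L2_char_fun_torus: "char_fun v \<in> L2 torus"
proof -
  interpret finite_measure torus by (rule finite_measure_torus)
  have "char_fun v \<in> borel_measurable torus"
    by (rule measurable_restrict_space1) simp
  then show ?thesis by (simp add: L2_def char_fun_simps)
qed

lemma L2_torus_integrable:
  assumes "f \<in> L2 torus"
  shows "integrable torus f"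
  using L2_mult_integrable[OF assms L2_char_fun_torus[of 0]] by (simp add: char_fun_simps)

theorem Fourier_uniqueness_torus:
  assumes f: "integrable torus f"
    and zero: "\<And>v. v \<in> int_vecs \<Longrightarrow> (LINT x|torus. f x * cnj (char_fun v x)) = 0"
  shows "AE x in torus. f x = 0"
proof -
  have s: "indicator unit_box x *\<^sub>R f x = indicator unit_box x * f x" for x
    by (simp add: indicator_def)
  have "AE x in lborel. indicator unit_box x * f x = 0"
  proof (rule Fourier_uniqueness_L1)
    show "integrable lborel (\<lambda>x. indicator unit_box x * f x)"
      using f by (simp add: integrable_restrict_space s)
    fix v :: 'a assume "v \<in> int_vecs"
    from zero[OF int_vecs_closed(3)[OF this]]
    show "(LINT x|lborel. indicator unit_box x * f x * char_fun v x) = 0"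
      by (simp add: integral_torus char_fun_simps mult.assoc)
  qed simp
  then show ?thesis
    by (subst AE_restrict_space_iff) (auto simp: indicator_def elim!: AE_mp split: if_splits)
qed

lemma l2_orthonormal_torus: "l2_orthonormal torus int_vecs char_fun"
  unfolding l2_orthonormal_def l2_inner_def
proof (intro conjI ballI L2_char_fun_torus)
  fix v w :: 'a assume vw: "v \<in> int_vecs" "w \<in> int_vecs"
  have "(LINT x|torus. char_fun v x * cnj (char_fun w x)) = (LINT x|torus. char_fun (v - w) x)"
    using char_fun_add(2)[of v "- w"] by (simp add: char_fun_simps)
  then show "(LINT x|torus. char_fun v x * cnj (char_fun w x)) = (if v = w then 1 else 0)"
    using integral_char_fun[OF int_vecs_closed(4)[OF vw]] by simp
qed

lemma l2_total_torus: "l2_total torus int_vecs char_fun"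
  unfolding l2_total_def l2_inner_def
  by (intro ballI impI Fourier_uniqueness_torus L2_torus_integrable) auto

section \<open>Affine substitutions and the tiling of space by integer translates of the unit
  cube\<close>

lemma integral_lborel_affine:
  fixes f :: "'a::euclidean_space \<Rightarrow> complex"
  assumes c: "c \<noteq> 0" and [measurable]: "f \<in> borel_measurable borel"
  shows "integral\<^sup>L lborel f = of_real (\<bar>c\<bar> ^ DIM('a)) * (LINT x|lborel. f (t + c *\<^sub>R x))"
proof -
  have "integral\<^sup>L lborel f = integral\<^sup>L (density (distr lborel borel (\<lambda>x. t + c *\<^sub>R x)) (\<lambda>_. ennreal (\<bar>c\<bar>^DIM('a)))) f"
    using lborel_affine[OF c, of t] by (simp add: ennreal_power)
  also have "\<dots> = of_real (\<bar>c\<bar> ^ DIM('a)) * (LINT x|lborel. f (t + c *\<^sub>R x))"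
    by (subst integral_density) (auto simp: integral_distr scaleR_conv_of_real)
  finally show ?thesis .
qed

lemma nn_integral_lborel_affine:
  fixes f :: "'a::euclidean_space \<Rightarrow> ennreal"
  assumes c: "c \<noteq> 0" and [measurable]: "f \<in> borel_measurable borel"
  shows "integral\<^sup>N lborel f = ennreal (\<bar>c\<bar> ^ DIM('a)) * (\<integral>\<^sup>+x. f (t + c *\<^sub>R x) \<partial>lborel)"
proof -
  have "integral\<^sup>N lborel f = integral\<^sup>N (density (distr lborel borel (\<lambda>x. t + c *\<^sub>R x)) (\<lambda>_. ennreal (\<bar>c\<bar>^DIM('a)))) f"
    using lborel_affine[OF c, of t] by (simp add: ennreal_power)
  also have "\<dots> = ennreal (\<bar>c\<bar> ^ DIM('a)) * (\<integral>\<^sup>+x. f (t + c *\<^sub>R x) \<partial>lborel)"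
    by (subst nn_integral_density) (auto simp: nn_integral_distr nn_integral_cmult)
  finally show ?thesis .
qed

lemma integrable_lborel_affine:
  fixes f :: "'a::euclidean_space \<Rightarrow> complex"
  assumes c: "c \<noteq> 0" and f: "integrable lborel f"
  shows "integrable lborel (\<lambda>x. f (t + c *\<^sub>R x))"
proof -
  have [measurable]: "f \<in> borel_measurable borel" using f by auto
  have "ennreal (\<bar>c\<bar> ^ DIM('a)) * (\<integral>\<^sup>+x. ennreal (norm (f (t + c *\<^sub>R x))) \<partial>lborel) < \<infinity>"
    using f nn_integral_lborel_affine[OF c, of "\<lambda>x. ennreal (norm (f x))" t] by (simp add: integrable_iff_bounded)
  then have "(\<integral>\<^sup>+x. ennreal (norm (f (t + c *\<^sub>R x))) \<partial>lborel) < \<infinity>"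
    using c by (auto simp: ennreal_mult_less_top)
  then show ?thesis by (auto simp: integrable_iff_bounded)
qed

lemma integral_lborel_translate:
  fixes f :: "'a::euclidean_space \<Rightarrow> complex"
  assumes "f \<in> borel_measurable borel"
  shows "(LINT x|lborel. f (x + t)) = integral\<^sup>L lborel f"
  using integral_lborel_affine[OF _ assms, of 1 t] by (simp add: add.commute)

lemma nn_integral_lborel_translate:
  fixes f :: "'a::euclidean_space \<Rightarrow> ennreal"
  assumes "f \<in> borel_measurable borel"
  shows "(\<integral>\<^sup>+x. f (x + t) \<partial>lborel) = integral\<^sup>N lborel f"
  using nn_integral_lborel_affine[OF _ assms, of 1 t] by (simp add: add.commute)

lemma L2_lborel_affine:
  fixes f :: "'a::euclidean_space \<Rightarrow> complex"
  assumes c: "c \<noteq> 0" and f: "f \<in> L2 lborel"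
  shows "(\<lambda>x. f (t + c *\<^sub>R x)) \<in> L2 lborel"
    "(l2_norm lborel f)\<^sup>2 = \<bar>c\<bar> ^ DIM('a) * (l2_norm lborel (\<lambda>x. f (t + c *\<^sub>R x)))\<^sup>2"
proof -
  have [measurable]: "f \<in> borel_measurable borel" using L2_measurable[OF f] by simp
  note * = nn_integral_lborel_affine[OF c, of "\<lambda>x. ennreal ((cmod (f x))\<^sup>2)" t]
  have "ennreal (\<bar>c\<bar> ^ DIM('a)) * (\<integral>\<^sup>+x. ennreal ((cmod (f (t + c *\<^sub>R x)))\<^sup>2) \<partial>lborel) < \<infinity>"
    using f * by (simp add: L2_iff_nn_integral)
  then have "(\<integral>\<^sup>+x. ennreal ((cmod (f (t + c *\<^sub>R x)))\<^sup>2) \<partial>lborel) < \<infinity>"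
    using c by (auto simp: ennreal_mult_less_top)
  then show L: "(\<lambda>x. f (t + c *\<^sub>R x)) \<in> L2 lborel" by (auto simp: L2_iff_nn_integral)
  show "(l2_norm lborel f)\<^sup>2 = \<bar>c\<bar> ^ DIM('a) * (l2_norm lborel (\<lambda>x. f (t + c *\<^sub>R x)))\<^sup>2"
    using * unfolding nn_integral_l2_norm[OF f] nn_integral_l2_norm[OF L]
    by (simp add: ennreal_mult[symmetric] del: ennreal_power)
qed

lemma AE_lborel_component_neq:
  fixes b :: "'a::euclidean_space"
  assumes b: "b \<in> Basis"
  shows "AE x in lborel. x \<bullet> b \<noteq> c"
proof (rule AE_I)
  show "{x \<in> space lborel. \<not> x \<bullet> b \<noteq> c} \<subseteq> {x. x \<bullet> b = c}" by auto
  have "negligible {x. x \<bullet> b = c}" using negligible_standard_hyperplane[OF b] .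
  then have "{x. x \<bullet> b = c} \<in> null_sets lebesgue" by (simp add: negligible_iff_null_sets)
  then have "{x. x \<bullet> b = c} \<in> null_sets lborel"
    by (subst (asm) null_sets_completion_iff) measurable
  then show "emeasure lborel {x. x \<bullet> b = c} = 0" "{x. x \<bullet> b = c} \<in> sets lborel"
    by (auto simp: null_sets_def)
qed

text \<open>The translating vector is minus the coordinatewise floor. Points with an integer
  coordinate, which no translate of the open cube contains, form a null set.\<close>

lemma AE_unique_unit_box_translate:
  "AE x in lborel. \<exists>!v. v \<in> int_vecs \<and> x + v \<in> (unit_box :: 'a::euclidean_space set)"
proof -
  have "AE x in lborel. \<forall>b\<in>Basis. \<forall>m::int. (x::'a) \<bullet> b \<noteq> of_int m"
    by (intro AE_finite_allI) (auto simp: AE_all_countable intro: AE_lborel_component_neq)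
  then show ?thesis
  proof eventually_elim
    case (elim x)
    let ?v = "- (\<Sum>b\<in>Basis. of_int \<lfloor>x \<bullet> b\<rfloor> *\<^sub>R b) :: 'a"
    have vb: "?v \<bullet> b = - of_int \<lfloor>x \<bullet> b\<rfloor>" if "b \<in> Basis" for b
      using that by simp
    show ?case
    proof (rule ex1I[of _ ?v], intro conjI)
      show "?v \<in> int_vecs" by (simp add: int_vecs_def del: inner_minus_left) (simp add: vb)
      show "x + ?v \<in> unit_box"
        unfolding mem_box inner_add_left
      proof (intro ballI)
        fix b :: 'a assume b: "b \<in> Basis"
        then have "x \<bullet> b \<noteq> of_int \<lfloor>x \<bullet> b\<rfloor>" using elim by blast
        then have "0 < x \<bullet> b - of_int \<lfloor>x \<bullet> b\<rfloor>" "x \<bullet> b - of_int \<lfloor>x \<bullet> b\<rfloor> < 1"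
          by linarith+
        then show "0 \<bullet> b < x \<bullet> b + ?v \<bullet> b \<and> x \<bullet> b + ?v \<bullet> b < One \<bullet> b"
          using b by (simp add: vb del: inner_minus_left)
      qed
    next
      fix v assume v: "v \<in> int_vecs \<and> x + v \<in> unit_box"
      show "v = ?v"
      proof (rule euclidean_eqI)
        fix b :: 'a assume b: "b \<in> Basis"
        then obtain m where m: "v \<bullet> b = of_int m" using v by (auto simp: int_vecs_def elim: Ints_cases)
        have "0 < x \<bullet> b + of_int m" "x \<bullet> b + of_int m < 1"
          using v b m by (auto simp: mem_box inner_add_left)
        then have "m = - \<lfloor>x \<bullet> b\<rfloor>" by linarith
        then show "v \<bullet> b = ?v \<bullet> b" using vb[OF b] m by simp
      qed
    qed
  qed
qed

text \<open>Turns sums over the lattice into series over the natural numbers, which can be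
  interchanged with integrals.\<close>

definition int_vec_enum :: "nat \<Rightarrow> 'a::euclidean_space" where
  "int_vec_enum = from_nat_into int_vecs"

lemma bij_int_vec_enum: "bij_betw int_vec_enum UNIV int_vecs"
  unfolding int_vec_enum_def by (intro bij_betw_from_nat_into countable_int_vecs infinite_int_vecs)

lemma int_vec_enum_in: "int_vec_enum n \<in> int_vecs"
  using bij_int_vec_enum bij_betwE by blast

lemma int_vec_enum_eq_iff: "int_vec_enum n = int_vec_enum m \<longleftrightarrow> n = m"
  using bij_betw_imp_inj_on[OF bij_int_vec_enum] by (rule inj_eq)

lemma suminf_ennreal_has_sum:
  assumes "(f has_sum s) (UNIV :: nat set)" "\<And>n. 0 \<le> f n"
  shows "(\<Sum>n. ennreal (f n)) = ennreal s"
  using has_sum_imp_sums[OF assms(1)] assms(2) by (intro suminf_ennreal_eq)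

text \<open>Almost every point has exactly one translate in the cube, so the integral is a sum over
  the tiles. The minus sign appears when the translation is moved from the indicator onto F.\<close>

lemma nn_integral_unfold:
  fixes F :: "'a::euclidean_space \<Rightarrow> ennreal"
  assumes [measurable]: "F \<in> borel_measurable borel"
  shows "integral\<^sup>N lborel F = (\<integral>\<^sup>+\<theta>. (\<Sum>n. F (\<theta> - int_vec_enum n)) \<partial>torus)"
proof -
  have "AE x in lborel. F x = (\<Sum>n. F x * indicator unit_box (x + int_vec_enum n))"
    using AE_unique_unit_box_translate
  proof eventually_elim
    case (elim x)
    then obtain w where w: "w \<in> int_vecs" "x + w \<in> unit_box" and uw: "\<And>v. v \<in> int_vecs \<Longrightarrow> x + v \<in> unit_box \<Longrightarrow> v = w"
      by (elim ex1E) blast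
    obtain N where N': "w = int_vec_enum N"
      using w(1) bij_int_vec_enum unfolding bij_betw_def by blast
    have N: "x + int_vec_enum N \<in> unit_box" and u: "\<And>v. v \<in> int_vecs \<Longrightarrow> x + v \<in> unit_box \<Longrightarrow> v = int_vec_enum N"
      using w(2) uw unfolding N' by blast+
    have "F x * indicator unit_box (x + int_vec_enum n) = 0" if "n \<notin> {N}" for n
    proof -
      have "x + int_vec_enum n \<notin> unit_box"
        using that u[OF int_vec_enum_in, of n] by (auto simp: int_vec_enum_eq_iff)
      then show ?thesis by simp
    qed
    then have "(\<Sum>n. F x * indicator unit_box (x + int_vec_enum n)) = (\<Sum>n\<in>{N}. F x * indicator unit_box (x + int_vec_enum n))"
      by (intro suminf_finite) auto
    then show ?case using N by simp
  qed
  then have "integral\<^sup>N lborel F = (\<integral>\<^sup>+x. (\<Sum>n. F x * indicator unit_box (x + int_vec_enum n)) \<partial>lborel)"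
    by (rule nn_integral_cong_AE)
  also have "\<dots> = (\<Sum>n. \<integral>\<^sup>+x. F x * indicator unit_box (x + int_vec_enum n) \<partial>lborel)"
    by (rule nn_integral_suminf) measurable
  also have "\<dots> = (\<Sum>n. \<integral>\<^sup>+x. F (x - int_vec_enum n) * indicator unit_box x \<partial>lborel)"
  proof (intro suminf_cong)
    fix n :: nat
    show "(\<integral>\<^sup>+x. F x * indicator unit_box (x + int_vec_enum n) \<partial>lborel) = (\<integral>\<^sup>+x. F (x - int_vec_enum n) * indicator unit_box x \<partial>lborel)"
      using nn_integral_lborel_translate[of "\<lambda>x. F (x - int_vec_enum n) * indicator unit_box x" "int_vec_enum n"] by simp
  qed
  also have "\<dots> = (\<integral>\<^sup>+x. (\<Sum>n. F (x - int_vec_enum n) * indicator unit_box x) \<partial>lborel)"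
    by (rule nn_integral_suminf[symmetric]) measurable
  also have "\<dots> = (\<integral>\<^sup>+\<theta>. (\<Sum>n. F (\<theta> - int_vec_enum n)) \<partial>torus)"
    by (subst nn_integral_restrict_space) (auto simp: ennreal_suminf_multc)
  finally show ?thesis .
qed

section \<open>The Plancherel theorem\<close>

definition ft :: "('a::euclidean_space \<Rightarrow> complex) \<Rightarrow> 'a \<Rightarrow> complex" where
  "ft h \<xi> = (LINT x|lborel. h x * char_fun \<xi> x)"

lemma borel_measurable_ft [measurable]:
  assumes [measurable]: "h \<in> borel_measurable borel"
  shows "ft h \<in> borel_measurable borel"
  unfolding ft_def by measurable

text \<open>For fixed \<theta> the values of \<open>ft h\<close> at \<theta> - v, with v in the
  lattice, are the Fourier coefficients of h times the character of \<theta>. By Parseval their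
  squares sum to ||h||^2 whatever \<theta> is; integrating over \<theta> in the unit cube unfolds to
  the integral over the whole space.\<close>

lemma Plancherel_unit_box:
  fixes h :: "'a::euclidean_space \<Rightarrow> complex"
  assumes h: "h \<in> L2 lborel" and supp: "\<And>x. x \<notin> unit_box \<Longrightarrow> h x = 0"
  shows "(\<integral>\<^sup>+\<xi>. ennreal ((cmod (ft h \<xi>))\<^sup>2) \<partial>lborel) = ennreal ((l2_norm lborel h)\<^sup>2)"
proof -
  have [measurable]: "h \<in> borel_measurable borel" using L2_measurable[OF h] by simp
  have ind: "indicator unit_box x * h x = h x" for x using supp by (auto simp: indicator_def)
  have *: "(\<Sum>n. ennreal ((cmod (ft h (\<theta> - int_vec_enum n)))\<^sup>2)) = ennreal ((l2_norm lborel h)\<^sup>2)" for \<theta>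
  proof -
    let ?g = "\<lambda>x. h x * char_fun \<theta> x"
    have "(\<lambda>x. char_fun \<theta> x * h x) \<in> L2 lborel"
      by (rule L2_bounded_mult[OF h, of _ 1]) (auto simp: char_fun_simps)
    moreover have "(\<lambda>x. indicator unit_box x * ?g x) = (\<lambda>x. char_fun \<theta> x * h x)"
      by (rule ext) (simp add: mult.assoc[symmetric] ind)
    ultimately have g: "?g \<in> L2 torus" unfolding L2_torus_iff by simp
    have co: "l2_inner torus ?g (char_fun v) = ft h (\<theta> - v)" for v
      unfolding l2_inner_def integral_torus ft_def char_fun_simps(4)
    proof (intro Bochner_Integration.integral_cong refl)
      fix x
      have "indicator unit_box x * (h x * char_fun \<theta> x * char_fun (- v) x) = (indicator unit_box x * h x) * (char_fun \<theta> x * char_fun (- v) x)"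
        by (simp only: mult.assoc)
      then show "indicator unit_box x * (h x * char_fun \<theta> x * char_fun (- v) x) = h x * char_fun (\<theta> - v) x"
        unfolding ind using char_fun_add(2)[of \<theta> "- v" x] by simp
    qed
    have nrm: "(l2_norm torus ?g)\<^sup>2 = (l2_norm lborel h)\<^sup>2"
    proof -
      have "complex_of_real ((l2_norm torus ?g)\<^sup>2) = l2_inner torus ?g ?g" by (rule l2_inner_self[symmetric])
      also have "\<dots> = (LINT x|lborel. h x * cnj (h x))"
        unfolding l2_inner_def integral_torus
      proof (intro Bochner_Integration.integral_cong refl)
        fix x
        have "char_fun \<theta> x * cnj (char_fun \<theta> x) = 1"
          using complex_norm_square[of "char_fun \<theta> x"] unfolding char_fun_simps(3) by simp
        then have "indicator unit_box x * (h x * char_fun \<theta> x * cnj (h x * char_fun \<theta> x)) = (indicator unit_box x * h x) * cnj (h x)"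
          by (simp add: mult_ac)
        then show "indicator unit_box x * (h x * char_fun \<theta> x * cnj (h x * char_fun \<theta> x)) = h x * cnj (h x)"
          using ind by simp
      qed
      also have "\<dots> = complex_of_real ((l2_norm lborel h)\<^sup>2)"
        using l2_inner_self[of lborel h] by (simp add: l2_inner_def)
      finally show ?thesis using of_real_eq_iff by blast
    qed
    have "((\<lambda>v. (cmod (l2_inner torus ?g (char_fun v)))\<^sup>2) has_sum (l2_norm torus ?g)\<^sup>2) int_vecs"
      by (rule Parseval_norm[OF l2_orthonormal_torus l2_total_torus g])
    then have "((\<lambda>n. (cmod (l2_inner torus ?g (char_fun (int_vec_enum n))))\<^sup>2) has_sum (l2_norm torus ?g)\<^sup>2) UNIV"
      using has_sum_reindex_bij_betw[OF bij_int_vec_enum] by fast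
    from suminf_ennreal_has_sum[OF this zero_le_power2] show ?thesis unfolding co nrm .
  qed
  have "(\<integral>\<^sup>+\<xi>. ennreal ((cmod (ft h \<xi>))\<^sup>2) \<partial>lborel) = (\<integral>\<^sup>+\<theta>. ennreal ((l2_norm lborel h)\<^sup>2) \<partial>(torus::'a measure))"
    by (subst nn_integral_unfold) (auto simp: *)
  also have "\<dots> = ennreal ((l2_norm lborel h)\<^sup>2)"
    using emeasure_torus_space[where 'a='a] by simp
  finally show ?thesis .
qed

text \<open>Rescaling to the unit box. The squared modulus of the transform brings the square of
  L^n: one factor is consumed by the substitution in the frequency, the other by the substitution in
  the norm of h.\<close>

lemma Plancherel_box:
  fixes h :: "'a::euclidean_space \<Rightarrow> complex"
  assumes h: "h \<in> L2 lborel" and L: "0 < L" and supp: "\<And>x. x \<notin> unit_box \<Longrightarrow> h (c + L *\<^sub>R x) = 0"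
  shows "(\<integral>\<^sup>+\<xi>. ennreal ((cmod (ft h \<xi>))\<^sup>2) \<partial>lborel) = ennreal ((l2_norm lborel h)\<^sup>2)"
proof -
  have [measurable]: "h \<in> borel_measurable borel" using L2_measurable[OF h] by simp
  let ?h = "\<lambda>x. h (c + L *\<^sub>R x)" and ?d = "L ^ DIM('a)"
  have d: "0 < ?d" using L by simp
  have ft: "ft h \<xi> = of_real ?d * char_fun \<xi> c * ft ?h (L *\<^sub>R \<xi>)" for \<xi>
  proof -
    have "ft h \<xi> = of_real ?d * (LINT x|lborel. h (c + L *\<^sub>R x) * char_fun \<xi> (c + L *\<^sub>R x))"
      unfolding ft_def using L integral_lborel_affine[of L "\<lambda>x. h x * char_fun \<xi> x" c] by simp
    also have "(LINT x|lborel. h (c + L *\<^sub>R x) * char_fun \<xi> (c + L *\<^sub>R x)) = (LINT x|lborel. char_fun \<xi> c * (h (c + L *\<^sub>R x) * char_fun (L *\<^sub>R \<xi>) x))"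
      unfolding char_fun_add by (intro Bochner_Integration.integral_cong refl) (simp add: char_fun_def)
    finally show ?thesis by (simp add: ft_def)
  qed
  have "(\<integral>\<^sup>+\<xi>. ennreal ((cmod (ft h \<xi>))\<^sup>2) \<partial>lborel) = (\<integral>\<^sup>+\<xi>. ennreal (?d\<^sup>2) * ennreal ((cmod (ft ?h (0 + L *\<^sub>R \<xi>)))\<^sup>2) \<partial>lborel)"
  proof (intro nn_integral_cong)
    fix \<xi>
    have "cmod (complex_of_real ?d) = ?d" using d by (simp only: norm_of_real abs_of_pos)
    then show "ennreal ((cmod (ft h \<xi>))\<^sup>2) = ennreal (?d\<^sup>2) * ennreal ((cmod (ft ?h (0 + L *\<^sub>R \<xi>)))\<^sup>2)"
      unfolding ft norm_mult char_fun_simps power_mult_distrib by (simp add: ennreal_mult[symmetric] del: ennreal_power)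
  qed
  also have "\<dots> = ennreal (?d\<^sup>2) * (\<integral>\<^sup>+\<xi>. ennreal ((cmod (ft ?h (0 + L *\<^sub>R \<xi>)))\<^sup>2) \<partial>lborel)"
    by (rule nn_integral_cmult) measurable
  also have "\<dots> = ennreal ?d * (ennreal ?d * (\<integral>\<^sup>+\<xi>. ennreal ((cmod (ft ?h (0 + L *\<^sub>R \<xi>)))\<^sup>2) \<partial>lborel))"
    using d by (simp only: power2_eq_square ennreal_mult less_imp_le mult.assoc)
  also have "\<dots> = ennreal ?d * (\<integral>\<^sup>+\<xi>. ennreal ((cmod (ft ?h \<xi>))\<^sup>2) \<partial>lborel)"
    using nn_integral_lborel_affine[of L "\<lambda>\<xi>. ennreal ((cmod (ft ?h \<xi>))\<^sup>2)" 0] L by simp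
  also have "\<dots> = ennreal ?d * ennreal ((l2_norm lborel ?h)\<^sup>2)"
    using L by (subst Plancherel_unit_box[OF L2_lborel_affine(1)[OF _ h] supp]) auto
  also have "\<dots> = ennreal ((l2_norm lborel h)\<^sup>2)"
    using L2_lborel_affine(2)[OF _ h, of L c] L d by (simp add: ennreal_mult[symmetric] del: ennreal_power)
  finally show ?thesis .
qed

lemma ft_diff:
  assumes "integrable lborel f" "integrable lborel g"
  shows "ft (\<lambda>x. f x - g x) \<xi> = ft f \<xi> - ft g \<xi>"
  using integrable_mult_char_fun[OF assms(1)] integrable_mult_char_fun[OF assms(2)]
  by (simp add: ft_def ring_distribs)

lemma l2_truncation:
  fixes h :: "'a \<Rightarrow> complex"
  assumes h: "h \<in> L2 M" and A: "\<And>n. A n \<in> sets M" "incseq A" "(\<Union>n. A n) = UNIV"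
  shows "(\<lambda>x. indicator (A n) x * h x) \<in> L2 M"
    "(\<lambda>n. l2_norm M (\<lambda>x. indicator (A n) x * h x - h x)) \<longlonglongrightarrow> 0"
proof -
  note [measurable] = A(1) L2_measurable[OF h]
  show "(\<lambda>x. indicator (A n) x * h x) \<in> L2 M"
    by (rule L2_bounded_mult[OF h, of _ 1]) (auto split: split_indicator)
  have "(\<lambda>n. LINT x|M. (cmod (indicator (A n) x * h x - h x))\<^sup>2) \<longlonglongrightarrow> (LINT x|M. 0)"
  proof (rule integral_dominated_convergence[where w="\<lambda>x. (cmod (h x))\<^sup>2"])
    show "integrable M (\<lambda>x. (cmod (h x))\<^sup>2)" by (rule L2_integrable[OF h])
    show "AE x in M. norm ((cmod (indicator (A n) x * h x - h x))\<^sup>2) \<le> (cmod (h x))\<^sup>2" for n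
      by (intro AE_I2) (simp split: split_indicator)
    show "AE x in M. (\<lambda>n. (cmod (indicator (A n) x * h x - h x))\<^sup>2) \<longlonglongrightarrow> 0"
    proof (intro AE_I2)
      fix x
      have "(\<lambda>n. indicator (A n) x) \<longlonglongrightarrow> (indicator (\<Union>n. A n) x :: complex)"
        using A(2) by (rule LIMSEQ_indicator_incseq)
      then have "(\<lambda>n. indicator (A n) x) \<longlonglongrightarrow> (1 :: complex)" using A(3) by simp
      then have "(\<lambda>n. (cmod (indicator (A n) x * h x - h x))\<^sup>2) \<longlonglongrightarrow> (cmod (1 * h x - h x))\<^sup>2"
        by (intro tendsto_intros)
      then show "(\<lambda>n. (cmod (indicator (A n) x * h x - h x))\<^sup>2) \<longlonglongrightarrow> 0" by simp
    qed
  qed measurable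
  from tendsto_real_sqrt[OF this]
  show "(\<lambda>n. l2_norm M (\<lambda>x. indicator (A n) x * h x - h x)) \<longlonglongrightarrow> 0"
    by (simp add: l2_norm_def)
qed

text \<open>Truncations to large boxes are covered by \<open>Plancherel_box\<close>. Fatou along
  them gives only that the transform does not increase the norm; applied to the truncation errors,
  this inequality makes the transforms converge in norm, and equality follows.\<close>

theorem Plancherel:
  fixes h :: "'a::euclidean_space \<Rightarrow> complex"
  assumes h: "h \<in> L2 lborel" and int: "integrable lborel h"
  shows "ft h \<in> L2 lborel" "l2_norm lborel (ft h) = l2_norm lborel h"
proof -
  define A :: "nat \<Rightarrow> 'a set" where "A n = box (- real (Suc n) *\<^sub>R One) (real (Suc n) *\<^sub>R One)" for n
  define tr :: "('a \<Rightarrow> complex) \<Rightarrow> nat \<Rightarrow> 'a \<Rightarrow> complex" where "tr g n x = indicator (A n) x * g x" for g n x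
  have A: "A n \<in> sets lborel" "incseq A" "(\<Union>n. A n) = UNIV" for n
  proof -
    show "incseq A" by (auto simp: A_def incseq_def mem_box) (force+)?
    show "(\<Union>n. A n) = UNIV"
    proof safe
      fix x :: 'a
      obtain n where n: "norm x < real n" using reals_Archimedean2 by blast
      have "x \<in> A n" unfolding A_def mem_box
      proof
        fix b :: 'a assume "b \<in> Basis"
        with Basis_le_norm[OF this, of x] n
        show "(- real (Suc n) *\<^sub>R One) \<bullet> b < x \<bullet> b \<and> x \<bullet> b < (real (Suc n) *\<^sub>R One) \<bullet> b" by auto
      qed
      then show "x \<in> (\<Union>n. A n)" by blast
    qed simp
  qed (simp add: A_def)
  \<comment> \<open>The box \<open>A n\<close> is the image of the unit box under x -> -(n+1) One +
    2 (n+1) x, which is the form of support that \<open>Plancherel_box\<close> asks for.\<close>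
  have supp: "tr g n (- real (Suc n) *\<^sub>R One + (2 * real (Suc n)) *\<^sub>R x) = 0" if "x \<notin> unit_box" for g n x
  proof -
    obtain b where b: "b \<in> Basis" "\<not> (0 < x \<bullet> b \<and> x \<bullet> b < 1)" using \<open>x \<notin> unit_box\<close> by (auto simp: mem_box)
    have "- real (Suc n) *\<^sub>R One + (2 * real (Suc n)) *\<^sub>R x \<notin> A n"
    proof
      assume "- real (Suc n) *\<^sub>R One + (2 * real (Suc n)) *\<^sub>R x \<in> A n"
      then have "- real (Suc n) < - real (Suc n) + 2 * real (Suc n) * (x \<bullet> b) \<and> - real (Suc n) + 2 * real (Suc n) * (x \<bullet> b) < real (Suc n)"
        using b(1) unfolding A_def mem_box by (auto simp: inner_simps)
      then have "0 < real (Suc n) * (x \<bullet> b)" "real (Suc n) * (x \<bullet> b) < real (Suc n) * 1"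
        unfolding mult.assoc mult_1_right by linarith+
      then have "0 < x \<bullet> b" "x \<bullet> b < 1"
        by (simp_all add: zero_less_mult_iff del: of_nat_Suc)
      with b(2) show False by simp
    qed
    then show ?thesis by (simp add: tr_def)
  qed
  have tr: "tr g n \<in> L2 lborel" "(\<lambda>n. l2_norm lborel (\<lambda>x. tr g n x - g x)) \<longlonglongrightarrow> 0" if "g \<in> L2 lborel" for g n
    using l2_truncation[OF that A] by (simp_all add: tr_def[abs_def])
  have ti: "integrable lborel (tr g n)" if "integrable lborel g" for g n
    unfolding tr_def[abs_def] using A(1)[of n] by (intro integrable_indicator_mult_complex that) simp
  have Pn: "ft (tr g n) \<in> L2 lborel" "l2_norm lborel (ft (tr g n)) = l2_norm lborel (tr g n)" if "g \<in> L2 lborel" for g n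
  proof -
    have P: "(\<integral>\<^sup>+\<xi>. ennreal ((cmod (ft (tr g n) \<xi>))\<^sup>2) \<partial>lborel) = ennreal ((l2_norm lborel (tr g n))\<^sup>2)"
      using Plancherel_box[OF tr(1)[OF that] _ supp] by simp
    have [measurable]: "tr g n \<in> borel_measurable borel" using tr(1)[OF that, THEN L2_measurable] by simp
    show L: "ft (tr g n) \<in> L2 lborel" unfolding L2_iff_nn_integral using P by simp
    show "l2_norm lborel (ft (tr g n)) = l2_norm lborel (tr g n)"
      using P unfolding nn_integral_l2_norm[OF L] by simp
  qed
  have lim: "(\<lambda>n. ft (tr g n) \<xi>) \<longlonglongrightarrow> ft g \<xi>" if g: "integrable lborel g" for g :: "'a \<Rightarrow> complex" and \<xi>
    unfolding ft_def
  proof (rule integral_dominated_convergence[where w="\<lambda>x. cmod (g x)"])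
    show "AE x in lborel. (\<lambda>n. tr g n x * char_fun \<xi> x) \<longlonglongrightarrow> g x * char_fun \<xi> x"
    proof (intro AE_I2)
      fix x
      have "(\<lambda>n. indicator (A n) x) \<longlonglongrightarrow> (indicator (\<Union>n. A n) x :: complex)"
        using A(2) by (rule LIMSEQ_indicator_incseq)
      then have "(\<lambda>n. indicator (A n) x) \<longlonglongrightarrow> (1 :: complex)" using A(3) by simp
      then have "(\<lambda>n. tr g n x * char_fun \<xi> x) \<longlonglongrightarrow> 1 * g x * char_fun \<xi> x"
        unfolding tr_def by (intro tendsto_intros)
      then show "(\<lambda>n. tr g n x * char_fun \<xi> x) \<longlonglongrightarrow> g x * char_fun \<xi> x" by simp
    qed
    show "AE x in lborel. norm (tr g n x * char_fun \<xi> x) \<le> cmod (g x)" for n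
      by (intro AE_I2) (simp add: tr_def norm_mult char_fun_simps split: split_indicator)
    show "(\<lambda>x. tr g n x * char_fun \<xi> x) \<in> borel_measurable lborel" for n
      using integrable_mult_char_fun[OF ti[OF g]] by (rule borel_measurable_integrable)
  qed (use g integrable_mult_char_fun[OF g] in \<open>auto\<close>)
  have le: "ft g \<in> L2 lborel \<and> l2_norm lborel (ft g) \<le> l2_norm lborel g" if g: "g \<in> L2 lborel" "integrable lborel g" for g :: "'a \<Rightarrow> complex"
  proof -
    have [measurable]: "g \<in> borel_measurable borel" using g(2) by auto
    have b: "l2_norm lborel (ft (tr g n)) \<le> l2_norm lborel g" for n
      unfolding Pn(2)[OF g(1)] unfolding l2_norm_def
      by (intro real_sqrt_le_mono integral_mono L2_integrable tr g)
        (auto simp: tr_def indicator_def)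
    have "ft g \<in> borel_measurable lborel" by simp
    from l2_Fatou[OF Pn(1)[OF g(1)] b this AE_I2[OF lim[OF g(2)]]]
    show ?thesis by simp
  qed
  show L: "ft h \<in> L2 lborel" using le[OF h int] by simp
  have "(\<lambda>n. l2_norm lborel (\<lambda>\<xi>. ft (tr h n) \<xi> - ft h \<xi>)) \<longlonglongrightarrow> 0"
  proof (rule Lim_null_comparison[OF always_eventually tr(2)[OF h]], intro allI)
    fix n
    show "norm (l2_norm lborel (\<lambda>\<xi>. ft (tr h n) \<xi> - ft h \<xi>)) \<le> l2_norm lborel (\<lambda>x. tr h n x - h x)"
      using le[of "\<lambda>x. tr h n x - h x"] ti[OF int] tr(1)[OF h] h int
      by (simp add: L2_diff flip: ft_diff)
  qed
  from tendsto_l2_norm[OF this always_eventually L] Pn[OF h]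
  have "(\<lambda>n. l2_norm lborel (tr h n)) \<longlonglongrightarrow> l2_norm lborel (ft h)" by simp
  moreover from tendsto_l2_norm[OF tr(2)[OF h] always_eventually h] tr(1)[OF h]
  have "(\<lambda>n. l2_norm lborel (tr h n)) \<longlonglongrightarrow> l2_norm lborel h" by simp
  ultimately show "l2_norm lborel (ft h) = l2_norm lborel h" by (rule LIMSEQ_unique)
qed

section \<open>An orthonormal basis of \<open>L\<^sup>2(\<real>\<^sup>n)\<close>\<close>

text \<open>A Gabor basis: the exponentials on each unit cube of the tiling. It witnesses that an
  orthonormal basis exists, which gives the choice in \<open>some_onb\<close> its meaning.\<close>

definition cube_char :: "'a \<times> 'a \<Rightarrow> 'a::euclidean_space \<Rightarrow> complex" where
  "cube_char kv x = indicator unit_box (x - fst kv) * char_fun (snd kv) x"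

lemma inner_int_vecs: "v \<in> int_vecs \<Longrightarrow> w \<in> int_vecs \<Longrightarrow> v \<bullet> w \<in> \<int>"
  by (subst euclidean_inner) (auto simp: int_vecs_def)

lemma char_fun_int_vecs: 
  assumes "v \<in> int_vecs" "w \<in> int_vecs"
  shows "char_fun v w = 1"
  using cis_multiple_2pi[OF inner_int_vecs[OF assms]] by (simp add: char_fun_def)

lemma L2_cube_char: "cube_char kv \<in> L2 lborel"
proof -
  have "(\<lambda>x. indicator unit_box x * char_fun (snd kv) (x + fst kv)) \<in> L2 lborel"
  proof -
    have "(\<lambda>x. char_fun (snd kv) (fst kv) * char_fun (snd kv) x) \<in> L2 torus"
      by (intro L2_scale) (rule L2_char_fun_torus)
    then show ?thesis unfolding L2_torus_iff char_fun_add by (simp add: mult_ac)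
  qed
  from L2_lborel_affine(1)[OF _ this, of 1 "- fst kv"] show ?thesis
    by (simp add: cube_char_def[abs_def])
qed

lemma l2_inner_cube_char:
  assumes f: "f \<in> L2 lborel" and kv: "k \<in> int_vecs" "v \<in> int_vecs"
  shows "l2_inner lborel f (cube_char (k, v)) = (LINT x|torus. f (x + k) * cnj (char_fun v x))"
proof -
  have [measurable]: "f \<in> borel_measurable borel" using L2_measurable[OF f] by simp
  have "l2_inner lborel f (cube_char (k, v)) = (LINT x|lborel. f (x + k) * cnj (cube_char (k, v) (x + k)))"
    unfolding l2_inner_def
    by (rule integral_lborel_translate[symmetric]) (simp add: cube_char_def)
  also have "\<dots> = (LINT x|torus. f (x + k) * cnj (char_fun v x))"
    unfolding integral_torus
    by (intro Bochner_Integration.integral_cong refl)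
      (simp add: cube_char_def char_fun_add char_fun_int_vecs kv indicator_def)
  finally show ?thesis .
qed

lemma l2_orthonormal_cube_char: "l2_orthonormal lborel (int_vecs \<times> int_vecs) cube_char"
  unfolding l2_orthonormal_def
proof (intro conjI ballI L2_cube_char)
  fix p q :: "'a \<times> 'a" assume pq: "p \<in> int_vecs \<times> int_vecs" "q \<in> int_vecs \<times> int_vecs"
  obtain k v k' v' where [simp]: "p = (k, v)" "q = (k', v')" by (cases p, cases q)
  have in_vecs: "k \<in> int_vecs" "v \<in> int_vecs" "k' \<in> int_vecs" "v' \<in> int_vecs" using pq by auto
  have eq: "l2_inner lborel (cube_char p) (cube_char q) = (LINT x|torus. cube_char (k, v) (x + k') * cnj (char_fun v' x))"
    using l2_inner_cube_char[OF L2_cube_char in_vecs(3,4)] by simp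
  show "l2_inner lborel (cube_char p) (cube_char q) = (if p = q then 1 else 0)"
  proof (cases "k = k'")
    case True
    have "l2_inner lborel (cube_char p) (cube_char q) = (LINT x|torus. char_fun v x * cnj (char_fun v' x))"
      unfolding eq integral_torus
      by (intro Bochner_Integration.integral_cong refl)
        (auto simp: True cube_char_def char_fun_add char_fun_int_vecs in_vecs indicator_def)
    also have "\<dots> = (if v = v' then 1 else 0)"
      using l2_orthonormalD(2)[OF l2_orthonormal_torus in_vecs(2,4)] by (simp add: l2_inner_def)
    finally show ?thesis using True by simp
  next
    case False
    then have "\<exists>b\<in>Basis. k \<bullet> b \<noteq> k' \<bullet> b" using euclidean_eqI by blast
    then obtain b where b: "b \<in> Basis" "(k' - k) \<bullet> b \<noteq> 0" by (auto simp: inner_diff_left)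
    obtain m where m: "(k' - k) \<bullet> b = of_int m" using int_vecs_closed(4)[OF in_vecs(3,1)] b(1)
      by (auto simp: int_vecs_def elim: Ints_cases)
    have "indicator unit_box x * cube_char (k, v) (x + k') = 0" for x
    proof -
      have "\<not> (x \<in> unit_box \<and> x + k' - k \<in> unit_box)"
      proof
        assume "x \<in> unit_box \<and> x + k' - k \<in> unit_box"
        then have "0 < x \<bullet> b" "x \<bullet> b < 1" "0 < (x + k' - k) \<bullet> b" "(x + k' - k) \<bullet> b < 1"
          using b(1) by (auto simp: mem_box)
        moreover have "(x + k' - k) \<bullet> b = x \<bullet> b + of_int m" using m by (simp add: inner_simps)
        ultimately have "m = 0" by linarith
        then show False using m b by simp
      qed
      then show ?thesis by (auto simp: cube_char_def indicator_def)
    qed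
    then have "indicator unit_box x * (cube_char (k, v) (x + k') * cnj (char_fun v' x)) = 0" for x
      by (metis mult.assoc mult_zero_left)
    then show ?thesis using False unfolding eq integral_torus by (simp only: Bochner_Integration.integral_zero) simp
  qed
qed

text \<open>The coefficients with a fixed cube are the Fourier coefficients of f on that cube, so f
  vanishes there; countably many cubes cover almost all of space.\<close>

lemma l2_total_cube_char: "l2_total lborel (int_vecs \<times> int_vecs) cube_char"
  unfolding l2_total_def
proof (intro ballI impI)
  fix f :: "'a \<Rightarrow> complex" assume f: "f \<in> L2 lborel" and z: "\<forall>p\<in>int_vecs \<times> int_vecs. l2_inner lborel f (cube_char p) = 0"
  have [measurable]: "f \<in> borel_measurable borel" using L2_measurable[OF f] by simp
  have "AE x in lborel. x - k \<in> unit_box \<longrightarrow> f x = 0" if k: "k \<in> int_vecs" for k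
  proof -
    have "(\<lambda>x. f (x + k)) \<in> L2 lborel"
      using L2_lborel_affine(1)[OF _ f, of 1 k] by (simp add: add.commute)
    then have "(\<lambda>x. indicator unit_box x * f (x + k)) \<in> L2 lborel"
      by (rule L2_bounded_mult[of _ _ _ 1]) (auto split: split_indicator)
    then have "(\<lambda>x. f (x + k)) \<in> L2 torus" by (simp add: L2_torus_iff)
    then have "AE x in torus. f (x + k) = 0"
      using z k l2_inner_cube_char[OF f k] by (intro Fourier_uniqueness_torus L2_torus_integrable) auto
    then have AE: "AE x in lborel. x \<in> unit_box \<longrightarrow> f (x + k) = 0"
      by (simp add: AE_restrict_space_iff)
    have "AE x in distr lborel borel ((+) (k)). x - k \<in> unit_box \<longrightarrow> f x = 0"
      using AE by (subst AE_distr_iff) (auto simp: add.commute)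
    then show ?thesis unfolding lborel_distr_plus .
  qed
  then have "AE x in lborel. \<forall>k\<in>int_vecs. x - k \<in> unit_box \<longrightarrow> f x = 0"
    by (subst AE_ball_countable) (auto simp: countable_int_vecs)
  with AE_unique_unit_box_translate show "AE x in lborel. f x = 0"
  proof eventually_elim
    case (elim x)
    then obtain v where "v \<in> int_vecs" "x + v \<in> unit_box" by blast
    with elim(2) int_vecs_closed(3)[of v] show ?case by (metis diff_minus_eq_add)
  qed
qed

lemma l2_onb_iff: "l2_onb M e \<longleftrightarrow> l2_orthonormal M UNIV e \<and> l2_total M UNIV e"
  by (auto simp: l2_onb_def l2_orthonormal_def l2_total_def)

theorem l2_onb_exists: "\<exists>e. l2_onb (lborel :: 'a::euclidean_space measure) e"
proof -
  define b :: "nat \<Rightarrow> 'a \<times> 'a" where "b = from_nat_into (int_vecs \<times> int_vecs)"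
  have bij: "bij_betw b UNIV (int_vecs \<times> int_vecs)"
    unfolding b_def using int_vecs_closed(1)
    by (intro bij_betw_from_nat_into countable_SIGMA countable_int_vecs) (auto simp: finite_cartesian_product_iff infinite_int_vecs)
  then have b: "b n \<in> int_vecs \<times> int_vecs" "b n = b m \<longleftrightarrow> n = m" for n m
    by (auto dest: bij_betwE bij_betw_imp_inj_on simp: inj_eq)
  have "l2_orthonormal lborel UNIV (cube_char \<circ> b)"
    unfolding l2_orthonormal_def o_def
    by (simp only: l2_orthonormalD[OF l2_orthonormal_cube_char] b(1)) (simp add: b(2))
  moreover have "l2_total lborel UNIV (cube_char \<circ> b)"
    unfolding l2_total_def
  proof (intro ballI impI)
    fix f :: "'a \<Rightarrow> complex" assume f: "f \<in> L2 lborel" "\<forall>i\<in>UNIV. l2_inner lborel f ((cube_char \<circ> b) i) = 0"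
    have "l2_inner lborel f (cube_char p) = 0" if "p \<in> int_vecs \<times> int_vecs" for p
    proof -
      have "p \<in> range b" using bij_betw_imp_surj_on[OF bij] that by simp
      then obtain n where "p = b n" by (rule rangeE)
      then show ?thesis using f(2) by simp
    qed
    then show "AE x in lborel. f x = 0"
      by (rule l2_total_cube_char[unfolded l2_total_def, rule_format, OF f(1)])
  qed
  ultimately show ?thesis unfolding l2_onb_iff by blast
qed

lemma l2_onb_some_onb: "l2_onb (lborel :: (real^'n::finite) measure) some_onb"
  unfolding some_onb_def by (rule someI_ex[OF l2_onb_exists])

section \<open>Integral operators with square integrable kernel\<close>

text \<open>Written with norms of f + c g only, so that an identity proved for the norms of all such
  combinations carries over to inner products.\<close>

lemma l2_polarization:
  assumes f: "f \<in> L2 M" and g: "g \<in> L2 M"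
  shows "l2_inner M f g = 
    (of_real ((l2_norm M (\<lambda>x. f x + 1 * g x))\<^sup>2) - of_real ((l2_norm M (\<lambda>x. f x + (-1) * g x))\<^sup>2) +
     \<i> * (of_real ((l2_norm M (\<lambda>x. f x + \<i> * g x))\<^sup>2) - of_real ((l2_norm M (\<lambda>x. f x + (-\<i>) * g x))\<^sup>2))) / 4"
proof -
  have *: "(l2_norm M (\<lambda>x. f x + c * g x))\<^sup>2 = (l2_norm M f)\<^sup>2 + 2 * Re (cnj c * l2_inner M f g) + (cmod c * l2_norm M g)\<^sup>2" for c
    by (simp only: l2_norm_add_sq[OF f L2_scale[OF g]] l2_inner_scale_right l2_norm_scale)
  show ?thesis unfolding * by (simp add: complex_eq_iff)
qed

lemma l2_inner_eqI_norm:
  assumes "f \<in> L2 M" "g \<in> L2 M" "f' \<in> L2 N" "g' \<in> L2 N"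
    and "\<And>c. l2_norm M (\<lambda>x. f x + c * g x) = l2_norm N (\<lambda>x. f' x + c * g' x)"
  shows "l2_inner M f g = l2_inner N f' g'"
  using assms by (simp only: l2_polarization)

text \<open>Collects what follows from a change of variables with constant Jacobian c. Its instances
  are coordinate permutations and group translations with c = 1, and the substitution behind the
  operator kernel with c = |\<omega>|^n. Only nonnegative integrals have to be checked in an
  instance.\<close>

locale scaled_measure_map =
  fixes T :: "'b::euclidean_space \<Rightarrow> 'a::euclidean_space" and c :: real
  assumes meas [measurable]: "T \<in> borel_measurable borel" and c_pos: "0 < c"
    and nn: "\<And>f. f \<in> borel_measurable borel \<Longrightarrow> integral\<^sup>N lborel f = ennreal c * (\<integral>\<^sup>+x. f (T x) \<partial>lborel)"
begin

text \<open>Tested on indicators, the integral identity is an identity of measures, from which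
  Bochner integrals and null sets transfer.\<close>

lemma measure_eq: "lborel = density (distr lborel borel T) (\<lambda>_. ennreal c)"
proof (rule measure_eqI)
  fix A :: "'a set" assume "A \<in> sets lborel"
  then have [measurable]: "A \<in> sets borel" by simp
  have "emeasure lborel A = ennreal c * (\<integral>\<^sup>+x. indicator A (T x) \<partial>lborel)"
    using nn[of "indicator A"] by simp
  also have "(\<integral>\<^sup>+x. indicator A (T x) \<partial>lborel) = emeasure (distr lborel borel T) A"
    using nn_integral_distr[of T lborel borel "indicator A"] by simp
  also have "ennreal c * emeasure (distr lborel borel T) A = emeasure (density (distr lborel borel T) (\<lambda>_. ennreal c)) A"
    by (simp add: emeasure_density nn_integral_cmult)
  finally show "emeasure lborel A = emeasure (density (distr lborel borel T) (\<lambda>_. ennreal c)) A" .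
qed simp

lemma integral_map:
  fixes f :: "'a \<Rightarrow> complex"
  assumes [measurable]: "f \<in> borel_measurable borel"
  shows "integral\<^sup>L lborel f = of_real c * (LINT x|lborel. f (T x))"
proof -
  have "integral\<^sup>L lborel f = integral\<^sup>L (density (distr lborel borel T) (\<lambda>_. ennreal c)) f"
    using measure_eq by simp
  also have "\<dots> = of_real c * (LINT x|lborel. f (T x))"
    using c_pos by (subst integral_density) (auto simp: integral_distr scaleR_conv_of_real)
  finally show ?thesis .
qed

lemma integrable_map_iff:
  fixes f :: "'a \<Rightarrow> complex"
  assumes [measurable]: "f \<in> borel_measurable borel"
  shows "integrable lborel (\<lambda>x. f (T x)) \<longleftrightarrow> integrable lborel f"
  using nn[of "\<lambda>x. ennreal (norm (f x))"] c_pos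
  by (auto simp: integrable_iff_bounded ennreal_mult_less_top)

lemma L2_map_iff:
  fixes f :: "'a \<Rightarrow> complex"
  assumes [measurable]: "f \<in> borel_measurable borel"
  shows "(\<lambda>x. f (T x)) \<in> L2 lborel \<longleftrightarrow> f \<in> L2 lborel"
  using nn[of "\<lambda>x. ennreal ((cmod (f x))\<^sup>2)"] c_pos
  by (auto simp: L2_iff_nn_integral ennreal_mult_less_top)

lemma l2_inner_map:
  assumes [measurable]: "f \<in> borel_measurable borel" "g \<in> borel_measurable borel"
  shows "l2_inner lborel f g = of_real c * l2_inner lborel (\<lambda>x. f (T x)) (\<lambda>x. g (T x))"
  unfolding l2_inner_def by (rule integral_map) measurable

lemma l2_norm_map:
  assumes "f \<in> borel_measurable borel"
  shows "(l2_norm lborel f)\<^sup>2 = c * (l2_norm lborel (\<lambda>x. f (T x)))\<^sup>2"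
proof -
  have "complex_of_real ((l2_norm lborel f)\<^sup>2) = of_real (c * (l2_norm lborel (\<lambda>x. f (T x)))\<^sup>2)"
    using l2_inner_map[OF assms assms] unfolding l2_inner_self by (simp only: of_real_mult)
  then show ?thesis using of_real_eq_iff by blast
qed

lemma AE_map_iff:
  assumes [measurable]: "Measurable.pred borel P"
  shows "(AE x in lborel. P (T x)) \<longleftrightarrow> (AE x in lborel. P x)"
proof -
  have "(AE x in lborel. P x) \<longleftrightarrow> (AE x in density (distr lborel borel T) (\<lambda>_. ennreal c). P x)"
    by (rule arg_cong[OF measure_eq, of "\<lambda>M. AE x in M. P x"])
  also have "\<dots> \<longleftrightarrow> (AE x in lborel. P (T x))"
    using c_pos by (subst AE_density) (auto simp: AE_distr_iff)
  finally show ?thesis by simp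
qed

end

lemma nn_integral_lborel_pair:
  fixes f :: "'a::euclidean_space \<times> 'b::euclidean_space \<Rightarrow> ennreal"
  assumes "f \<in> borel_measurable borel"
  shows "integral\<^sup>N lborel f = (\<integral>\<^sup>+x. \<integral>\<^sup>+y. f (x, y) \<partial>lborel \<partial>lborel)"
    "integral\<^sup>N lborel f = (\<integral>\<^sup>+y. \<integral>\<^sup>+x. f (x, y) \<partial>lborel \<partial>lborel)"
proof -
  have m: "f \<in> borel_measurable (lborel \<Otimes>\<^sub>M lborel)"
    using assms by (simp add: lborel_prod)
  show "integral\<^sup>N lborel f = (\<integral>\<^sup>+x. \<integral>\<^sup>+y. f (x, y) \<partial>lborel \<partial>lborel)"
    using lborel.nn_integral_fst[OF m] by (simp add: lborel_prod)
  then show "integral\<^sup>N lborel f = (\<integral>\<^sup>+y. \<integral>\<^sup>+x. f (x, y) \<partial>lborel \<partial>lborel)"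
    using lborel_pair.Fubini[OF m] by simp
qed

definition kernel_op :: "('a::euclidean_space \<times> 'a \<Rightarrow> complex) \<Rightarrow> ('a \<Rightarrow> complex) \<Rightarrow> 'a \<Rightarrow> complex" where
  "kernel_op K a \<xi> = (LINT \<eta>|lborel. K (\<xi>, \<eta>) * a \<eta>)"

lemma borel_measurable_kernel_op [measurable]:
  assumes [measurable]: "K \<in> borel_measurable borel" "a \<in> borel_measurable borel"
  shows "kernel_op K a \<in> borel_measurable borel"
  unfolding kernel_op_def by measurable

lemma AE_section_L2:
  fixes K :: "'a::euclidean_space \<times> 'b::euclidean_space \<Rightarrow> complex"
  assumes K: "K \<in> L2 lborel"
  shows "AE \<xi> in lborel. (\<lambda>\<eta>. K (\<xi>, \<eta>)) \<in> L2 lborel"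
proof -
  have [measurable]: "K \<in> borel_measurable borel" using L2_measurable[OF K] by simp
  have "(\<integral>\<^sup>+\<xi>. \<integral>\<^sup>+\<eta>. ennreal ((cmod (K (\<xi>, \<eta>)))\<^sup>2) \<partial>lborel \<partial>lborel) \<noteq> \<infinity>"
    using K nn_integral_lborel_pair(1)[of "\<lambda>z. ennreal ((cmod (K z))\<^sup>2)"] by (simp add: L2_iff_nn_integral)
  then have "AE \<xi> in lborel. (\<integral>\<^sup>+\<eta>. ennreal ((cmod (K (\<xi>, \<eta>)))\<^sup>2) \<partial>lborel) \<noteq> \<infinity>"
    by (intro nn_integral_PInf_AE) measurable
  then show ?thesis
    by eventually_elim (auto simp: L2_iff_nn_integral top.not_eq_extremum)
qed

lemma kernel_op_inner: "kernel_op K a \<xi> = l2_inner lborel (\<lambda>\<eta>. K (\<xi>, \<eta>)) (\<lambda>\<eta>. cnj (a \<eta>))"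
  by (simp add: kernel_op_def l2_inner_def)

lemma l2_norm_cnj: "l2_norm M (\<lambda>x. cnj (a x)) = l2_norm M a"
  by (simp add: l2_norm_def)

lemma nn_integral_section_norm:
  fixes K :: "'a::euclidean_space \<times> 'b::euclidean_space \<Rightarrow> complex"
  assumes K: "K \<in> L2 lborel"
  shows "(\<integral>\<^sup>+\<xi>. ennreal ((l2_norm lborel (\<lambda>\<eta>. K (\<xi>, \<eta>)))\<^sup>2) \<partial>lborel) = ennreal ((l2_norm lborel K)\<^sup>2)"
proof -
  have [measurable]: "K \<in> borel_measurable borel" using L2_measurable[OF K] by simp
  have "(\<integral>\<^sup>+\<xi>. ennreal ((l2_norm lborel (\<lambda>\<eta>. K (\<xi>, \<eta>)))\<^sup>2) \<partial>lborel) = (\<integral>\<^sup>+\<xi>. \<integral>\<^sup>+\<eta>. ennreal ((cmod (K (\<xi>, \<eta>)))\<^sup>2) \<partial>lborel \<partial>lborel)"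
    using AE_section_L2[OF K] by (intro nn_integral_cong_AE) (auto simp: nn_integral_l2_norm elim!: AE_mp)
  also have "\<dots> = ennreal ((l2_norm lborel K)\<^sup>2)"
    using nn_integral_lborel_pair(1)[of "\<lambda>z. ennreal ((cmod (K z))\<^sup>2)"] by (simp add: nn_integral_l2_norm[OF K])
  finally show ?thesis .
qed

text \<open>Cauchy--Schwarz in \<eta> for almost every \<xi>, then integration over \<xi>.\<close>

lemma kernel_op_bound:
  assumes K: "K \<in> L2 lborel" and a: "a \<in> L2 lborel"
  shows "kernel_op K a \<in> L2 lborel" "l2_norm lborel (kernel_op K a) \<le> l2_norm lborel K * l2_norm lborel a"
proof -
  have [measurable]: "K \<in> borel_measurable borel" "a \<in> borel_measurable borel" 
    using L2_measurable[OF K] L2_measurable[OF a] by auto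
  have "(\<integral>\<^sup>+\<xi>. ennreal ((cmod (kernel_op K a \<xi>))\<^sup>2) \<partial>lborel)
     \<le> (\<integral>\<^sup>+\<xi>. ennreal ((l2_norm lborel a)\<^sup>2) * ennreal ((l2_norm lborel (\<lambda>\<eta>. K (\<xi>, \<eta>)))\<^sup>2) \<partial>lborel)"
  proof (rule nn_integral_mono_AE, rule AE_mp[OF AE_section_L2[OF K]], intro AE_I2 impI)
    fix \<xi> assume elim: "(\<lambda>\<eta>. K (\<xi>, \<eta>)) \<in> L2 lborel"
    have "cmod (kernel_op K a \<xi>) \<le> l2_norm lborel (\<lambda>\<eta>. K (\<xi>, \<eta>)) * l2_norm lborel a"
      using l2_Cauchy_Schwarz[OF elim L2_cnj[OF a]] by (simp add: kernel_op_inner l2_norm_cnj)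
    then have "(cmod (kernel_op K a \<xi>))\<^sup>2 \<le> (l2_norm lborel a)\<^sup>2 * (l2_norm lborel (\<lambda>\<eta>. K (\<xi>, \<eta>)))\<^sup>2"
      by (metis norm_ge_zero power_mono power_mult_distrib mult.commute)
    then show "ennreal ((cmod (kernel_op K a \<xi>))\<^sup>2) \<le> ennreal ((l2_norm lborel a)\<^sup>2) * ennreal ((l2_norm lborel (\<lambda>\<eta>. K (\<xi>, \<eta>)))\<^sup>2)"
      by (simp add: ennreal_leI flip: ennreal_mult)
  qed
  also have "\<dots> = ennreal ((l2_norm lborel a)\<^sup>2) * ennreal ((l2_norm lborel K)\<^sup>2)"
    unfolding nn_integral_section_norm[OF K, symmetric]
    by (rule nn_integral_cmult) (simp add: l2_norm_def)
  also have "\<dots> = ennreal ((l2_norm lborel K * l2_norm lborel a)\<^sup>2)"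
    by (simp add: power_mult_distrib mult.commute flip: ennreal_mult)
  finally have *: "(\<integral>\<^sup>+\<xi>. ennreal ((cmod (kernel_op K a \<xi>))\<^sup>2) \<partial>lborel) \<le> ennreal ((l2_norm lborel K * l2_norm lborel a)\<^sup>2)" .
  then show L: "kernel_op K a \<in> L2 lborel"
    by (auto simp: L2_iff_nn_integral order_le_less_trans)
  show "l2_norm lborel (kernel_op K a) \<le> l2_norm lborel K * l2_norm lborel a"
  proof (rule power2_le_imp_le)
    show "(l2_norm lborel (kernel_op K a))\<^sup>2 \<le> (l2_norm lborel K * l2_norm lborel a)\<^sup>2"
      using * unfolding nn_integral_l2_norm[OF L] by simp
  qed simp
qed

text \<open>Additivity is derived at those \<xi> whose section of K is square integrable, that is,
  almost everywhere.\<close>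

lemma AE_kernel_op_linear:
  assumes K: "K \<in> L2 lborel" and a: "a \<in> L2 lborel" and b: "b \<in> L2 lborel"
  shows "AE \<xi> in lborel. kernel_op K (\<lambda>z. c * a z + d * b z) \<xi> = c * kernel_op K a \<xi> + d * kernel_op K b \<xi>"
  using AE_section_L2[OF K]
proof eventually_elim
  case (elim \<xi>)
  have "integrable lborel (\<lambda>\<eta>. K (\<xi>, \<eta>) * (c * a \<eta>))" "integrable lborel (\<lambda>\<eta>. K (\<xi>, \<eta>) * (d * b \<eta>))"
    by (intro L2_mult_integrable elim L2_scale a b)+
  then have "kernel_op K (\<lambda>z. c * a z + d * b z) \<xi> = (LINT \<eta>|lborel. K (\<xi>, \<eta>) * (c * a \<eta>)) + (LINT \<eta>|lborel. K (\<xi>, \<eta>) * (d * b \<eta>))"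
    by (simp add: kernel_op_def ring_distribs)
  moreover have "(LINT \<eta>|lborel. K (\<xi>, \<eta>) * (c * a \<eta>)) = c * kernel_op K a \<xi>" for c a
    by (simp add: kernel_op_def mult.left_commute)
  ultimately show ?case by simp
qed

lemma AE_kernel_op_add:
  assumes K: "K \<in> L2 lborel" and L: "L \<in> L2 lborel" and a: "a \<in> L2 lborel"
  shows "AE \<xi> in lborel. kernel_op (\<lambda>z. K z + c * L z) a \<xi> = kernel_op K a \<xi> + c * kernel_op L a \<xi>"
  using AE_section_L2[OF K] AE_section_L2[OF L]
proof eventually_elim
  case (elim \<xi>)
  then have "integrable lborel (\<lambda>\<eta>. K (\<xi>, \<eta>) * a \<eta>)" "integrable lborel (\<lambda>\<eta>. L (\<xi>, \<eta>) * a \<eta>)"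
    by (auto intro: L2_mult_integrable a)
  then show ?case by (simp add: kernel_op_def ring_distribs mult.assoc)
qed

lemma l2_bounded_op_kernel: "K \<in> L2 lborel \<Longrightarrow> l2_bounded_op (kernel_op K)"
  unfolding l2_bounded_op_def using kernel_op_bound AE_kernel_op_linear by blast

lemma some_onb_L2: "some_onb j \<in> L2 lborel"
  using l2_onb_some_onb by (auto simp: l2_onb_def)

text \<open>The second form is the one for kernel operators: \<open>kernel_op\<close> pairs a
  section of the kernel with a function without conjugating it, so the coefficients are taken
  against the conjugate basis.\<close>

lemma some_onb_Parseval:
  fixes f :: "real^'n::finite \<Rightarrow> complex"
  assumes f: "f \<in> L2 lborel"
  shows "(\<Sum>j. ennreal ((cmod (l2_inner lborel f (some_onb j)))\<^sup>2)) = ennreal ((l2_norm lborel f)\<^sup>2)"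
    "(\<Sum>j. ennreal ((cmod (l2_inner lborel f (\<lambda>x. cnj (some_onb j x))))\<^sup>2)) = ennreal ((l2_norm lborel f)\<^sup>2)"
proof -
  have on: "l2_orthonormal (lborel :: (real^'n) measure) UNIV some_onb" "l2_total (lborel :: (real^'n) measure) UNIV some_onb"
    using l2_onb_some_onb unfolding l2_onb_iff by auto
  have *: "(\<Sum>j. ennreal ((cmod (l2_inner lborel g (some_onb j)))\<^sup>2)) = ennreal ((l2_norm lborel g)\<^sup>2)" 
    if "g \<in> L2 lborel" for g :: "real^'n::finite \<Rightarrow> complex"
    by (intro suminf_ennreal_has_sum Parseval_norm[OF on that]) simp
  show "(\<Sum>j. ennreal ((cmod (l2_inner lborel f (some_onb j)))\<^sup>2)) = ennreal ((l2_norm lborel f)\<^sup>2)"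
    by (rule *[OF f])
  have "l2_inner lborel f (\<lambda>x. cnj (some_onb j x)) = cnj (l2_inner lborel (\<lambda>x. cnj (f x)) (some_onb j))" for j
    unfolding l2_inner_def by (subst Bochner_Integration.integral_cnj[symmetric]) simp
  then show "(\<Sum>j. ennreal ((cmod (l2_inner lborel f (\<lambda>x. cnj (some_onb j x))))\<^sup>2)) = ennreal ((l2_norm lborel f)\<^sup>2)"
    using *[OF L2_cnj[OF f]] by (simp add: l2_norm_cnj)
qed

text \<open>At a fixed \<xi> the images of the basis functions take as values the coefficients of
  the section of K in the conjugate basis. Parseval sums their squares to the norm of the section,
  and integration over \<xi> gives the norm of K.\<close>

lemma kernel_op_sums:
  assumes K: "K \<in> L2 lborel"
  shows "(\<Sum>j. ennreal ((l2_norm lborel (kernel_op K (some_onb j)))\<^sup>2)) = ennreal ((l2_norm lborel K)\<^sup>2)"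
proof -
  have [measurable]: "K \<in> borel_measurable borel" "some_onb j \<in> borel_measurable borel" for j
    using L2_measurable[OF K] L2_measurable[OF some_onb_L2] by auto
  have "(\<Sum>j. ennreal ((l2_norm lborel (kernel_op K (some_onb j)))\<^sup>2)) = (\<Sum>j. \<integral>\<^sup>+\<xi>. ennreal ((cmod (kernel_op K (some_onb j) \<xi>))\<^sup>2) \<partial>lborel)"
    by (simp add: nn_integral_l2_norm kernel_op_bound K some_onb_L2)
  also have "\<dots> = (\<integral>\<^sup>+\<xi>. (\<Sum>j. ennreal ((cmod (kernel_op K (some_onb j) \<xi>))\<^sup>2)) \<partial>lborel)"
    by (rule nn_integral_suminf[symmetric]) measurable
  also have "\<dots> = (\<integral>\<^sup>+\<xi>. ennreal ((l2_norm lborel (\<lambda>\<eta>. K (\<xi>, \<eta>)))\<^sup>2) \<partial>lborel)"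
    by (rule nn_integral_cong_AE, rule AE_mp[OF AE_section_L2[OF K]])
      (intro AE_I2 impI, simp only: kernel_op_inner some_onb_Parseval)
  finally show ?thesis by (simp add: nn_integral_section_norm[OF K])
qed

lemma hs_norm_sq_kernel: "K \<in> L2 lborel \<Longrightarrow> hs_norm_sq (kernel_op K) = ennreal ((l2_norm lborel K)\<^sup>2)"
  by (simp only: hs_norm_sq_def kernel_op_sums)

lemma hilbert_schmidt_kernel: "K \<in> L2 lborel \<Longrightarrow> hilbert_schmidt (kernel_op K)"
  by (simp add: hilbert_schmidt_def l2_bounded_op_kernel hs_norm_sq_kernel)

lemma sums_ennreal_suminf:
  assumes "(\<Sum>j. ennreal (f j)) = ennreal s" "\<And>j. 0 \<le> f j" "0 \<le> s"
  shows "f sums s"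
proof -
  have sm: "summable f" using assms by (intro summable_suminf_not_top) simp_all
  have "ennreal (suminf f) = ennreal s" using suminf_ennreal2[OF assms(2) sm] assms(1) by (rule trans[OF sym])
  then have "suminf f = s" using assms(3) suminf_nonneg[OF sm assms(2)] by (simp only: ennreal_inj)
  with sm show ?thesis by (simp only: sums_iff)
qed

text \<open>The norm identity is applied to K + c L for the four values of c in the polarization
  formula and the resulting series are combined termwise.\<close>

lemma hs_inner_kernel:
  assumes K: "K \<in> L2 lborel" and L: "L \<in> L2 lborel"
  shows "hs_inner (kernel_op K) (kernel_op L) = l2_inner lborel K L"
proof -
  let ?e = "some_onb" 
  have s: "(\<lambda>j. complex_of_real ((l2_norm lborel (\<lambda>\<xi>. kernel_op K (?e j) \<xi> + c * kernel_op L (?e j) \<xi>))\<^sup>2)) sums 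
      of_real ((l2_norm lborel (\<lambda>z. K z + c * L z))\<^sup>2)" for c
  proof -
    have KL: "(\<lambda>z. K z + c * L z) \<in> L2 lborel" by (intro L2_add L2_scale K L)
    have "l2_norm lborel (kernel_op (\<lambda>z. K z + c * L z) (?e j)) = l2_norm lborel (\<lambda>\<xi>. kernel_op K (?e j) \<xi> + c * kernel_op L (?e j) \<xi>)" for j
      by (intro l2_norm_cong_AE AE_kernel_op_add L2_measurable kernel_op_bound L2_add L2_scale K L some_onb_L2)
    with sums_ennreal_suminf[OF kernel_op_sums[OF KL]]
    show ?thesis unfolding sums_of_real_iff by simp
  qed
  have "(\<lambda>j. l2_inner lborel (kernel_op K (?e j)) (kernel_op L (?e j))) sums l2_inner lborel K L"
    unfolding l2_polarization[OF K L] l2_polarization[OF kernel_op_bound(1)[OF K some_onb_L2] kernel_op_bound(1)[OF L some_onb_L2]]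
    by (intro sums_divide sums_add sums_diff sums_mult s)
  then show ?thesis by (simp add: hs_inner_def sums_iff)
qed

text \<open>Operators are compared only on the basis functions, since this is how much of a chosen
  transform is determined.\<close>

lemma hs_norm_sq_cong_AE:
  assumes "\<And>j. T (some_onb j) \<in> borel_measurable lborel" "\<And>j. S (some_onb j) \<in> borel_measurable lborel"
    "\<And>j. AE \<xi> in lborel. T (some_onb j) \<xi> = S (some_onb j) \<xi>"
  shows "hs_norm_sq T = hs_norm_sq S"
  unfolding hs_norm_sq_def using l2_norm_cong_AE[OF assms] by simp

lemma hs_inner_cong_AE:
  assumes "\<And>j. T (some_onb j) \<in> borel_measurable lborel" "\<And>j. S (some_onb j) \<in> borel_measurable lborel"
    "\<And>j. AE \<xi> in lborel. T (some_onb j) \<xi> = S (some_onb j) \<xi>"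
    "\<And>j. T' (some_onb j) \<in> borel_measurable lborel" "\<And>j. S' (some_onb j) \<in> borel_measurable lborel"
    "\<And>j. AE \<xi> in lborel. T' (some_onb j) \<xi> = S' (some_onb j) \<xi>"
  shows "hs_inner T T' = hs_inner S S'"
  unfolding hs_inner_def using l2_inner_cong_AE[OF assms(1,2,4,5,3,6)] by simp

section \<open>The Fourier transform in the central and the first variable\<close>

lemma borel_measurable_fst [measurable]: "fst \<in> borel_measurable (borel :: ('a::topological_space \<times> 'b::topological_space) measure)"
  by (intro borel_measurable_continuous_onI continuous_intros)

lemma borel_measurable_snd [measurable]: "snd \<in> borel_measurable (borel :: ('a::topological_space \<times> 'b::topological_space) measure)"
  by (intro borel_measurable_continuous_onI continuous_intros)

text \<open>Reads its argument as (y, x, t): sections over the first component are functions of (x,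
  t), the variables that are transformed.\<close>

definition swap_x :: "'n::finite heis \<Rightarrow> 'n heis" where
  "swap_x q = (fst (snd q), fst q, snd (snd q))"

text \<open>Brings the last component to the front, so that sections at a fixed frequency \<omega>
  are sections over the first component of a product.\<close>

definition rotate_t :: "real \<times> (real^'n::finite) \<times> (real^'n) \<Rightarrow> 'n heis" where
  "rotate_t q = (fst (snd q), snd (snd q), fst q)"

lemma measurable_swap_x [measurable]: "swap_x \<in> borel_measurable borel"
  unfolding swap_x_def by (intro borel_measurable_continuous_onI continuous_intros)

lemma measurable_rotate_t [measurable]: "rotate_t \<in> borel_measurable borel"
  unfolding rotate_t_def by (intro borel_measurable_continuous_onI continuous_intros)

lemma nn_integral_heis:
  fixes f :: "'n::finite heis \<Rightarrow> ennreal"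
  assumes [measurable]: "f \<in> borel_measurable borel"
  shows "integral\<^sup>N lborel f = (\<integral>\<^sup>+x. \<integral>\<^sup>+y. \<integral>\<^sup>+t. f (x, y, t) \<partial>lborel \<partial>lborel \<partial>lborel)"
  by (simp add: nn_integral_lborel_pair(1))

lemma nn_integral_Fubini:
  fixes f :: "'a::euclidean_space \<Rightarrow> 'b::euclidean_space \<Rightarrow> ennreal"
  assumes "(\<lambda>z. f (fst z) (snd z)) \<in> borel_measurable borel"
  shows "(\<integral>\<^sup>+x. \<integral>\<^sup>+y. f x y \<partial>lborel \<partial>lborel) = (\<integral>\<^sup>+y. \<integral>\<^sup>+x. f x y \<partial>lborel \<partial>lborel)"
  using nn_integral_lborel_pair[OF assms] by simp

interpretation swap_x: scaled_measure_map "swap_x :: 'n::finite heis \<Rightarrow> 'n heis" 1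
proof
  fix f :: "'n heis \<Rightarrow> ennreal" assume [measurable]: "f \<in> borel_measurable borel"
  have "(\<integral>\<^sup>+q. f (swap_x q) \<partial>lborel) = (\<integral>\<^sup>+y. \<integral>\<^sup>+x. \<integral>\<^sup>+t. f (x, y, t) \<partial>lborel \<partial>lborel \<partial>lborel)"
    by (subst nn_integral_heis) (simp_all add: swap_x_def)
  also have "\<dots> = integral\<^sup>N lborel f"
    by (subst nn_integral_Fubini) (simp_all add: nn_integral_heis)
  finally show "integral\<^sup>N lborel f = ennreal 1 * (\<integral>\<^sup>+q. f (swap_x q) \<partial>lborel)" by simp
qed auto

interpretation rotate_t: scaled_measure_map "rotate_t :: real \<times> (real^'n::finite) \<times> (real^'n) \<Rightarrow> 'n heis" 1
proof
  fix f :: "'n heis \<Rightarrow> ennreal" assume [measurable]: "f \<in> borel_measurable borel"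
  have "(\<integral>\<^sup>+q. f (rotate_t q) \<partial>lborel) = (\<integral>\<^sup>+t. \<integral>\<^sup>+x. \<integral>\<^sup>+y. f (x, y, t) \<partial>lborel \<partial>lborel \<partial>lborel)"
    by (simp add: nn_integral_lborel_pair(1) rotate_t_def)
  also have "\<dots> = (\<integral>\<^sup>+x. \<integral>\<^sup>+t. \<integral>\<^sup>+y. f (x, y, t) \<partial>lborel \<partial>lborel \<partial>lborel)"
    by (rule nn_integral_Fubini) simp
  also have "\<dots> = (\<integral>\<^sup>+x. \<integral>\<^sup>+y. \<integral>\<^sup>+t. f (x, y, t) \<partial>lborel \<partial>lborel \<partial>lborel)"
    by (intro nn_integral_cong nn_integral_Fubini) simp
  also have "\<dots> = integral\<^sup>N lborel f" by (simp add: nn_integral_heis)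
  finally show "integral\<^sup>N lborel f = ennreal 1 * (\<integral>\<^sup>+q. f (rotate_t q) \<partial>lborel)" by simp
qed auto

text \<open>The argument is \<open>(u, y, \<omega>)\<close>; the variable \<open>y\<close> is not transformed.\<close>

definition pft :: "('n::finite heis \<Rightarrow> complex) \<Rightarrow> 'n heis \<Rightarrow> complex" where
  "pft h q = (LINT z|lborel. h (fst z, fst (snd q), snd z) * char_fun (fst q, snd (snd q)) z)"

lemma pft_ft: "pft h (u, y, \<omega>) = ft (\<lambda>z. h (swap_x (y, z))) (u, \<omega>)"
  by (simp add: pft_def ft_def swap_x_def)

lemma borel_measurable_pft [measurable]:
  assumes [measurable]: "h \<in> borel_measurable borel"
  shows "pft h \<in> borel_measurable borel"
  unfolding pft_def by measurable

lemma AE_section_integrable: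
  fixes K :: "'a::euclidean_space \<times> 'b::euclidean_space \<Rightarrow> complex"
  assumes K: "integrable lborel K"
  shows "AE \<xi> in lborel. integrable lborel (\<lambda>\<eta>. K (\<xi>, \<eta>))"
proof -
  have [measurable]: "K \<in> borel_measurable borel" using K by simp
  have "(\<integral>\<^sup>+\<xi>. \<integral>\<^sup>+\<eta>. ennreal (cmod (K (\<xi>, \<eta>))) \<partial>lborel \<partial>lborel) \<noteq> \<infinity>"
    using K nn_integral_lborel_pair(1)[of "\<lambda>z. ennreal (cmod (K z))"] by (simp add: integrable_iff_bounded)
  then have "AE \<xi> in lborel. (\<integral>\<^sup>+\<eta>. ennreal (cmod (K (\<xi>, \<eta>))) \<partial>lborel) \<noteq> \<infinity>"
    by (intro nn_integral_PInf_AE) measurable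
  then show ?thesis
    by eventually_elim (auto simp: integrable_iff_bounded top.not_eq_extremum)
qed

text \<open>Plancherel in (x, t) for almost every y, integrated over y.\<close>

lemma pft_Plancherel:
  fixes h :: "'n::finite heis \<Rightarrow> complex"
  assumes h: "h \<in> L2 lborel" "integrable lborel h"
  shows "pft h \<in> L2 lborel" "l2_norm lborel (pft h) = l2_norm lborel h"
proof -
  have hm[measurable]: "h \<in> borel_measurable borel" using h by simp
  let ?g = "\<lambda>q. h (swap_x q)"
  have g: "?g \<in> L2 lborel" "integrable lborel ?g"
    using h by (simp_all add: swap_x.L2_map_iff swap_x.integrable_map_iff)
  have "(\<integral>\<^sup>+q. ennreal ((cmod (pft h q))\<^sup>2) \<partial>lborel) = (\<integral>\<^sup>+q. ennreal ((cmod (pft h (swap_x q)))\<^sup>2) \<partial>lborel)"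
    using swap_x.nn[of "\<lambda>q. ennreal ((cmod (pft h q))\<^sup>2)"] by simp
  also have "\<dots> = (\<integral>\<^sup>+y. \<integral>\<^sup>+z. ennreal ((cmod (ft (\<lambda>z. ?g (y, z)) z))\<^sup>2) \<partial>lborel \<partial>lborel)"
    by (subst nn_integral_lborel_pair(1)) (simp_all add: swap_x_def[of "(_, _)"] pft_ft)
  also have "\<dots> = (\<integral>\<^sup>+y. \<integral>\<^sup>+z. ennreal ((cmod (?g (y, z)))\<^sup>2) \<partial>lborel \<partial>lborel)"
  proof (rule nn_integral_cong_AE)
    show "AE y in lborel. (\<integral>\<^sup>+z. ennreal ((cmod (ft (\<lambda>z. ?g (y, z)) z))\<^sup>2) \<partial>lborel) = (\<integral>\<^sup>+z. ennreal ((cmod (?g (y, z)))\<^sup>2) \<partial>lborel)"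
      using AE_section_L2[OF g(1)] AE_section_integrable[OF g(2)]
    proof eventually_elim
      case (elim y)
      then show ?case
        using Plancherel[OF elim] by (simp only: nn_integral_l2_norm)
    qed
  qed
  also have "\<dots> = (\<integral>\<^sup>+q. ennreal ((cmod (?g q))\<^sup>2) \<partial>lborel)"
    by (rule nn_integral_lborel_pair(1)[symmetric]) simp
  also have "\<dots> = (\<integral>\<^sup>+q. ennreal ((cmod (h q))\<^sup>2) \<partial>lborel)"
    using swap_x.nn[of "\<lambda>q. ennreal ((cmod (h q))\<^sup>2)"] by simp
  finally have *: "(\<integral>\<^sup>+q. ennreal ((cmod (pft h q))\<^sup>2) \<partial>lborel) = ennreal ((l2_norm lborel h)\<^sup>2)"
    by (simp only: nn_integral_l2_norm[OF h(1)])
  then show L: "pft h \<in> L2 lborel" unfolding L2_iff_nn_integral by simp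
  show "l2_norm lborel (pft h) = l2_norm lborel h"
    using * unfolding nn_integral_l2_norm[OF L] by simp
qed

lemma AE_swap_xI:
  fixes A B C :: "'n::finite heis \<Rightarrow> complex"
  assumes AE: "AE y in lborel. AE z in lborel. A (swap_x (y, z)) = B (swap_x (y, z)) + c * C (swap_x (y, z))"
    and [measurable]: "A \<in> borel_measurable borel" "B \<in> borel_measurable borel" "C \<in> borel_measurable borel"
  shows "AE q in lborel. A q = B q + c * C q"
proof -
  have "Measurable.pred borel (\<lambda>q. A (swap_x q) = B (swap_x q) + c * C (swap_x q))"
    by measurable
  then have "{q \<in> space (lborel \<Otimes>\<^sub>M lborel). A (swap_x q) = B (swap_x q) + c * C (swap_x q)} \<in> sets (lborel \<Otimes>\<^sub>M lborel)"
    unfolding lborel_prod by (simp add: pred_def)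
  from lborel_pair.AE_pair_measure[OF this AE]
  have "AE q in lborel. A (swap_x q) = B (swap_x q) + c * C (swap_x q)"
    unfolding lborel_prod .
  then show ?thesis by (subst (asm) swap_x.AE_map_iff) measurable
qed

text \<open>Almost everywhere, because the section at some exceptional y may fail to be integrable.
  The form h + c g serves polarization as well as differences.\<close>

lemma AE_pft_linear:
  fixes h g :: "'n::finite heis \<Rightarrow> complex"
  assumes h: "integrable lborel h" and g: "integrable lborel g"
  shows "AE q in lborel. pft (\<lambda>p. h p + c * g p) q = pft h q + c * pft g q"
proof -
  have [measurable]: "h \<in> borel_measurable borel" "g \<in> borel_measurable borel" using h g by auto
  have i: "integrable lborel (\<lambda>q. h (swap_x q))" "integrable lborel (\<lambda>q. g (swap_x q))"
    using h g by (simp_all add: swap_x.integrable_map_iff)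
  have "AE y in lborel. \<forall>z. pft (\<lambda>p. h p + c * g p) (swap_x (y, z)) = pft h (swap_x (y, z)) + c * pft g (swap_x (y, z))"
    using AE_section_integrable[OF i(1)] AE_section_integrable[OF i(2)]
  proof eventually_elim
    case (elim y)
    show ?case
    proof
      fix z :: "(real^'n) \<times> real"
      have "integrable lborel (\<lambda>w. h (swap_x (y, w)) * char_fun z w)" "integrable lborel (\<lambda>w. g (swap_x (y, w)) * char_fun z w)"
        using elim by (auto intro: integrable_mult_char_fun)
      then show "pft (\<lambda>p. h p + c * g p) (swap_x (y, z)) = pft h (swap_x (y, z)) + c * pft g (swap_x (y, z))"
        by (simp add: swap_x_def[of "(y, z)"] pft_ft ft_def ring_distribs mult.assoc)
    qed
  qed
  then have "AE y in lborel. AE z in lborel. pft (\<lambda>p. h p + c * g p) (swap_x (y, z)) = pft h (swap_x (y, z)) + c * pft g (swap_x (y, z))"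
    by eventually_elim auto
  moreover have "(\<lambda>p. h p + c * g p) \<in> borel_measurable borel" by measurable
  ultimately show ?thesis
    by (rule AE_swap_xI[OF _ borel_measurable_pft borel_measurable_pft borel_measurable_pft]) fact+
qed

text \<open>The extension of \<open>pft\<close> to L2 by density, as a relation. It quantifies over
  all approximating sequences, so that the particular sequence hidden in a given
  \<open>is_gft\<close> can be inserted.\<close>

definition pft_limit :: "('n::finite heis \<Rightarrow> complex) \<Rightarrow> ('n heis \<Rightarrow> complex) \<Rightarrow> bool" where
  "pft_limit f F \<longleftrightarrow> f \<in> L2 lborel \<and> F \<in> L2 lborel \<and>
     (\<forall>h :: nat \<Rightarrow> 'n heis \<Rightarrow> complex. (\<forall>j. h j \<in> L2 lborel \<and> integrable lborel (h j)) \<longrightarrow>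
        (\<lambda>j. l2_norm lborel (\<lambda>p. h j p - f p)) \<longlonglongrightarrow> 0 \<longrightarrow> (\<lambda>j. l2_norm lborel (\<lambda>q. pft (h j) q - F q)) \<longlonglongrightarrow> 0)"

lemma l2_norm_pft_diff:
  fixes h g :: "'n::finite heis \<Rightarrow> complex"
  assumes "h \<in> L2 lborel" "integrable lborel h" "g \<in> L2 lborel" "integrable lborel g"
  shows "l2_norm lborel (\<lambda>q. pft h q - pft g q) = l2_norm lborel (\<lambda>p. h p - g p)"
proof -
  have "l2_norm lborel (pft (\<lambda>p. h p + (-1) * g p)) = l2_norm lborel (\<lambda>q. pft h q + (-1) * pft g q)"
    using assms by (intro l2_norm_cong_AE AE_pft_linear) auto
  moreover have "l2_norm lborel (pft (\<lambda>p. h p + (-1) * g p)) = l2_norm lborel (\<lambda>p. h p + (-1) * g p)"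
    using assms by (intro pft_Plancherel) (auto intro: L2_diff)
  ultimately show ?thesis by simp
qed

lemma L1_L2_dense:
  fixes f :: "'a::euclidean_space \<Rightarrow> complex"
  assumes f: "f \<in> L2 lborel"
  obtains h :: "nat \<Rightarrow> 'a \<Rightarrow> complex" where "\<And>j. h j \<in> L2 lborel" "\<And>j. integrable lborel (h j)"
    "(\<lambda>j. l2_norm lborel (\<lambda>p. h j p - f p)) \<longlonglongrightarrow> 0"
proof -
  define A :: "nat \<Rightarrow> 'a set" where "A n = ball 0 (real n)" for n
  have A: "A n \<in> sets lborel" "incseq A" "(\<Union>n. A n) = UNIV" for n
    by (auto simp: A_def incseq_def intro: reals_Archimedean2)
  show ?thesis
  proof (rule that[of "\<lambda>n x. indicator (A n) x * f x"])
    show "(\<lambda>x. indicator (A n) x * f x) \<in> L2 lborel" for n by (rule l2_truncation(1)[OF f A])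
    show "(\<lambda>j. l2_norm lborel (\<lambda>p. indicator (A j) p * f p - f p)) \<longlonglongrightarrow> 0" by (rule l2_truncation(2)[OF f A])
    show "integrable lborel (\<lambda>x. indicator (A n) x * f x)" for n
    proof (rule L2_mult_integrable[OF _ f])
      have "(\<lambda>x. (cmod (indicator (A n) x))\<^sup>2) = (\<lambda>x. indicator (A n) x)" by (auto simp: indicator_def)
      then show "indicator (A n) \<in> L2 lborel"
        using A(1)[of n] unfolding L2_def A_def
        by (auto intro!: integrable_real_indicator emeasure_lborel_ball_finite borel_measurable_indicator)
    qed
  qed
qed

text \<open>One approximating sequence yields F by completeness. By the isometry, the transforms of
  any other approximating sequence come arbitrarily close to those of the first.\<close>

lemma pft_limit_exists:
  fixes f :: "'n::finite heis \<Rightarrow> complex"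
  assumes f: "f \<in> L2 lborel"
  shows "\<exists>F. pft_limit f F"
proof -
  obtain h where h: "\<And>j. h j \<in> L2 lborel" "\<And>j. integrable lborel (h j)" "(\<lambda>j. l2_norm lborel (\<lambda>p. h j p - f p)) \<longlonglongrightarrow> 0"
    using L1_L2_dense[OF f] by blast
  obtain F where F: "F \<in> L2 lborel" "(\<lambda>j. l2_norm lborel (\<lambda>q. pft (h j) q - F q)) \<longlonglongrightarrow> 0"
  proof (rule Riesz_Fischer[of "\<lambda>j. pft (h j)" lborel])
    show "pft (h j) \<in> L2 lborel" for j by (intro pft_Plancherel h)
    fix e :: real assume "0 < e"
    then have "\<forall>\<^sub>F j in sequentially. l2_norm lborel (\<lambda>p. h j p - f p) < e / 2"
      using h(3) by (intro order_tendstoD(2)) auto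
    then obtain N where N: "\<And>j. j \<ge> N \<Longrightarrow> l2_norm lborel (\<lambda>p. h j p - f p) < e / 2"
      by (auto simp: eventually_sequentially)
    have "l2_norm lborel (\<lambda>q. pft (h m) q - pft (h n) q) < e" if "m \<ge> N" "n \<ge> N" for m n
      using l2_norm_triangle_diff[OF h(1)[of m] f h(1)[of n]] N[OF that(1)] N[OF that(2)] l2_norm_minus_commute[of lborel f "h n"]
      by (simp add: l2_norm_pft_diff h)
    then show "\<exists>N. \<forall>m\<ge>N. \<forall>n\<ge>N. l2_norm lborel (\<lambda>q. pft (h m) q - pft (h n) q) < e" by blast
  qed (rule that)
  have "(\<lambda>j. l2_norm lborel (\<lambda>q. pft (k j) q - F q)) \<longlonglongrightarrow> 0"
    if k: "\<And>j. k j \<in> L2 lborel \<and> integrable lborel (k j)" "(\<lambda>j. l2_norm lborel (\<lambda>p. k j p - f p)) \<longlonglongrightarrow> 0"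
    for k :: "nat \<Rightarrow> 'n heis \<Rightarrow> complex"
  proof (rule Lim_null_comparison)
    show "(\<lambda>j. (l2_norm lborel (\<lambda>p. k j p - f p) + l2_norm lborel (\<lambda>p. h j p - f p)) + l2_norm lborel (\<lambda>q. pft (h j) q - F q)) \<longlonglongrightarrow> 0"
      using tendsto_add[OF tendsto_add[OF k(2) h(3)] F(2)] by simp
    have "l2_norm lborel (\<lambda>q. pft (k j) q - F q) \<le> (l2_norm lborel (\<lambda>p. k j p - f p) + l2_norm lborel (\<lambda>p. h j p - f p)) + l2_norm lborel (\<lambda>q. pft (h j) q - F q)" for j
    proof -
      have kj: "k j \<in> L2 lborel" "integrable lborel (k j)" using k(1) by auto
      have "l2_norm lborel (\<lambda>q. pft (k j) q - F q) \<le> l2_norm lborel (\<lambda>q. pft (k j) q - pft (h j) q) + l2_norm lborel (\<lambda>q. pft (h j) q - F q)"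
        by (intro l2_norm_triangle_diff pft_Plancherel kj h F)
      also have "l2_norm lborel (\<lambda>q. pft (k j) q - pft (h j) q) = l2_norm lborel (\<lambda>p. k j p - h j p)"
        by (intro l2_norm_pft_diff kj h)
      also have "\<dots> \<le> l2_norm lborel (\<lambda>p. k j p - f p) + l2_norm lborel (\<lambda>p. h j p - f p)"
        using l2_norm_triangle_diff[OF kj(1) f h(1)[of j]] l2_norm_minus_commute[of lborel f "h j"] by simp
      finally show ?thesis by simp
    qed
    then show "\<forall>\<^sub>F j in sequentially. norm (l2_norm lborel (\<lambda>q. pft (k j) q - F q)) \<le> (l2_norm lborel (\<lambda>p. k j p - f p) + l2_norm lborel (\<lambda>p. h j p - f p)) + l2_norm lborel (\<lambda>q. pft (h j) q - F q)"
      by (simp add: always_eventually)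
  qed
  with f F(1) show ?thesis unfolding pft_limit_def by blast
qed

lemma pft_limitD:
  assumes "pft_limit f F"
  shows "f \<in> L2 lborel" "F \<in> L2 lborel"
    "\<And>h :: nat \<Rightarrow> _. (\<And>j. h j \<in> L2 lborel) \<Longrightarrow> (\<And>j. integrable lborel (h j)) \<Longrightarrow> (\<lambda>j. l2_norm lborel (\<lambda>p. h j p - f p)) \<longlonglongrightarrow> 0
      \<Longrightarrow> (\<lambda>j. l2_norm lborel (\<lambda>q. pft (h j) q - F q)) \<longlonglongrightarrow> 0"
  using assms unfolding pft_limit_def by blast+

lemma pft_inner:
  fixes f g :: "'n::finite heis \<Rightarrow> complex"
  assumes "f \<in> L2 lborel" "integrable lborel f" "g \<in> L2 lborel" "integrable lborel g"
  shows "l2_inner lborel (pft f) (pft g) = l2_inner lborel f g"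
proof (rule l2_inner_eqI_norm)
  fix c
  have "l2_norm lborel (pft (\<lambda>p. f p + c * g p)) = l2_norm lborel (\<lambda>q. pft f q + c * pft g q)"
    using assms by (intro l2_norm_cong_AE AE_pft_linear) auto
  moreover have "l2_norm lborel (pft (\<lambda>p. f p + c * g p)) = l2_norm lborel (\<lambda>p. f p + c * g p)"
    using assms by (intro pft_Plancherel) (auto intro: L2_add L2_scale)
  ultimately show "l2_norm lborel (\<lambda>q. pft f q + c * pft g q) = l2_norm lborel (\<lambda>p. f p + c * g p)" by simp
qed (use assms pft_Plancherel in auto)

lemma pft_limit_inner:
  assumes F: "pft_limit f F" and H: "pft_limit g H"
  shows "l2_inner lborel f g = l2_inner lborel F H"
proof -
  obtain h where h: "\<And>j. h j \<in> L2 lborel" "\<And>j. integrable lborel (h j)" "(\<lambda>j. l2_norm lborel (\<lambda>p. h j p - f p)) \<longlonglongrightarrow> 0"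
    using L1_L2_dense[OF pft_limitD(1)[OF F]] by blast
  obtain k where k: "\<And>j. k j \<in> L2 lborel" "\<And>j. integrable lborel (k j)" "(\<lambda>j. l2_norm lborel (\<lambda>p. k j p - g p)) \<longlonglongrightarrow> 0"
    using L1_L2_dense[OF pft_limitD(1)[OF H]] by blast
  have "(\<lambda>j. l2_inner lborel (h j) (k j)) \<longlonglongrightarrow> l2_inner lborel f g"
    by (intro tendsto_l2_inner2 h k pft_limitD[OF F] pft_limitD[OF H])
  moreover have "(\<lambda>j. l2_inner lborel (pft (h j)) (pft (k j))) \<longlonglongrightarrow> l2_inner lborel F H"
    by (intro tendsto_l2_inner2 pft_limitD(3)[OF F h] pft_limitD(3)[OF H k] pft_Plancherel h k pft_limitD(2)[OF F] pft_limitD(2)[OF H])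
  ultimately show ?thesis
    by (simp add: pft_inner h k LIMSEQ_unique)
qed

definition central_translate :: "real \<Rightarrow> ('n::finite heis \<Rightarrow> complex) \<Rightarrow> 'n heis \<Rightarrow> complex" where
  "central_translate m f p = f (fst p, fst (snd p), snd (snd p) - m)"

lemma central_translate_eq: "central_translate m f p = f (p + (0, 0, - m))"
  by (cases p) (simp add: central_translate_def)

lemma L2_translate:
  fixes f :: "'a::euclidean_space \<Rightarrow> complex"
  assumes f: "f \<in> L2 lborel"
  shows "(\<lambda>x. f (x + t)) \<in> L2 lborel" "l2_norm lborel (\<lambda>x. f (x + t)) = l2_norm lborel f"
  using L2_lborel_affine[OF _ f, of 1 t] by (simp_all add: add.commute)

lemma central_translate_L2:
  assumes "f \<in> L2 lborel"
  shows "central_translate m f \<in> L2 lborel" "l2_norm lborel (central_translate m f) = l2_norm lborel f"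
  using L2_translate[OF assms, of "(0, 0, - m)"] by (simp_all add: central_translate_eq[abs_def])

lemma pft_central_translate:
  assumes [measurable]: "f \<in> borel_measurable borel"
  shows "pft (central_translate m f) (u, y, \<omega>) = char_fun \<omega> m * pft f (u, y, \<omega>)"
proof -
  have "pft f (u, y, \<omega>) = (LINT z|lborel. f (fst (z + (0, - m)), y, snd (z + (0, - m))) * char_fun (u, \<omega>) (z + (0, - m)))"
    unfolding pft_def by (subst integral_lborel_translate) auto
  also have "\<dots> = (LINT z|lborel. char_fun \<omega> (- m) * (central_translate m f (fst z, y, snd z) * char_fun (u, \<omega>) z))"
    unfolding char_fun_add
    by (intro Bochner_Integration.integral_cong refl) (simp add: central_translate_def char_fun_def)
  also have "\<dots> = char_fun \<omega> (- m) * pft (central_translate m f) (u, y, \<omega>)"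
    by (simp add: pft_def)
  finally have "pft f (u, y, \<omega>) = char_fun \<omega> (- m) * pft (central_translate m f) (u, y, \<omega>)" .
  moreover have "char_fun \<omega> m * char_fun \<omega> (- m) = 1"
    using char_fun_add(1)[of \<omega> m "- m"] by (simp add: char_fun_simps)
  ultimately show ?thesis by (simp add: mult.assoc[symmetric])
qed

text \<open>An approximating sequence for the translate is translated back to one for f; on the
  transform side this is multiplication by a function of modulus 1, which leaves norms
  alone.\<close>

lemma pft_limit_central_translate:
  assumes F: "pft_limit f F"
  shows "pft_limit (central_translate m f) (\<lambda>q. char_fun (snd (snd q)) m * F q)"
proof -
  note FD = pft_limitD[OF F]
  have Fm[measurable]: "F \<in> borel_measurable borel" using FD(2)[THEN L2_measurable] by simp
  have inv: "central_translate (- m) (central_translate m g) = g" "central_translate m (central_translate (- m) g) = g" for g :: "'a heis \<Rightarrow> complex"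
    by (auto simp: central_translate_def)
  show ?thesis
    unfolding pft_limit_def
  proof (intro conjI allI impI)
    show "central_translate m f \<in> L2 lborel" by (intro central_translate_L2 FD)
    show "(\<lambda>q. char_fun (snd (snd q)) m * F q) \<in> L2 lborel"
      by (rule L2_bounded_mult[OF FD(2), of _ 1]) (auto simp: char_fun_simps)
    fix h :: "nat \<Rightarrow> 'a heis \<Rightarrow> complex"
    assume h: "\<forall>j. h j \<in> L2 lborel \<and> integrable lborel (h j)"
      and lim: "(\<lambda>j. l2_norm lborel (\<lambda>p. h j p - central_translate m f p)) \<longlonglongrightarrow> 0"
    let ?k = "\<lambda>j. central_translate (- m) (h j)"
    have k: "?k j \<in> L2 lborel" "integrable lborel (?k j)" for j
      using h integrable_lborel_affine[of 1 "h j" "(0, 0, m)"] central_translate_L2(1)[of "h j" "- m"]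
      by (simp_all add: central_translate_eq[abs_def] add.commute)
    have "l2_norm lborel (\<lambda>p. ?k j p - f p) = l2_norm lborel (\<lambda>p. h j p - central_translate m f p)" for j
    proof -
      have "(\<lambda>p. ?k j p - f p) = central_translate (- m) (\<lambda>p. h j p - central_translate m f p)"
        using fun_cong[OF inv(1)[of f]] by (auto simp: central_translate_def)
      moreover have "(\<lambda>p. h j p - central_translate m f p) \<in> L2 lborel"
        using h by (intro L2_diff central_translate_L2 FD) auto
      ultimately show ?thesis by (simp add: central_translate_L2)
    qed
    then have "(\<lambda>j. l2_norm lborel (\<lambda>p. ?k j p - f p)) \<longlonglongrightarrow> 0" using lim by simp
    note kl = FD(3)[OF k this]
    have "l2_norm lborel (\<lambda>q. pft (h j) q - char_fun (snd (snd q)) m * F q) = l2_norm lborel (\<lambda>q. pft (?k j) q - F q)" for j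
    proof -
      have [measurable]: "?k j \<in> borel_measurable borel" using k(1)[of j, THEN L2_measurable] by simp
      have "pft (h j) q - char_fun (snd (snd q)) m * F q = char_fun (snd (snd q)) m * (pft (?k j) q - F q)" for q
        using pft_central_translate[of "?k j" m "fst q" "fst (snd q)" "snd (snd q)"] by (simp add: inv ring_distribs)
      then show ?thesis
        by (simp add: l2_norm_def norm_mult char_fun_simps)
    qed
    with kl show "(\<lambda>j. l2_norm lborel (\<lambda>q. pft (h j) q - char_fun (snd (snd q)) m * F q)) \<longlonglongrightarrow> 0" by simp
  qed
qed

section \<open>The operator-valued Fourier transform\<close>

definition section_t :: "('n::finite heis \<Rightarrow> complex) \<Rightarrow> real \<Rightarrow> (real^'n) \<times> (real^'n) \<Rightarrow> complex" where
  "section_t F \<omega> z = F (fst z, snd z, \<omega>)"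

text \<open>The first component is the frequency \<omega> (\<xi> + y/2) that the representation
  pairs with x, rewritten for y = \<eta> - \<xi>.\<close>

definition kernel_map :: "real \<Rightarrow> (real^'n::finite) \<times> (real^'n) \<Rightarrow> (real^'n) \<times> (real^'n)" where
  "kernel_map \<omega> z = ((\<omega> / 2) *\<^sub>R (fst z + snd z), snd z - fst z)"

text \<open>The kernel is found by substituting \<open>\<eta> = \<xi> + y\<close> in the operator-valued integral.\<close>

definition gft_kernel :: "('n::finite heis \<Rightarrow> complex) \<Rightarrow> real \<Rightarrow> (real^'n) \<times> (real^'n) \<Rightarrow> complex" where
  "gft_kernel F \<omega> z = section_t F \<omega> (kernel_map \<omega> z)"

lemma measurable_kernel_map [measurable]: "kernel_map \<omega> \<in> borel_measurable borel"
  unfolding kernel_map_def by (intro borel_measurable_continuous_onI continuous_intros)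

lemma measurable_section_t [measurable]:
  assumes [measurable]: "F \<in> borel_measurable borel"
  shows "section_t F \<omega> \<in> borel_measurable borel"
  unfolding section_t_def by measurable

text \<open>The Jacobian is the Plancherel weight, so weighted kernel norms become norms of sections
  of the partial transform. The substitution is u = (\<omega>/2) y + \<omega> \<xi> for fixed y,
  followed by y = \<eta> - \<xi> for fixed \<xi>.\<close>

lemma scaled_measure_kernel_map:
  assumes "\<omega> \<noteq> 0"
  shows "scaled_measure_map (kernel_map \<omega> :: (real^'n::finite) \<times> (real^'n) \<Rightarrow> _) (\<bar>\<omega>\<bar> ^ CARD('n))"
proof
  fix f :: "(real^'n) \<times> (real^'n) \<Rightarrow> ennreal" assume [measurable]: "f \<in> borel_measurable borel"
  let ?c = "ennreal (\<bar>\<omega>\<bar> ^ CARD('n))"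
  have "integral\<^sup>N lborel f = (\<integral>\<^sup>+y. \<integral>\<^sup>+u. f (u, y) \<partial>lborel \<partial>lborel)"
    by (rule nn_integral_lborel_pair) simp
  also have "\<dots> = (\<integral>\<^sup>+y. ?c * (\<integral>\<^sup>+\<xi>. f ((\<omega> / 2) *\<^sub>R y + \<omega> *\<^sub>R \<xi>, y) \<partial>lborel) \<partial>lborel)"
  proof (intro nn_integral_cong)
    fix y :: "real^'n"
    show "(\<integral>\<^sup>+u. f (u, y) \<partial>lborel) = ?c * (\<integral>\<^sup>+\<xi>. f ((\<omega> / 2) *\<^sub>R y + \<omega> *\<^sub>R \<xi>, y) \<partial>lborel)"
      using nn_integral_lborel_affine[OF assms, of "\<lambda>u. f (u, y)" "(\<omega> / 2) *\<^sub>R y"] by simp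
  qed
  also have "\<dots> = ?c * (\<integral>\<^sup>+y. \<integral>\<^sup>+\<xi>. f ((\<omega> / 2) *\<^sub>R y + \<omega> *\<^sub>R \<xi>, y) \<partial>lborel \<partial>lborel)"
    by (rule nn_integral_cmult) measurable
  also have "(\<integral>\<^sup>+y. \<integral>\<^sup>+\<xi>. f ((\<omega> / 2) *\<^sub>R y + \<omega> *\<^sub>R \<xi>, y) \<partial>lborel \<partial>lborel) = (\<integral>\<^sup>+\<xi>. \<integral>\<^sup>+y. f ((\<omega> / 2) *\<^sub>R y + \<omega> *\<^sub>R \<xi>, y) \<partial>lborel \<partial>lborel)"
    by (rule nn_integral_Fubini) measurable
  also have "\<dots> = (\<integral>\<^sup>+\<xi>. \<integral>\<^sup>+\<eta>. f (kernel_map \<omega> (\<xi>, \<eta>)) \<partial>lborel \<partial>lborel)"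
  proof (rule nn_integral_cong)
    fix \<xi> :: "real^'n"
    have "(\<integral>\<^sup>+y. f ((\<omega> / 2) *\<^sub>R y + \<omega> *\<^sub>R \<xi>, y) \<partial>lborel) = (\<integral>\<^sup>+\<eta>. f ((\<omega> / 2) *\<^sub>R (\<eta> + - \<xi>) + \<omega> *\<^sub>R \<xi>, \<eta> + - \<xi>) \<partial>lborel)"
      by (rule nn_integral_lborel_translate[symmetric]) measurable
    also have "\<dots> = (\<integral>\<^sup>+\<eta>. f (kernel_map \<omega> (\<xi>, \<eta>)) \<partial>lborel)"
    proof (intro nn_integral_cong arg_cong[where f=f])
      fix \<eta> :: "real^'n"
      have "(\<omega> / 2) *\<^sub>R (\<eta> + - \<xi>) + \<omega> *\<^sub>R \<xi> = (\<omega> / 2) *\<^sub>R (\<xi> + \<eta>)"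
        by (simp add: vec_eq_iff field_simps)
      then show "((\<omega> / 2) *\<^sub>R (\<eta> + - \<xi>) + \<omega> *\<^sub>R \<xi>, \<eta> + - \<xi>) = kernel_map \<omega> (\<xi>, \<eta>)"
        by (simp add: kernel_map_def)
    qed
    finally show "(\<integral>\<^sup>+y. f ((\<omega> / 2) *\<^sub>R y + \<omega> *\<^sub>R \<xi>, y) \<partial>lborel) = (\<integral>\<^sup>+\<eta>. f (kernel_map \<omega> (\<xi>, \<eta>)) \<partial>lborel)" .
  qed
  also have "\<dots> = (\<integral>\<^sup>+z. f (kernel_map \<omega> z) \<partial>lborel)"
    by (rule nn_integral_lborel_pair(1)[symmetric]) measurable
  finally show "integral\<^sup>N lborel f = ?c * (\<integral>\<^sup>+z. f (kernel_map \<omega> z) \<partial>lborel)" .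
qed (use assms in auto)

lemma AE_section_t_L2:
  fixes F :: "'n::finite heis \<Rightarrow> complex"
  assumes F: "F \<in> L2 lborel"
  shows "AE \<omega> in lborel. section_t F \<omega> \<in> L2 lborel"
proof -
  have [measurable]: "F \<in> borel_measurable borel" using L2_measurable[OF F] by simp
  have "(\<lambda>q. F (rotate_t q)) \<in> L2 lborel" using F by (simp add: rotate_t.L2_map_iff)
  from AE_section_L2[OF this] show ?thesis
    by (simp add: rotate_t_def section_t_def[abs_def])
qed

lemma nn_integral_section_t:
  fixes F :: "'n::finite heis \<Rightarrow> complex"
  assumes F: "F \<in> L2 lborel"
  shows "(\<integral>\<^sup>+\<omega>. ennreal ((l2_norm lborel (section_t F \<omega>))\<^sup>2) \<partial>lborel) = ennreal ((l2_norm lborel F)\<^sup>2)"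
proof -
  have [measurable]: "F \<in> borel_measurable borel" using L2_measurable[OF F] by simp
  have "(\<lambda>q. F (rotate_t q)) \<in> L2 lborel" using F by (simp add: rotate_t.L2_map_iff)
  from nn_integral_section_norm[OF this] show ?thesis
    using rotate_t.l2_norm_map[of F] by (simp add: rotate_t_def section_t_def[abs_def])
qed

lemma gft_kernel_L2:
  assumes "F \<in> borel_measurable borel" "\<omega> \<noteq> 0"
  shows "gft_kernel F \<omega> \<in> L2 lborel \<longleftrightarrow> section_t F \<omega> \<in> L2 lborel"
  unfolding gft_kernel_def[abs_def]
  by (rule scaled_measure_map.L2_map_iff[OF scaled_measure_kernel_map[OF assms(2)] measurable_section_t[OF assms(1)]])

lemma gft_kernel_norm:
  fixes F :: "'n::finite heis \<Rightarrow> complex"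
  assumes "F \<in> borel_measurable borel" "\<omega> \<noteq> 0"
  shows "(l2_norm lborel (section_t F \<omega>))\<^sup>2 = \<bar>\<omega>\<bar> ^ CARD('n) * (l2_norm lborel (gft_kernel F \<omega>))\<^sup>2"
  unfolding gft_kernel_def[abs_def]
  by (rule scaled_measure_map.l2_norm_map[OF scaled_measure_kernel_map[OF assms(2)] measurable_section_t[OF assms(1)]])

lemma gft_kernel_inner:
  fixes F H :: "'n::finite heis \<Rightarrow> complex"
  assumes "F \<in> borel_measurable borel" "H \<in> borel_measurable borel" "\<omega> \<noteq> 0"
  shows "l2_inner lborel (section_t F \<omega>) (section_t H \<omega>) = of_real (\<bar>\<omega>\<bar> ^ CARD('n)) * l2_inner lborel (gft_kernel F \<omega>) (gft_kernel H \<omega>)"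
  unfolding gft_kernel_def[abs_def]
  by (rule scaled_measure_map.l2_inner_map[OF scaled_measure_kernel_map[OF assms(3)] measurable_section_t[OF assms(1)] measurable_section_t[OF assms(2)]])

lemma schroedinger_rep_char_fun:
  "schroedinger_rep \<omega> (x, y, t) a \<xi> = char_fun (\<omega> *\<^sub>R (\<xi> + (1/2) *\<^sub>R y), \<omega>) (x, t) * a (\<xi> + y)"
proof -
  have "exp (2 * of_real pi * \<i> * of_real r) = cis (2 * pi * r)" for r
    by (simp add: cis_conv_exp mult_ac)
  then have "schroedinger_rep \<omega> (x, y, t) a \<xi> = cis (2 * pi * (\<omega> * t)) * cis (2 * pi * (\<omega> * (x \<bullet> \<xi> + 1 / 2 * (x \<bullet> y)))) * a (\<xi> + y)"
    by (simp only: schroedinger_rep.simps)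
  also have "\<dots> = char_fun (\<omega> *\<^sub>R (\<xi> + (1/2) *\<^sub>R y), \<omega>) (x, t) * a (\<xi> + y)"
    unfolding cis_mult char_fun_def by (simp add: inner_add_left inner_commute[of x] algebra_simps)
  finally show ?thesis .
qed

lemma schroedinger_rep_eq:
  "schroedinger_rep \<omega> p a \<xi> = char_fun (\<omega> *\<^sub>R (\<xi> + (1/2) *\<^sub>R fst (snd p)), \<omega>) (fst p, snd (snd p)) * a (\<xi> + fst (snd p))"
  by (cases p) (simp only: schroedinger_rep_char_fun fst_conv snd_conv)

lemma measurable_gft_L1 [measurable]:
  assumes [measurable]: "h \<in> borel_measurable borel" "a \<in> borel_measurable borel" "w \<in> borel_measurable M" "x \<in> borel_measurable M"
  shows "(\<lambda>z. gft_L1 h (w z) a (x z)) \<in> borel_measurable M"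
  unfolding gft_L1_def schroedinger_rep_eq by measurable

lemma measurable_kernel_op_gft [measurable]:
  assumes [measurable]: "F \<in> borel_measurable borel" "a \<in> borel_measurable borel" "w \<in> borel_measurable M" "x \<in> borel_measurable M"
  shows "(\<lambda>z. kernel_op (gft_kernel F (w z)) a (x z)) \<in> borel_measurable M"
  unfolding kernel_op_def gft_kernel_def section_t_def kernel_map_def by measurable

text \<open>Tonelli in (\<xi>, p), with \<xi> restricted to a ball. The integral over the ball of
  the translated modulus of a is bounded by a constant independent of the translation, and h is
  integrable.\<close>

lemma AE_schroedinger_integrable:
  fixes h :: "'n::finite heis \<Rightarrow> complex"
  assumes h: "integrable lborel h" and a: "a \<in> L2 lborel"
  shows "AE \<xi> in lborel. integrable lborel (\<lambda>p. h p * schroedinger_rep \<omega> p a \<xi>)"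
proof -
  have [measurable]: "h \<in> borel_measurable borel" "a \<in> borel_measurable borel" using h a L2_lborel_measurable by auto
  \<comment> \<open>a is square integrable but perhaps not integrable over the whole space, hence
    the localization to balls of integer radius.\<close>
  have "AE \<xi> in lborel. indicator (ball 0 (real N)) \<xi> * (\<integral>\<^sup>+p. ennreal (cmod (h p)) * ennreal (cmod (a (\<xi> + fst (snd p)))) \<partial>lborel) \<noteq> \<infinity>" for N
  proof (rule nn_integral_PInf_AE)
    let ?B = "ball 0 (real N) :: (real^'n) set"
    have [measurable]: "?B \<in> sets borel" by simp
    let ?C = "emeasure lborel ?B + ennreal ((l2_norm lborel a)\<^sup>2)"
    have "(\<integral>\<^sup>+\<xi>. indicator ?B \<xi> * (\<integral>\<^sup>+p. ennreal (cmod (h p)) * ennreal (cmod (a (\<xi> + fst (snd p)))) \<partial>lborel) \<partial>lborel)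
      = (\<integral>\<^sup>+\<xi>. \<integral>\<^sup>+p. indicator ?B \<xi> * (ennreal (cmod (h p)) * ennreal (cmod (a (\<xi> + fst (snd p))))) \<partial>lborel \<partial>lborel)"
      by (intro nn_integral_cong nn_integral_cmult[symmetric]) measurable
    also have "\<dots> = (\<integral>\<^sup>+p. \<integral>\<^sup>+\<xi>. indicator ?B \<xi> * (ennreal (cmod (h p)) * ennreal (cmod (a (\<xi> + fst (snd p))))) \<partial>lborel \<partial>lborel)"
      by (rule nn_integral_Fubini) measurable
    also have "\<dots> \<le> (\<integral>\<^sup>+p. ennreal (cmod (h p)) * ?C \<partial>lborel)"
    proof (intro nn_integral_mono)
      fix p :: "'n heis"
      have "(\<integral>\<^sup>+\<xi>. indicator ?B \<xi> * (ennreal (cmod (h p)) * ennreal (cmod (a (\<xi> + fst (snd p))))) \<partial>lborel)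
        = (\<integral>\<^sup>+\<xi>. ennreal (cmod (h p)) * (indicator ?B \<xi> * ennreal (cmod (a (\<xi> + fst (snd p))))) \<partial>lborel)"
        by (simp add: mult_ac)
      also have "\<dots> = ennreal (cmod (h p)) * (\<integral>\<^sup>+\<xi>. indicator ?B \<xi> * ennreal (cmod (a (\<xi> + fst (snd p)))) \<partial>lborel)"
        by (rule nn_integral_cmult) measurable
      also have "(\<integral>\<^sup>+\<xi>. indicator ?B \<xi> * ennreal (cmod (a (\<xi> + fst (snd p)))) \<partial>lborel) \<le> (\<integral>\<^sup>+\<xi>. indicator ?B \<xi> + ennreal ((cmod (a (\<xi> + fst (snd p))))\<^sup>2) \<partial>lborel)"
      proof (intro nn_integral_mono)
        fix \<xi>
        \<comment> \<open>On a ball this bounds the integral of |a| by the volume plus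
          ||a||^2.\<close>
        have "t \<le> 1 + t\<^sup>2" if "0 \<le> t" for t :: real
          using that zero_le_power2[of "t - 1"] unfolding power2_diff by simp
        then have "ennreal (cmod (a (\<xi> + fst (snd p)))) \<le> ennreal (1 + (cmod (a (\<xi> + fst (snd p))))\<^sup>2)"
          by (intro ennreal_leI) simp
        also have "\<dots> = 1 + ennreal ((cmod (a (\<xi> + fst (snd p))))\<^sup>2)" by simp
        finally show "indicator ?B \<xi> * ennreal (cmod (a (\<xi> + fst (snd p)))) \<le> indicator ?B \<xi> + ennreal ((cmod (a (\<xi> + fst (snd p))))\<^sup>2)"
          by (simp split: split_indicator)
      qed
      also have "\<dots> = emeasure lborel ?B + (\<integral>\<^sup>+\<xi>. ennreal ((cmod (a (\<xi> + fst (snd p))))\<^sup>2) \<partial>lborel)"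
        by (subst nn_integral_add) auto
      also have "(\<integral>\<^sup>+\<xi>. ennreal ((cmod (a (\<xi> + fst (snd p))))\<^sup>2) \<partial>lborel) = ennreal ((l2_norm lborel a)\<^sup>2)"
        using nn_integral_lborel_translate[of "\<lambda>\<xi>. ennreal ((cmod (a \<xi>))\<^sup>2)" "fst (snd p)"] by (simp only: nn_integral_l2_norm[OF a]) simp
      finally show "(\<integral>\<^sup>+\<xi>. indicator ?B \<xi> * (ennreal (cmod (h p)) * ennreal (cmod (a (\<xi> + fst (snd p))))) \<partial>lborel) \<le> ennreal (cmod (h p)) * ?C"
        by (simp add: mult_left_mono)
    qed
    also have "\<dots> = (\<integral>\<^sup>+p. ennreal (cmod (h p)) \<partial>lborel) * ?C"
      by (rule nn_integral_multc) simp
    also have "\<dots> < \<infinity>"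
      using h emeasure_lborel_ball_finite[of 0 "real N"] by (auto simp: integrable_iff_bounded ennreal_mult_less_top)
    finally show "(\<integral>\<^sup>+\<xi>. indicator ?B \<xi> * (\<integral>\<^sup>+p. ennreal (cmod (h p)) * ennreal (cmod (a (\<xi> + fst (snd p)))) \<partial>lborel) \<partial>lborel) \<noteq> \<infinity>"
      by simp
    show "(\<lambda>\<xi>. indicator ?B \<xi> * (\<integral>\<^sup>+p. ennreal (cmod (h p)) * ennreal (cmod (a (\<xi> + fst (snd p)))) \<partial>lborel)) \<in> borel_measurable lborel"
      by measurable
  qed
  then have "AE \<xi> in lborel. \<forall>N. indicator (ball 0 (real N)) \<xi> * (\<integral>\<^sup>+p. ennreal (cmod (h p)) * ennreal (cmod (a (\<xi> + fst (snd p)))) \<partial>lborel) \<noteq> \<infinity>"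
    by (simp add: AE_all_countable)
  then show ?thesis
  proof eventually_elim
    case (elim \<xi>)
    obtain N :: nat where "norm \<xi> < real N" using reals_Archimedean2 by blast
    then have fin: "(\<integral>\<^sup>+p. ennreal (cmod (h p)) * ennreal (cmod (a (\<xi> + fst (snd p)))) \<partial>lborel) \<noteq> \<infinity>"
      using elim[rule_format, of N] by simp
    have "ennreal (norm (h p * schroedinger_rep \<omega> p a \<xi>)) = ennreal (cmod (h p)) * ennreal (cmod (a (\<xi> + fst (snd p))))" for p
      by (simp add: schroedinger_rep_eq norm_mult char_fun_simps ennreal_mult)
    then show ?case
      using fin unfolding integrable_iff_bounded by (simp add: schroedinger_rep_eq top.not_eq_extremum)
  qed
qed

text \<open>Fubini with y outermost: the inner integral over (x, t) is the partial transform at the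
  frequency that the representation assigns to \<xi> and y.\<close>

lemma AE_gft_L1_kernel:
  fixes h :: "'n::finite heis \<Rightarrow> complex"
  assumes h: "integrable lborel h" and a: "a \<in> L2 lborel"
  shows "AE \<xi> in lborel. gft_L1 h \<omega> a \<xi> = kernel_op (gft_kernel (pft h) \<omega>) a \<xi>"
  using AE_schroedinger_integrable[OF h a, of \<omega>]
proof eventually_elim
  case (elim \<xi>)
  have [measurable]: "h \<in> borel_measurable borel" "a \<in> borel_measurable borel" using h a L2_lborel_measurable by auto
  let ?g = "\<lambda>p. h p * schroedinger_rep \<omega> p a \<xi>"
  have gm: "?g \<in> borel_measurable borel" using elim by auto
  have int: "integrable (lborel \<Otimes>\<^sub>M lborel) (\<lambda>q. ?g (swap_x q))"
    using elim swap_x.integrable_map_iff[OF gm] by (simp add: lborel_prod)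
  have "gft_L1 h \<omega> a \<xi> = (LINT q|lborel. ?g (swap_x q))"
    using swap_x.integral_map[OF gm] by (simp add: gft_L1_def)
  also have "\<dots> = (LINT y|lborel. LINT z|lborel. ?g (swap_x (y, z)))"
    using lborel_pair.integral_fst'[OF int] by (simp add: lborel_prod)
  also have "\<dots> = (LINT y|lborel. pft h (\<omega> *\<^sub>R (\<xi> + (1/2) *\<^sub>R y), y, \<omega>) * a (\<xi> + y))"
    by (simp add: schroedinger_rep_eq swap_x_def pft_def mult.assoc[symmetric])
  also have "\<dots> = (LINT \<eta>|lborel. pft h (\<omega> *\<^sub>R (\<xi> + (1/2) *\<^sub>R (\<eta> + - \<xi>)), \<eta> + - \<xi>, \<omega>) * a (\<xi> + (\<eta> + - \<xi>)))"
    by (rule integral_lborel_translate[symmetric]) measurable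
  also have "\<dots> = kernel_op (gft_kernel (pft h) \<omega>) a \<xi>"
    unfolding kernel_op_def gft_kernel_def section_t_def kernel_map_def
  proof (intro Bochner_Integration.integral_cong refl)
    fix \<eta> :: "real^'n"
    have "\<omega> *\<^sub>R (\<xi> + (1/2) *\<^sub>R (\<eta> + - \<xi>)) = (\<omega> / 2) *\<^sub>R (\<xi> + \<eta>)"
      by (simp add: vec_eq_iff field_simps)
    then show "pft h (\<omega> *\<^sub>R (\<xi> + (1/2) *\<^sub>R (\<eta> + - \<xi>)), \<eta> + - \<xi>, \<omega>) * a (\<xi> + (\<eta> + - \<xi>)) =
      pft h (fst ((\<omega> / 2) *\<^sub>R (fst (\<xi>, \<eta>) + snd (\<xi>, \<eta>)), snd (\<xi>, \<eta>) - fst (\<xi>, \<eta>)), snd ((\<omega> / 2) *\<^sub>R (fst (\<xi>, \<eta>) + snd (\<xi>, \<eta>)), snd (\<xi>, \<eta>) - fst (\<xi>, \<eta>)), \<omega>) * a \<eta>"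
      by simp
  qed
  finally show ?case .
qed

section \<open>Existence and uniqueness of the extended operator-valued transform\<close>

lemma AE_nonzero: "AE \<omega> in lborel. (\<omega> :: real) \<noteq> 0"
  by (rule AE_lborel_singleton)

text \<open>Translates the convergence demanded by \<open>is_gft\<close> into L2 convergence of
  partial transforms. For each \<omega> the weight turns the kernel norm into the norm of a section;
  integration over \<omega> assembles the sections.\<close>

lemma gft_L1_diff_norm:
  fixes h F :: "'n::finite heis \<Rightarrow> complex"
  assumes h: "h \<in> L2 lborel" "integrable lborel h" and F: "F \<in> L2 lborel"
  shows "(\<integral>\<^sup>+\<omega>. hs_norm_sq (\<lambda>a \<xi>. gft_L1 h \<omega> a \<xi> - kernel_op (gft_kernel F \<omega>) a \<xi>) * ennreal (\<bar>\<omega>\<bar> ^ CARD('n)) \<partial>lborel)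
    = ennreal ((l2_norm lborel (\<lambda>q. pft h q - F q))\<^sup>2)"
proof -
  let ?D = "\<lambda>q. pft h q - F q"
  have D: "?D \<in> L2 lborel" by (intro L2_diff pft_Plancherel h F)
  have [measurable]: "h \<in> borel_measurable borel" "F \<in> borel_measurable borel" using h F L2_lborel_measurable by auto
  have [measurable]: "some_onb j \<in> borel_measurable borel" for j by (rule L2_lborel_measurable[OF some_onb_L2])
  have "(\<integral>\<^sup>+\<omega>. hs_norm_sq (\<lambda>a \<xi>. gft_L1 h \<omega> a \<xi> - kernel_op (gft_kernel F \<omega>) a \<xi>) * ennreal (\<bar>\<omega>\<bar> ^ CARD('n)) \<partial>lborel)
    = (\<integral>\<^sup>+\<omega>. ennreal ((l2_norm lborel (section_t ?D \<omega>))\<^sup>2) \<partial>lborel)"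
  proof (rule nn_integral_cong_AE)
    show "AE \<omega> in lborel. hs_norm_sq (\<lambda>a \<xi>. gft_L1 h \<omega> a \<xi> - kernel_op (gft_kernel F \<omega>) a \<xi>) * ennreal (\<bar>\<omega>\<bar> ^ CARD('n))
        = ennreal ((l2_norm lborel (section_t ?D \<omega>))\<^sup>2)"
      using AE_nonzero AE_section_t_L2[OF pft_Plancherel(1)[OF h]] AE_section_t_L2[OF F] AE_section_t_L2[OF D]
    proof eventually_elim
      case (elim \<omega>)
      have k: "gft_kernel (pft h) \<omega> \<in> L2 lborel" "gft_kernel F \<omega> \<in> L2 lborel" "gft_kernel ?D \<omega> \<in> L2 lborel"
        using elim by (simp_all add: gft_kernel_L2)
      have "hs_norm_sq (\<lambda>a \<xi>. gft_L1 h \<omega> a \<xi> - kernel_op (gft_kernel F \<omega>) a \<xi>) = hs_norm_sq (kernel_op (gft_kernel ?D \<omega>))"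
      proof (rule hs_norm_sq_cong_AE)
        fix j :: nat
        show "AE \<xi> in lborel. gft_L1 h \<omega> (some_onb j) \<xi> - kernel_op (gft_kernel F \<omega>) (some_onb j) \<xi> = kernel_op (gft_kernel ?D \<omega>) (some_onb j) \<xi>"
          using AE_gft_L1_kernel[OF h(2) some_onb_L2, of \<omega> j] AE_kernel_op_add[OF k(1,2) some_onb_L2, of "-1" j]
        proof eventually_elim
          case (elim \<xi>)
          have "gft_kernel ?D \<omega> = (\<lambda>z. gft_kernel (pft h) \<omega> z + (-1) * gft_kernel F \<omega> z)"
            by (auto simp: gft_kernel_def section_t_def)
          with elim show ?case by simp
        qed
      qed auto
      also have "\<dots> = ennreal ((l2_norm lborel (gft_kernel ?D \<omega>))\<^sup>2)" by (rule hs_norm_sq_kernel[OF k(3)])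
      finally show ?case
        using elim by (simp add: gft_kernel_norm mult.commute flip: ennreal_mult)
    qed
  qed
  then show ?thesis by (simp only: nn_integral_section_t[OF D])
qed

text \<open>Supplies the witness that makes the choice in \<open>gft\<close> satisfy its
  specification.\<close>

lemma is_gft_kernel:
  fixes f F :: "'n::finite heis \<Rightarrow> complex"
  assumes F: "pft_limit f F"
  shows "is_gft f (\<lambda>\<omega>. kernel_op (gft_kernel F \<omega>))"
  unfolding is_gft_def
proof (intro conjI ballI)
  note FD = pft_limitD[OF F]
  have [measurable]: "F \<in> borel_measurable borel" using FD(2) L2_lborel_measurable by auto
  show "AE \<omega> in lborel. hilbert_schmidt (kernel_op (gft_kernel F \<omega>))"
    using AE_nonzero AE_section_t_L2[OF FD(2)] by eventually_elim (simp add: hilbert_schmidt_kernel gft_kernel_L2)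
  show "(\<lambda>\<omega>. l2_inner lborel (kernel_op (gft_kernel F \<omega>) a) b) \<in> borel_measurable lborel"
    if "a \<in> L2 lborel" "b \<in> L2 lborel" for a b
  proof -
    have [measurable]: "a \<in> borel_measurable borel" "b \<in> borel_measurable borel" using that L2_lborel_measurable by auto
    show ?thesis unfolding l2_inner_def by measurable
  qed
  obtain h where h: "\<And>j. h j \<in> L2 lborel" "\<And>j. integrable lborel (h j)" "(\<lambda>j. l2_norm lborel (\<lambda>p. h j p - f p)) \<longlonglongrightarrow> 0"
    using L1_L2_dense[OF FD(1)] by blast
  have "(\<lambda>j. ennreal ((l2_norm lborel (\<lambda>q. pft (h j) q - F q))\<^sup>2)) \<longlonglongrightarrow> ennreal (0\<^sup>2)"
    by (intro tendsto_ennrealI tendsto_power FD(3) h)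
  then have "(\<lambda>j. \<integral>\<^sup>+\<omega>. hs_norm_sq (\<lambda>a \<xi>. gft_L1 (h j) \<omega> a \<xi> - kernel_op (gft_kernel F \<omega>) a \<xi>) * ennreal (\<bar>\<omega>\<bar> ^ CARD('n)) \<partial>lborel) \<longlonglongrightarrow> 0"
    unfolding gft_L1_diff_norm[OF h(1,2) FD(2)] by simp
  with h show "\<exists>h. (\<forall>j. integrable lborel (h j) \<and> h j \<in> L2 lborel) \<and> (\<lambda>j. l2_norm lborel (\<lambda>p. h j p - f p)) \<longlonglongrightarrow> 0 \<and>
      (\<lambda>j. \<integral>\<^sup>+\<omega>. hs_norm_sq (\<lambda>a \<xi>. gft_L1 (h j) \<omega> a \<xi> - kernel_op (gft_kernel F \<omega>) a \<xi>) * ennreal (\<bar>\<omega>\<bar> ^ CARD('n)) \<partial>lborel) \<longlonglongrightarrow> 0"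
    by blast
qed

text \<open>A single matrix entry is at most the norm of one column, since basis functions have norm
  1.\<close>

lemma hs_norm_sq_ge:
  fixes T :: "'n::finite op"
  assumes "T (some_onb j) \<in> L2 lborel"
  shows "ennreal ((cmod (l2_inner lborel (T (some_onb j)) (some_onb k)))\<^sup>2) \<le> hs_norm_sq T"
proof -
  have "l2_norm lborel (some_onb k :: real^'n::finite \<Rightarrow> complex) = 1"
  proof -
    have "complex_of_real ((l2_norm lborel (some_onb k :: real^'n::finite \<Rightarrow> complex))\<^sup>2) = 1"
      using l2_onb_some_onb[where 'n='n] unfolding l2_onb_def l2_inner_self[symmetric] by simp
    then have "(l2_norm lborel (some_onb k :: real^'n::finite \<Rightarrow> complex))\<^sup>2 = 1" using of_real_eq_1_iff by blast
    then show ?thesis by (simp add: power2_eq_1_iff) (metis l2_norm_nonneg neg_0_le_iff_le not_one_le_zero)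
  qed
  then have "cmod (l2_inner lborel (T (some_onb j)) (some_onb k)) \<le> l2_norm lborel (T (some_onb j))"
    using l2_Cauchy_Schwarz[OF assms some_onb_L2, of k] by simp
  then have "ennreal ((cmod (l2_inner lborel (T (some_onb j)) (some_onb k)))\<^sup>2) \<le> ennreal ((l2_norm lborel (T (some_onb j)))\<^sup>2)"
    by (intro ennreal_leI power_mono) auto
  also have "\<dots> \<le> hs_norm_sq T"
  proof -
    define f where "f j = ennreal ((l2_norm lborel (T (some_onb j)))\<^sup>2)" for j
    have "sum f {j} \<le> suminf f" by (rule sum_le_suminf) auto
    then show ?thesis by (simp add: f_def[abs_def] hs_norm_sq_def del: suminf_ennreal2)
  qed
  finally show ?thesis .
qed

text \<open>The approximating sequence contained in A also approximates the kernel operators, so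
  each matrix entry of A equals that of the kernel operator for almost every frequency. There are
  countably many entries, and agreement of entries gives agreement on the basis functions.\<close>

lemma is_gft_unique:
  fixes f F :: "'n::finite heis \<Rightarrow> complex"
  assumes F: "pft_limit f F" and A: "is_gft f A"
  shows "AE \<omega> in lborel. \<forall>j. A \<omega> (some_onb j) \<in> L2 lborel \<and> (AE \<xi> in lborel. A \<omega> (some_onb j) \<xi> = kernel_op (gft_kernel F \<omega>) (some_onb j) \<xi>)"
proof -
  note FD = pft_limitD[OF F]
  let ?e = "some_onb :: nat \<Rightarrow> real^'n \<Rightarrow> complex" and ?B = "\<lambda>\<omega>. kernel_op (gft_kernel F \<omega>)"
  let ?w = "\<lambda>\<omega>. ennreal (\<bar>\<omega>\<bar> ^ CARD('n))"
  have hsA: "AE \<omega> in lborel. hilbert_schmidt (A \<omega>)"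
    and Am[measurable]: "\<And>a b. a \<in> L2 lborel \<Longrightarrow> b \<in> L2 lborel \<Longrightarrow> (\<lambda>\<omega>. l2_inner lborel (A \<omega> a) b) \<in> borel_measurable lborel"
    using A unfolding is_gft_def by auto
  obtain h where h: "\<And>j. h j \<in> L2 lborel" "\<And>j. integrable lborel (h j)" "(\<lambda>j. l2_norm lborel (\<lambda>p. h j p - f p)) \<longlonglongrightarrow> 0"
    and hA: "(\<lambda>j. \<integral>\<^sup>+\<omega>. hs_norm_sq (\<lambda>a \<xi>. gft_L1 (h j) \<omega> a \<xi> - A \<omega> a \<xi>) * ?w \<omega> \<partial>lborel) \<longlonglongrightarrow> 0"
    using A unfolding is_gft_def by auto
  have [measurable]: "F \<in> borel_measurable borel" "\<And>i. h i \<in> borel_measurable borel" "\<And>j. ?e j \<in> borel_measurable borel"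
    using FD(2) h(2) L2_lborel_measurable some_onb_L2 by auto
  have hB: "(\<lambda>i. \<integral>\<^sup>+\<omega>. hs_norm_sq (\<lambda>a \<xi>. gft_L1 (h i) \<omega> a \<xi> - ?B \<omega> a \<xi>) * ?w \<omega> \<partial>lborel) \<longlonglongrightarrow> 0"
  proof -
    have "(\<lambda>j. ennreal ((l2_norm lborel (\<lambda>q. pft (h j) q - F q))\<^sup>2)) \<longlonglongrightarrow> ennreal (0\<^sup>2)"
      by (intro tendsto_ennrealI tendsto_power FD(3) h)
    then show ?thesis unfolding gft_L1_diff_norm[OF h(1,2) FD(2)] by simp
  qed
  have BL: "AE \<omega> in lborel. \<forall>j. ?B \<omega> (?e j) \<in> L2 lborel"
    using AE_nonzero AE_section_t_L2[OF FD(2)]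
    by eventually_elim (simp add: kernel_op_bound some_onb_L2 gft_kernel_L2)
  have AL: "AE \<omega> in lborel. \<forall>j. A \<omega> (?e j) \<in> L2 lborel"
    using hsA by eventually_elim (auto simp: hilbert_schmidt_def l2_bounded_op_def some_onb_L2)
  have CL: "AE \<omega> in lborel. \<forall>j. gft_L1 (h i) \<omega> (?e j) \<in> L2 lborel" for i
    using AE_nonzero AE_section_t_L2[OF pft_Plancherel(1)[OF h(1,2), of i]]
  proof eventually_elim
    case (elim \<omega>)
    then have k: "gft_kernel (pft (h i)) \<omega> \<in> L2 lborel" by (simp add: gft_kernel_L2)
    show ?case
    proof
      fix j
      show "gft_L1 (h i) \<omega> (?e j) \<in> L2 lborel"
        by (rule L2_cong_AE[OF kernel_op_bound(1)[OF k some_onb_L2[of j]]])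
         (use AE_gft_L1_kernel[OF h(2) some_onb_L2, of i \<omega> j] in \<open>auto elim!: AE_mp\<close>)
    qed
  qed
  have zero: "AE \<omega> in lborel. l2_inner lborel (A \<omega> (?e j)) (?e k) = l2_inner lborel (?B \<omega> (?e j)) (?e k)" for j k
  proof -
    define \<alpha> where "\<alpha> \<omega> = l2_inner lborel (A \<omega> (?e j)) (?e k)" for \<omega>
    define \<beta> where "\<beta> \<omega> = l2_inner lborel (?B \<omega> (?e j)) (?e k)" for \<omega>
    define \<gamma> where "\<gamma> i \<omega> = l2_inner lborel (gft_L1 (h i) \<omega> (?e j)) (?e k)" for i \<omega>
    have [measurable]: "\<alpha> \<in> borel_measurable borel"
      unfolding \<alpha>_def[abs_def] using Am[OF some_onb_L2 some_onb_L2, of j k] by simp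
    have [measurable]: "\<beta> \<in> borel_measurable borel"
      unfolding \<beta>_def[abs_def] l2_inner_def by measurable
    have [measurable]: "\<gamma> i \<in> borel_measurable borel" for i
      unfolding \<gamma>_def[abs_def] l2_inner_def by measurable
    have 1: "AE \<omega> in lborel. ennreal ((cmod (\<gamma> i \<omega> - \<alpha> \<omega>))\<^sup>2) \<le> hs_norm_sq (\<lambda>a \<xi>. gft_L1 (h i) \<omega> a \<xi> - A \<omega> a \<xi>)" for i
      using AL CL[of i]
    proof eventually_elim
      case (elim \<omega>)
      then have L: "A \<omega> (?e j) \<in> L2 lborel" "gft_L1 (h i) \<omega> (?e j) \<in> L2 lborel" by auto
      show ?case
        using hs_norm_sq_ge[of "\<lambda>a \<xi>. gft_L1 (h i) \<omega> a \<xi> - A \<omega> a \<xi>" j k, OF L2_diff[OF L(2,1)]]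
          l2_inner_diff_left[OF L(2,1) some_onb_L2[of k]] by (simp only: \<gamma>_def \<alpha>_def)
    qed
    have 2: "AE \<omega> in lborel. ennreal ((cmod (\<gamma> i \<omega> - \<beta> \<omega>))\<^sup>2) \<le> hs_norm_sq (\<lambda>a \<xi>. gft_L1 (h i) \<omega> a \<xi> - ?B \<omega> a \<xi>)" for i
      using BL CL[of i]
    proof eventually_elim
      case (elim \<omega>)
      then have L: "?B \<omega> (?e j) \<in> L2 lborel" "gft_L1 (h i) \<omega> (?e j) \<in> L2 lborel" by auto
      show ?case
        using hs_norm_sq_ge[of "\<lambda>a \<xi>. gft_L1 (h i) \<omega> a \<xi> - ?B \<omega> a \<xi>" j k, OF L2_diff[OF L(2,1)]]
          l2_inner_diff_left[OF L(2,1) some_onb_L2[of k]] by (simp only: \<gamma>_def \<beta>_def)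
    qed
    have le: "(\<integral>\<^sup>+\<omega>. ennreal ((cmod (\<alpha> \<omega> - \<beta> \<omega>))\<^sup>2) * ?w \<omega> \<partial>lborel) \<le>
        2 * (\<integral>\<^sup>+\<omega>. hs_norm_sq (\<lambda>a \<xi>. gft_L1 (h i) \<omega> a \<xi> - A \<omega> a \<xi>) * ?w \<omega> \<partial>lborel) +
        2 * (\<integral>\<^sup>+\<omega>. hs_norm_sq (\<lambda>a \<xi>. gft_L1 (h i) \<omega> a \<xi> - ?B \<omega> a \<xi>) * ?w \<omega> \<partial>lborel)" for i
    proof -
      have "(\<integral>\<^sup>+\<omega>. ennreal ((cmod (\<alpha> \<omega> - \<beta> \<omega>))\<^sup>2) * ?w \<omega> \<partial>lborel) \<le>
        (\<integral>\<^sup>+\<omega>. 2 * (ennreal ((cmod (\<gamma> i \<omega> - \<alpha> \<omega>))\<^sup>2) * ?w \<omega>) + 2 * (ennreal ((cmod (\<gamma> i \<omega> - \<beta> \<omega>))\<^sup>2) * ?w \<omega>) \<partial>lborel)"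
      proof (intro nn_integral_mono)
        fix \<omega> :: real
        have "(cmod (a - b))\<^sup>2 \<le> 2 * (cmod (c - a))\<^sup>2 + 2 * (cmod (c - b))\<^sup>2" for a b c :: complex
        proof -
          have "cmod (a - b) \<le> cmod (c - a) + cmod (c - b)"
            using norm_triangle_ineq4[of "c - b" "c - a"] by simp
          then have "(cmod (a - b))\<^sup>2 \<le> (cmod (c - a) + cmod (c - b))\<^sup>2" by (intro power_mono) auto
          also have "\<dots> \<le> 2 * (cmod (c - a))\<^sup>2 + 2 * (cmod (c - b))\<^sup>2"
            using sum_squares_bound[of "cmod (c - a)" "cmod (c - b)"] by (simp add: power2_sum)
          finally show ?thesis .
        qed
        from ennreal_leI[OF this[of "\<alpha> \<omega>" "\<beta> \<omega>" "\<gamma> i \<omega>"]]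
        have "ennreal ((cmod (\<alpha> \<omega> - \<beta> \<omega>))\<^sup>2) \<le> 2 * ennreal ((cmod (\<gamma> i \<omega> - \<alpha> \<omega>))\<^sup>2) + 2 * ennreal ((cmod (\<gamma> i \<omega> - \<beta> \<omega>))\<^sup>2)"
          by (simp add: ennreal_mult)
        from mult_right_mono[OF this, of "?w \<omega>"]
        show "ennreal ((cmod (\<alpha> \<omega> - \<beta> \<omega>))\<^sup>2) * ?w \<omega> \<le> 2 * (ennreal ((cmod (\<gamma> i \<omega> - \<alpha> \<omega>))\<^sup>2) * ?w \<omega>) + 2 * (ennreal ((cmod (\<gamma> i \<omega> - \<beta> \<omega>))\<^sup>2) * ?w \<omega>)"
          by (simp only: distrib_right mult.assoc zero_le simp_thms)
      qed
      \<comment> \<open>The integral is split at the level of matrix entries, whose measurability in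
        \<omega> is known; only afterwards are they bounded by the Hilbert--Schmidt norms.\<close>
      also have "\<dots> = 2 * (\<integral>\<^sup>+\<omega>. ennreal ((cmod (\<gamma> i \<omega> - \<alpha> \<omega>))\<^sup>2) * ?w \<omega> \<partial>lborel) + 2 * (\<integral>\<^sup>+\<omega>. ennreal ((cmod (\<gamma> i \<omega> - \<beta> \<omega>))\<^sup>2) * ?w \<omega> \<partial>lborel)"
        by (subst nn_integral_add) (simp_all add: nn_integral_cmult)
      also have "\<dots> \<le> 2 * (\<integral>\<^sup>+\<omega>. hs_norm_sq (\<lambda>a \<xi>. gft_L1 (h i) \<omega> a \<xi> - A \<omega> a \<xi>) * ?w \<omega> \<partial>lborel) +
        2 * (\<integral>\<^sup>+\<omega>. hs_norm_sq (\<lambda>a \<xi>. gft_L1 (h i) \<omega> a \<xi> - ?B \<omega> a \<xi>) * ?w \<omega> \<partial>lborel)"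
      proof (intro add_mono mult_left_mono nn_integral_mono_AE)
        show "AE \<omega> in lborel. ennreal ((cmod (\<gamma> i \<omega> - \<alpha> \<omega>))\<^sup>2) * ?w \<omega> \<le> hs_norm_sq (\<lambda>a \<xi>. gft_L1 (h i) \<omega> a \<xi> - A \<omega> a \<xi>) * ?w \<omega>"
          using 1[of i] by eventually_elim (rule mult_right_mono, simp_all)
        show "AE \<omega> in lborel. ennreal ((cmod (\<gamma> i \<omega> - \<beta> \<omega>))\<^sup>2) * ?w \<omega> \<le> hs_norm_sq (\<lambda>a \<xi>. gft_L1 (h i) \<omega> a \<xi> - ?B \<omega> a \<xi>) * ?w \<omega>"
          using 2[of i] by eventually_elim (rule mult_right_mono, simp_all)
      qed simp_all
      finally show ?thesis .
    qed
    have "(\<integral>\<^sup>+\<omega>. ennreal ((cmod (\<alpha> \<omega> - \<beta> \<omega>))\<^sup>2) * ?w \<omega> \<partial>lborel) \<le> 2 * 0 + 2 * 0"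
      by (rule tendsto_lowerbound[OF tendsto_add[OF ennreal_tendsto_cmult[OF _ hA] ennreal_tendsto_cmult[OF _ hB]]])
        (use le in \<open>auto simp: always_eventually\<close>)
    then have "(\<integral>\<^sup>+\<omega>. ennreal ((cmod (\<alpha> \<omega> - \<beta> \<omega>))\<^sup>2) * ?w \<omega> \<partial>lborel) = 0" by simp
    then have "AE \<omega> in lborel. ennreal ((cmod (\<alpha> \<omega> - \<beta> \<omega>))\<^sup>2) * ?w \<omega> = 0"
      by (subst (asm) nn_integral_0_iff_AE) measurable
    with AE_nonzero show ?thesis
    proof eventually_elim
      case (elim \<omega>)
      have "ennreal (\<bar>\<omega>\<bar> ^ CARD('n)) \<noteq> 0" using elim(1) by (simp add: ennreal_eq_0_iff not_le del: ennreal_power)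
      then have "ennreal ((cmod (\<alpha> \<omega> - \<beta> \<omega>))\<^sup>2) = 0" using elim(2) by (metis mult_eq_0_iff)
      then show ?case by (simp add: \<alpha>_def \<beta>_def)
    qed
  qed
  have "AE \<omega> in lborel. \<forall>j k. l2_inner lborel (A \<omega> (?e j)) (?e k) = l2_inner lborel (?B \<omega> (?e j)) (?e k)"
    using zero by (simp add: AE_all_countable)
  with AL BL show ?thesis
  proof eventually_elim
    case (elim \<omega>)
    show ?case
    proof (intro allI conjI)
      fix j
      have L: "A \<omega> (?e j) \<in> L2 lborel" "?B \<omega> (?e j) \<in> L2 lborel" using elim by auto
      then show "A \<omega> (?e j) \<in> L2 lborel" by simp
      have "l2_inner lborel (\<lambda>\<xi>. A \<omega> (?e j) \<xi> - ?B \<omega> (?e j) \<xi>) (?e k) = 0" for k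
        using elim l2_inner_diff_left[OF L some_onb_L2[of k]] by simp
      then have "AE \<xi> in lborel. A \<omega> (?e j) \<xi> - ?B \<omega> (?e j) \<xi> = 0"
        using l2_onb_some_onb[where 'n='n] L2_diff[OF L] unfolding l2_onb_def by blast
      then show "AE \<xi> in lborel. A \<omega> (?e j) \<xi> = ?B \<omega> (?e j) \<xi>" by simp
    qed
  qed
qed

theorem hs_inner_gft:
  fixes f g F H :: "'n::finite heis \<Rightarrow> complex"
  assumes F: "pft_limit f F" and H: "pft_limit g H"
  shows "AE \<omega> in lborel. hs_inner (gft f \<omega>) (gft g \<omega>) * of_real (\<bar>\<omega>\<bar> ^ CARD('n)) = l2_inner lborel (section_t F \<omega>) (section_t H \<omega>)"
proof -
  have gf: "is_gft f (gft f)" unfolding gft_def by (rule someI[of "is_gft f"], rule is_gft_kernel[OF F])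
  have gg: "is_gft g (gft g)" unfolding gft_def by (rule someI[of "is_gft g"], rule is_gft_kernel[OF H])
  have [measurable]: "F \<in> borel_measurable borel" "H \<in> borel_measurable borel"
    using pft_limitD(2)[OF F] pft_limitD(2)[OF H] L2_lborel_measurable by auto
  show ?thesis
    using AE_nonzero is_gft_unique[OF F gf] is_gft_unique[OF H gg] AE_section_t_L2[OF pft_limitD(2)[OF F]] AE_section_t_L2[OF pft_limitD(2)[OF H]]
  proof eventually_elim
    case (elim \<omega>)
    have k: "gft_kernel F \<omega> \<in> L2 lborel" "gft_kernel H \<omega> \<in> L2 lborel"
      using elim by (simp_all add: gft_kernel_L2)
    have "hs_inner (gft f \<omega>) (gft g \<omega>) = hs_inner (kernel_op (gft_kernel F \<omega>)) (kernel_op (gft_kernel H \<omega>))"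
      using elim(2,3) kernel_op_bound(1)[OF k(1) some_onb_L2] kernel_op_bound(1)[OF k(2) some_onb_L2]
      by (intro hs_inner_cong_AE L2_measurable) auto
    also have "\<dots> = l2_inner lborel (gft_kernel F \<omega>) (gft_kernel H \<omega>)" by (rule hs_inner_kernel[OF k])
    finally show ?case using elim(1) by (simp add: gft_kernel_inner mult.commute)
  qed
qed

section \<open>Periodization\<close>

lemma sums_indicator_unit_box:
  fixes x :: "'a::euclidean_space"
  assumes "\<exists>!v. v \<in> int_vecs \<and> x + v \<in> (unit_box :: 'a set)"
  shows "(\<lambda>n. indicator unit_box (x + int_vec_enum n) * c) sums (c :: 'b::real_normed_algebra_1)"
proof -
  from assms obtain w where w: "w \<in> int_vecs" "x + w \<in> unit_box" and uw: "\<And>v. v \<in> int_vecs \<Longrightarrow> x + v \<in> unit_box \<Longrightarrow> v = w"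
    by (elim ex1E) blast
  obtain N where N: "w = int_vec_enum N"
    using w(1) bij_int_vec_enum unfolding bij_betw_def by blast
  have *: "indicator unit_box (x + int_vec_enum n) * c = 0" if "n \<notin> {N}" for n
    using that uw[OF int_vec_enum_in, of n] N by (auto simp: int_vec_enum_eq_iff indicator_def)
  have "(\<lambda>n. indicator unit_box (x + int_vec_enum n) * c) = (\<lambda>n. if n = N then c else 0)"
    by (rule ext) (use * w(2) N in auto)
  then show ?thesis using sums_single[of N "\<lambda>_. c"] by simp
qed

text \<open>The counterpart of \<open>nn_integral_unfold\<close> for integrable functions. Absolute
  convergence of the series is recorded because it identifies the series with the unordered sum that
  defines \<open>G\<close>.\<close>

theorem integral_unfold:
  fixes F :: "'a::euclidean_space \<Rightarrow> complex"
  assumes F: "integrable lborel F"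
  shows "AE \<theta> in torus. summable (\<lambda>n. cmod (F (\<theta> - int_vec_enum n)))"
    "integrable torus (\<lambda>\<theta>. \<Sum>n. F (\<theta> - int_vec_enum n))"
    "(LINT \<theta>|torus. (\<Sum>n. F (\<theta> - int_vec_enum n))) = integral\<^sup>L lborel F"
proof -
  have Fm[measurable]: "F \<in> borel_measurable borel" using F by simp
  have Ft[measurable]: "(\<lambda>\<theta>. F (\<theta> - c)) \<in> borel_measurable torus" for c
    by (rule measurable_restrict_space1) measurable
  have Fe: "(\<lambda>\<theta>. ennreal (cmod (F (\<theta> - c)))) \<in> borel_measurable torus" for c
    by (rule measurable_restrict_space1) measurable
  let ?N = "\<lambda>n. \<integral>\<^sup>+\<theta>. ennreal (cmod (F (\<theta> - int_vec_enum n))) \<partial>torus"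
  have tot: "(\<Sum>n. ?N n) = (\<integral>\<^sup>+x. ennreal (cmod (F x)) \<partial>lborel)"
    by (subst nn_integral_suminf[OF Fe, symmetric]) (rule nn_integral_unfold[symmetric], measurable)
  have fin: "(\<Sum>n. ?N n) < \<infinity>" using F unfolding tot by (simp add: integrable_iff_bounded)
  have it: "integrable torus (\<lambda>\<theta>. F (\<theta> - int_vec_enum n))" for n
  proof -
    have "?N n \<le> (\<Sum>n. ?N n)" using sum_le_suminf[of ?N "{n}"] by simp
    then show ?thesis using fin unfolding integrable_iff_bounded by (auto intro: order_le_less_trans)
  qed
  have Nn: "?N n = ennreal (LINT \<theta>|torus. cmod (F (\<theta> - int_vec_enum n)))" for n
    by (intro nn_integral_eq_integral integrable_norm it) auto
  have sumN: "summable (\<lambda>n. LINT \<theta>|torus. cmod (F (\<theta> - int_vec_enum n)))"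
    using fin unfolding Nn by (intro summable_suminf_not_top) auto
  have "(\<integral>\<^sup>+\<theta>. (\<Sum>n. ennreal (cmod (F (\<theta> - int_vec_enum n)))) \<partial>torus) < \<infinity>"
    using fin by (simp only: nn_integral_suminf[OF Fe])
  then have "AE \<theta> in torus. (\<Sum>n. ennreal (cmod (F (\<theta> - int_vec_enum n)))) \<noteq> \<infinity>"
    by (intro nn_integral_PInf_AE borel_measurable_suminf_order Fe) simp
  then show AEs: "AE \<theta> in torus. summable (\<lambda>n. cmod (F (\<theta> - int_vec_enum n)))"
    by eventually_elim (auto intro: summable_suminf_not_top)
  show "integrable torus (\<lambda>\<theta>. \<Sum>n. F (\<theta> - int_vec_enum n))"
    by (rule integrable_suminf[OF it AEs sumN])
  let ?g = "\<lambda>n x. indicator unit_box (x + int_vec_enum n) * F x"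
  have gint: "integrable lborel (?g n)" for n
  proof -
    have "?g n = (\<lambda>x. indicator ((\<lambda>x. x + int_vec_enum n) -` unit_box) x * F x)" by (auto simp: indicator_def)
    moreover have "(\<lambda>x. x + int_vec_enum n) -` unit_box \<in> sets borel" by (intro borel_open open_vimage) (auto intro!: continuous_intros)
    ultimately show ?thesis using integrable_indicator_mult_complex[OF F] by simp
  qed
  have trans: "(LINT x|lborel. h (indicator unit_box (x + int_vec_enum n) * F x)) = (LINT \<theta>|torus. h (F (\<theta> - int_vec_enum n)))"
    if [measurable]: "h \<in> borel_measurable borel" and h0: "h 0 = (0::complex)" for h n
  proof -
    have "(LINT x|lborel. h (indicator unit_box (x + int_vec_enum n) * F x)) = (LINT x|lborel. h (indicator unit_box (x + int_vec_enum n) * F (x + int_vec_enum n - int_vec_enum n)))"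
      by simp
    also have "\<dots> = (LINT x|lborel. h (indicator unit_box x * F (x - int_vec_enum n)))"
      by (rule integral_lborel_translate) measurable
    also have "\<dots> = (LINT x|lborel. indicator unit_box x * h (F (x - int_vec_enum n)))"
      by (intro Bochner_Integration.integral_cong refl) (simp add: h0 split: split_indicator)
    finally show ?thesis by (simp add: integral_torus)
  qed
  have nrm: "(LINT x|lborel. norm (?g n x)) = (LINT \<theta>|torus. cmod (F (\<theta> - int_vec_enum n)))" for n
  proof -
    have "complex_of_real (LINT x|lborel. norm (?g n x)) = of_real (LINT \<theta>|torus. cmod (F (\<theta> - int_vec_enum n)))"
      using trans[of "\<lambda>z. complex_of_real (cmod z)" n] by (simp only: integral_complex_of_real) simp
    then show ?thesis using of_real_eq_iff by blast
  qed
  have "integral\<^sup>L lborel F = (LINT x|lborel. (\<Sum>n. ?g n x))"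
  proof (rule integral_cong_AE)
    show "AE x in lborel. F x = (\<Sum>n. ?g n x)"
      using AE_unique_unit_box_translate
      by eventually_elim (rule sums_unique[OF sums_indicator_unit_box])
  qed measurable
  also have "\<dots> = (\<Sum>n. integral\<^sup>L lborel (?g n))"
  proof (rule integral_suminf[OF gint])
    show "summable (\<lambda>n. LINT x|lborel. norm (?g n x))" unfolding nrm by (rule sumN)
    show "AE x in lborel. summable (\<lambda>n. norm (?g n x))"
      using AE_unique_unit_box_translate
    proof eventually_elim
      case (elim x)
      have "norm (?g n x) = indicator unit_box (x + int_vec_enum n) * norm (F x)" for n
        by (simp add: norm_mult split: split_indicator)
      then show ?case using sums_summable[OF sums_indicator_unit_box[OF elim, of "norm (F x)"]] by simp
    qed
  qed
  also have "\<dots> = (\<Sum>n. LINT \<theta>|torus. F (\<theta> - int_vec_enum n))"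
    using trans[of "\<lambda>z. z"] by simp
  also have "\<dots> = (LINT \<theta>|torus. (\<Sum>n. F (\<theta> - int_vec_enum n)))"
    by (rule integral_suminf[OF it AEs sumN, symmetric])
  finally show "(LINT \<theta>|torus. (\<Sum>n. F (\<theta> - int_vec_enum n))) = integral\<^sup>L lborel F" by simp
qed

text \<open>Unfolding produces arguments \<theta> minus a lattice point, while \<open>G\<close> adds
  integers; the sign is absorbed in the enumeration.\<close>

lemma bij_int_enum: "\<exists>\<rho>. bij_betw \<rho> (UNIV::nat set) (UNIV::int set) \<and> (\<forall>n. int_vec_enum n = - real_of_int (\<rho> n))"
proof -
  let ?\<rho> = "\<lambda>n. - \<lfloor>int_vec_enum n :: real\<rfloor>"
  have eq: "int_vec_enum n = - real_of_int (?\<rho> n)" for n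
    using int_vec_enum_in[of n, where 'a=real] by (auto simp: int_vecs_real elim: Ints_cases)
  have "inj ?\<rho>"
  proof (rule injI)
    fix n m assume "?\<rho> n = ?\<rho> m"
    then have "(int_vec_enum n :: real) = int_vec_enum m" using eq[of n] eq[of m] by simp
    then show "n = m" by (simp add: int_vec_enum_eq_iff)
  qed
  moreover have "surj ?\<rho>"
    unfolding surj_def
  proof
    show "\<exists>n. r = ?\<rho> n" for r
    proof -
      have "- real_of_int r \<in> int_vecs" by (simp add: int_vecs_real)
      then obtain n where "- real_of_int r = int_vec_enum n" using bij_int_vec_enum[where 'a=real] unfolding bij_betw_def by blast
      then have "?\<rho> n = r" by (metis add.inverse_inverse floor_of_int of_int_minus)
      then show ?thesis by auto
    qed
  qed
  ultimately show ?thesis using eq unfolding bij_betw_def by blast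
qed

lemma infsum_int_eq_suminf:
  fixes I :: "real \<Rightarrow> complex"
  assumes "summable (\<lambda>n. cmod (I (\<theta> - int_vec_enum n)))"
  shows "(\<Sum>\<^sub>\<infinity>r::int. I (\<theta> + of_int r)) = (\<Sum>n. I (\<theta> - int_vec_enum n))"
proof -
  obtain \<rho> :: "nat \<Rightarrow> int" where \<rho>: "bij_betw \<rho> UNIV UNIV" "\<And>n. int_vec_enum n = - real_of_int (\<rho> n)"
    using bij_int_enum by auto
  have "(\<Sum>\<^sub>\<infinity>r::int. I (\<theta> + of_int r)) = (\<Sum>\<^sub>\<infinity>n. I (\<theta> + of_int (\<rho> n)))"
    using infsum_reindex_bij_betw[OF \<rho>(1), of "\<lambda>r. I (\<theta> + of_int r)"] by simp
  also have "\<dots> = (\<Sum>\<^sub>\<infinity>n. I (\<theta> - int_vec_enum n))" by (simp add: \<rho>(2))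
  also have "\<dots> = (\<Sum>n. I (\<theta> - int_vec_enum n))"
    by (rule infsumI[OF norm_summable_imp_has_sum[OF assms summable_sums[OF summable_norm_cancel[OF assms]]]])
  finally show ?thesis .
qed

lemma section_t_Fubini:
  fixes F H :: "'n::finite heis \<Rightarrow> complex"
  assumes F: "F \<in> L2 lborel" and H: "H \<in> L2 lborel"
  shows "integrable lborel (\<lambda>\<omega>. l2_inner lborel (section_t F \<omega>) (section_t H \<omega>))"
    "(LINT \<omega>|lborel. l2_inner lborel (section_t F \<omega>) (section_t H \<omega>)) = l2_inner lborel F H"
proof -
  have [measurable]: "F \<in> borel_measurable borel" "H \<in> borel_measurable borel" using F H L2_lborel_measurable by auto
  let ?g = "\<lambda>p. F p * cnj (H p)"
  have gm: "?g \<in> borel_measurable borel" by measurable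
  have "integrable lborel ?g" by (rule L2_inner_integrable[OF F H])
  then have int: "integrable (lborel \<Otimes>\<^sub>M lborel) (\<lambda>q. ?g (rotate_t q))"
    using rotate_t.integrable_map_iff[OF gm] by (simp only: lborel_prod)
  have eq: "(LINT z|lborel. ?g (rotate_t (\<omega>, z))) = l2_inner lborel (section_t F \<omega>) (section_t H \<omega>)" for \<omega>
    by (simp add: l2_inner_def section_t_def rotate_t_def)
  show "integrable lborel (\<lambda>\<omega>. l2_inner lborel (section_t F \<omega>) (section_t H \<omega>))"
    using lborel_pair.integrable_fst'[OF int] unfolding eq .
  have "l2_inner lborel F H = (LINT q|lborel. ?g (rotate_t q))"
    using rotate_t.integral_map[OF gm] by (simp add: l2_inner_def)
  also have "\<dots> = (LINT \<omega>|lborel. l2_inner lborel (section_t F \<omega>) (section_t H \<omega>))"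
    using lborel_pair.integral_fst'[OF int] unfolding eq lborel_prod by (rule sym)
  finally show "(LINT \<omega>|lborel. l2_inner lborel (section_t F \<omega>) (section_t H \<omega>)) = l2_inner lborel F H" by simp
qed

text \<open>P need not be measurable, so a Borel null set containing its exceptions is translated
  instead.\<close>

lemma AE_all_int_translates:
  assumes "AE \<omega> in lborel. P (\<omega> :: real)"
  shows "AE \<omega> in lborel. \<forall>r::int. P (\<omega> + of_int r)"
proof -
  have "AE \<omega> in lborel. P (\<omega> + c)" for c
  proof -
    from assms obtain N where N: "{\<omega> \<in> space lborel. \<not> P \<omega>} \<subseteq> N" "emeasure lborel N = 0" "N \<in> sets lborel"
      by (rule AE_E)
    have "AE \<omega> in lborel. \<omega> \<notin> N" using N by (intro AE_not_in) (auto simp: null_sets_def)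
    moreover have "Measurable.pred borel (\<lambda>\<omega>. \<omega> \<notin> N)" using N(3) by measurable
    ultimately have "AE \<omega> in lborel. c + 1 * \<omega> \<notin> N" by (intro AE_borel_affine[of 1]) auto
    then show ?thesis
      by eventually_elim (use N(1) in \<open>auto simp: add.commute\<close>)
  qed
  then show ?thesis by (simp add: AE_all_countable)
qed

lemma AE_torus_of_lborel: "AE \<omega> in lborel. P \<omega> \<Longrightarrow> AE \<omega> in torus. P \<omega>"
  by (subst AE_restrict_space_iff) (auto elim!: AE_mp)

text \<open>The coefficient of the periodization unfolds to an integral over the line in which the
  character modulates H; modulation of H is translation of g in the centre.\<close>

lemma hs_inner_gft_periodization:
  fixes f g F H :: "'n::finite heis \<Rightarrow> complex"
  assumes F: "pft_limit f F" and H: "pft_limit g H"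
  defines "J \<equiv> \<lambda>\<omega>. \<Sum>n. l2_inner lborel (section_t F (\<omega> - int_vec_enum n)) (section_t H (\<omega> - int_vec_enum n))"
  shows "integrable torus J"
    "AE \<omega> in torus. (\<Sum>\<^sub>\<infinity>r::int. hs_inner (gft f (\<omega> + of_int r)) (gft g (\<omega> + of_int r)) * of_real (\<bar>\<omega> + of_int r\<bar> ^ CARD('n))) = J \<omega>"
    "(LINT \<omega>|torus. J \<omega> * cnj (char_fun (of_int m) \<omega>)) = l2_inner lborel f (central_translate (of_int m) g)"
proof -
  define I where "I \<omega> = l2_inner lborel (section_t F \<omega>) (section_t H \<omega>)" for \<omega>
  note FD = pft_limitD[OF F] and HD = pft_limitD[OF H]
  have I: "integrable lborel I" unfolding I_def[abs_def] by (rule section_t_Fubini[OF FD(2) HD(2)])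
  have J: "J = (\<lambda>\<omega>. \<Sum>n. I (\<omega> - int_vec_enum n))" by (simp add: J_def I_def)
  show "integrable torus J" unfolding J by (rule integral_unfold(2)[OF I])
  have "AE \<omega> in lborel. hs_inner (gft f \<omega>) (gft g \<omega>) * of_real (\<bar>\<omega>\<bar> ^ CARD('n)) = I \<omega>"
    unfolding I_def by (rule hs_inner_gft[OF F H])
  from AE_torus_of_lborel[OF AE_all_int_translates[OF this]] integral_unfold(1)[OF I]
  show "AE \<omega> in torus. (\<Sum>\<^sub>\<infinity>r::int. hs_inner (gft f (\<omega> + of_int r)) (gft g (\<omega> + of_int r)) * of_real (\<bar>\<omega> + of_int r\<bar> ^ CARD('n))) = J \<omega>"
  proof eventually_elim
    case (elim \<omega>)
    show ?case unfolding J using elim(1) infsum_int_eq_suminf[OF elim(2)] by simp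
  qed
  let ?I = "\<lambda>\<omega>. I \<omega> * cnj (char_fun (of_int m) \<omega>)"
  have Im: "integrable lborel ?I"
    using integrable_mult_char_fun[OF I, of "- of_int m"] by (simp only: char_fun_simps(4))
  have "(LINT \<omega>|torus. J \<omega> * cnj (char_fun (of_int m) \<omega>)) = (LINT \<omega>|torus. (\<Sum>n. ?I (\<omega> - int_vec_enum n)))"
  proof (rule integral_cong_AE)
    show "AE \<omega> in torus. J \<omega> * cnj (char_fun (of_int m) \<omega>) = (\<Sum>n. ?I (\<omega> - int_vec_enum n))"
      using integral_unfold(1)[OF I]
    proof eventually_elim
      case (elim \<omega>)
      \<comment> \<open>A character of integer frequency does not see integer shifts and can be
        moved inside the series.\<close>
      have "char_fun (real_of_int m) (\<omega> - int_vec_enum n) = char_fun (real_of_int m) \<omega>" for n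
        using char_fun_add(1)[of "real_of_int m" \<omega> "- int_vec_enum n"] char_fun_int_vecs[of "real_of_int m" "- int_vec_enum n"]
          int_vecs_closed(3)[OF int_vec_enum_in[of n, where 'a=real]] by (simp add: int_vecs_real)
      then show ?case unfolding J using suminf_mult2[OF summable_norm_cancel[OF elim]] by simp
    qed
    show "(\<lambda>\<omega>. J \<omega> * cnj (char_fun (of_int m) \<omega>)) \<in> borel_measurable torus"
      using integral_unfold(2)[OF I, folded J, THEN borel_measurable_integrable] L2_measurable[OF L2_char_fun_torus[of "of_int m"]]
      by measurable
    show "(\<lambda>\<omega>. \<Sum>n. ?I (\<omega> - int_vec_enum n)) \<in> borel_measurable torus"
      by (rule borel_measurable_integrable[OF integral_unfold(2)[OF Im]])
  qed
  also have "\<dots> = (LINT \<omega>|lborel. ?I \<omega>)" by (rule integral_unfold(3)[OF Im])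
  also have "\<dots> = l2_inner lborel F (\<lambda>q. char_fun (snd (snd q)) (of_int m) * H q)"
  proof -
    note H' = pft_limitD(2)[OF pft_limit_central_translate[OF H, of "of_int m"]]
    have "section_t (\<lambda>q. char_fun (snd (snd q)) (of_int m) * H q) \<omega> = (\<lambda>z. char_fun \<omega> (of_int m) * section_t H \<omega> z)" for \<omega>
      by (auto simp: section_t_def)
    then show ?thesis
      unfolding section_t_Fubini(2)[OF FD(2) H', symmetric]
      by (simp add: l2_inner_scale_right I_def char_fun_commute[of _ "real_of_int m"] mult.commute)
  qed
  also have "\<dots> = l2_inner lborel f (central_translate (of_int m) g)"
    by (rule pft_limit_inner[OF F pft_limit_central_translate[OF H], symmetric])
  finally show "(LINT \<omega>|torus. J \<omega> * cnj (char_fun (of_int m) \<omega>)) = l2_inner lborel f (central_translate (of_int m) g)" .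
qed

section \<open>Group translations and the Fourier coefficients of \<open>G\<close>\<close>

lemma scaled_measure_heis_translate:
  "scaled_measure_map (\<lambda>p. heis_mult (heis_inv g) p :: 'n::finite heis) 1"
proof -
  obtain a b s where g: "g = (a, b, s)" by (cases g)
  have eq: "heis_mult (heis_inv g) p = (fst p - a, fst (snd p) - b, snd (snd p) - s + (1/2) * (a \<bullet> fst (snd p) - b \<bullet> fst p))" for p :: "'n heis"
    by (cases p) (simp add: g inner_commute algebra_simps)
  show ?thesis
  proof
    show "(\<lambda>p. heis_mult (heis_inv g) p) \<in> borel_measurable borel"
      unfolding eq by (intro borel_measurable_continuous_onI continuous_intros)
    fix f :: "'n heis \<Rightarrow> ennreal" assume [measurable]: "f \<in> borel_measurable borel"
    have "(\<integral>\<^sup>+p. f (heis_mult (heis_inv g) p) \<partial>lborel) = (\<integral>\<^sup>+x. \<integral>\<^sup>+y. \<integral>\<^sup>+t. f (heis_mult (heis_inv g) (x, y, t)) \<partial>lborel \<partial>lborel \<partial>lborel)"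
      unfolding eq by (subst nn_integral_heis) auto
    \<comment> \<open>In t the translation is a shift by an amount depending on (x, y), so the
      t-integral is treated first, with x and y fixed.\<close>
    also have "\<dots> = (\<integral>\<^sup>+x. \<integral>\<^sup>+y. \<integral>\<^sup>+t. f (x - a, y - b, t) \<partial>lborel \<partial>lborel \<partial>lborel)"
    proof -
      have "(\<integral>\<^sup>+t. f (heis_mult (heis_inv g) (x, y, t)) \<partial>lborel) = (\<integral>\<^sup>+t. f (x - a, y - b, t) \<partial>lborel)" for x y
        using nn_integral_lborel_translate[of "\<lambda>t. f (x - a, y - b, t)" "- s + (1/2) * (a \<bullet> y - b \<bullet> x)"]
        unfolding eq by (simp add: algebra_simps)
      then show ?thesis by simp
    qed
    also have "\<dots> = (\<integral>\<^sup>+x. \<integral>\<^sup>+y. \<integral>\<^sup>+t. f (x - a, y, t) \<partial>lborel \<partial>lborel \<partial>lborel)"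
    proof -
      have "(\<integral>\<^sup>+y. \<integral>\<^sup>+t. f (x - a, y - b, t) \<partial>lborel \<partial>lborel) = (\<integral>\<^sup>+y. \<integral>\<^sup>+t. f (x - a, y, t) \<partial>lborel \<partial>lborel)" for x
        using nn_integral_lborel_translate[of "\<lambda>y. \<integral>\<^sup>+t. f (x - a, y, t) \<partial>lborel" "- b"] by simp
      then show ?thesis by simp
    qed
    also have "\<dots> = (\<integral>\<^sup>+x. \<integral>\<^sup>+y. \<integral>\<^sup>+t. f (x, y, t) \<partial>lborel \<partial>lborel \<partial>lborel)"
      using nn_integral_lborel_translate[of "\<lambda>x. \<integral>\<^sup>+y. \<integral>\<^sup>+t. f (x, y, t) \<partial>lborel \<partial>lborel" "- a"] by simp
    also have "\<dots> = integral\<^sup>N lborel f" by (simp add: nn_integral_heis)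
    finally show "integral\<^sup>N lborel f = ennreal 1 * (\<integral>\<^sup>+p. f (heis_mult (heis_inv g) p) \<partial>lborel)" by simp
  qed simp
qed

lemma L2_ltrans:
  assumes "f \<in> L2 lborel"
  shows "ltrans g f \<in> L2 lborel"
  using scaled_measure_map.L2_map_iff[OF scaled_measure_heis_translate L2_lborel_measurable[OF assms], of g] assms
  by (simp add: ltrans_def[abs_def])

lemma l2_inner_ltrans:
  assumes "f \<in> L2 lborel" "h \<in> L2 lborel"
  shows "l2_inner lborel (ltrans g f) (ltrans g h) = l2_inner lborel f h"
  using scaled_measure_map.l2_inner_map[OF scaled_measure_heis_translate assms[THEN L2_lborel_measurable], of g]
  by (simp add: ltrans_def[abs_def])

lemma central_translate_ltrans:
  "central_translate (of_int m) (ltrans (lattice_pt (k, l, 0)) f) = ltrans (lattice_pt (k, l, m)) f"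
proof
  fix p :: "'a heis"
  obtain x y t where p: "p = (x, y, t)" by (cases p)
  show "central_translate (of_int m) (ltrans (lattice_pt (k, l, 0)) f) p = ltrans (lattice_pt (k, l, m)) f p"
    unfolding p central_translate_def fst_conv snd_conv ltrans_lattice_pt by (simp add: algebra_simps)
qed

lemma ltrans_lattice_pt_zero: "ltrans (lattice_pt (0, 0, 0)) f = f"
proof
  fix p :: "'a heis"
  obtain x y t where p: "p = (x, y, t)" by (cases p)
  have "(\<chi> i. (0 :: real)) = (0 :: real^'a)" by (simp add: vec_eq_iff)
  then show "ltrans (lattice_pt (0, 0, 0)) f p = f p"
    unfolding p ltrans_lattice_pt by simp
qed

text \<open>Passes from \<open>G\<close>, which contains a choice, to an integrable representative
  whose coefficients can be computed.\<close>

lemma G_Fourier_coeff: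
  fixes \<phi> :: "'n::finite heis \<Rightarrow> complex"
  assumes \<phi>: "\<phi> \<in> L2 lborel"
  obtains J where "integrable torus J" "AE \<omega> in torus. G \<phi> k l \<omega> = J \<omega>"
    "\<And>m. (LINT \<omega>|torus. J \<omega> * cnj (char_fun (of_int m) \<omega>)) = l2_inner lborel \<phi> (ltrans (lattice_pt (k, l, m)) \<phi>)"
proof -
  obtain F where F: "pft_limit \<phi> F" using pft_limit_exists[OF \<phi>] by blast
  obtain H where H: "pft_limit (ltrans (lattice_pt (k, l, 0)) \<phi>) H" using pft_limit_exists[OF L2_ltrans[OF \<phi>]] by blast
  from that[OF hs_inner_gft_periodization(1)[OF F H] hs_inner_gft_periodization(2)[OF F H, folded G_def]]
    hs_inner_gft_periodization(3)[OF F H, unfolded central_translate_ltrans]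
  show thesis by blast
qed

lemma condition_C_orthogonal:
  fixes \<phi> :: "'n::finite heis \<Rightarrow> complex"
  assumes \<phi>: "\<phi> \<in> L2 lborel" and C: "condition_C \<phi>" and kl: "(k, l) \<noteq> (0, 0)"
  shows "l2_inner lborel \<phi> (ltrans (lattice_pt (k, l, m)) \<phi>) = 0"
proof -
  obtain J where J: "integrable torus J" "AE \<omega> in torus. G \<phi> k l \<omega> = J \<omega>"
    "\<And>m. (LINT \<omega>|torus. J \<omega> * cnj (char_fun (of_int m) \<omega>)) = l2_inner lborel \<phi> (ltrans (lattice_pt (k, l, m)) \<phi>)"
    by (rule G_Fourier_coeff[OF \<phi>, of k l]) (rule that)
  have "AE \<omega> in lborel. \<omega> \<in> {0<..1} \<longrightarrow> G \<phi> k l \<omega> = 0"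
    using C kl unfolding condition_C_def by blast
  then have "AE \<omega> in torus. G \<phi> k l \<omega> = 0"
    by (subst AE_restrict_space_iff) (auto simp: unit_box_real elim!: AE_mp)
  with J(2) have z: "AE \<omega> in torus. J \<omega> = 0" by eventually_elim simp
  have "(LINT \<omega>|torus. J \<omega> * cnj (char_fun (of_int m) \<omega>)) = 0"
    using z by (intro integral_eq_zero_AE) (auto elim!: AE_mp)
  then show ?thesis unfolding J(3) .
qed

text \<open>The modulus of J is taken as the weight: it is nonnegative everywhere and agrees with J
  almost everywhere, where J is a convergent sum of squared norms.\<close>

lemma G_00_weight:
  fixes \<phi> :: "'n::finite heis \<Rightarrow> complex"
  assumes \<phi>: "\<phi> \<in> L2 lborel"
  obtains w :: "real \<Rightarrow> real" where "integrable torus w" "\<And>\<omega>. 0 \<le> w \<omega>" "AE \<omega> in torus. Re (G \<phi> 0 0 \<omega>) = w \<omega>"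
    "\<And>m. (LINT \<omega>|torus. of_real (w \<omega>) * cnj (char_fun (of_int m) \<omega>)) = l2_inner lborel \<phi> (ltrans (lattice_pt (0, 0, m)) \<phi>)"
proof -
  obtain F where F: "pft_limit \<phi> F" using pft_limit_exists[OF \<phi>] by blast
  have eq: "ltrans (lattice_pt (0, 0, 0)) \<phi> = \<phi>" by (rule ltrans_lattice_pt_zero)
  define I where "I \<omega> = (l2_norm lborel (section_t F \<omega>))\<^sup>2" for \<omega>
  define J where "J \<omega> = (\<Sum>n. l2_inner lborel (section_t F (\<omega> - int_vec_enum n)) (section_t F (\<omega> - int_vec_enum n)))" for \<omega>
  note P = hs_inner_gft_periodization[OF F F, folded J_def]
  have JJ: "J \<omega> = (\<Sum>n. complex_of_real (I (\<omega> - int_vec_enum n)))" for \<omega>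
    by (simp only: J_def I_def l2_inner_self)
  have "integrable lborel (\<lambda>\<omega>. l2_inner lborel (section_t F \<omega>) (section_t F \<omega>))"
    by (intro section_t_Fubini pft_limitD[OF F])
  then have Ii: "integrable lborel (\<lambda>\<omega>. complex_of_real (I \<omega>))" by (simp only: I_def l2_inner_self)
  have "AE \<omega> in torus. J \<omega> = of_real (cmod (J \<omega>))"
    using integral_unfold(1)[OF Ii]
  proof eventually_elim
    case (elim \<omega>)
    have "cmod (complex_of_real (I z)) = I z" for z by (simp add: I_def norm_power)
    with elim have s: "summable (\<lambda>n. I (\<omega> - int_vec_enum n))" by simp
    have "J \<omega> = of_real (\<Sum>n. I (\<omega> - int_vec_enum n))" unfolding JJ by (rule suminf_of_real[OF s, symmetric])
    moreover have "0 \<le> (\<Sum>n. I (\<omega> - int_vec_enum n))" by (rule suminf_nonneg[OF s]) (simp add: I_def)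
    ultimately show ?case by simp
  qed
  note real = this
  have Jm[measurable]: "J \<in> borel_measurable torus" using P(1) by (rule borel_measurable_integrable)
  have cm[measurable]: "char_fun c \<in> borel_measurable torus" for c :: real by (rule L2_measurable[OF L2_char_fun_torus])
  show thesis
  proof (rule that[of "\<lambda>\<omega>. cmod (J \<omega>)"])
    show "integrable torus (\<lambda>\<omega>. cmod (J \<omega>))" using P(1) by (rule integrable_norm)
    show "AE \<omega> in torus. Re (G \<phi> 0 0 \<omega>) = cmod (J \<omega>)"
      using P(2) real
    proof eventually_elim
      case (elim \<omega>)
      have "G \<phi> 0 0 \<omega> = J \<omega>" unfolding G_def eq using elim(1) .
      then show ?case using elim(2) by (metis Re_complex_of_real)
    qed
    show "(LINT \<omega>|torus. of_real (cmod (J \<omega>)) * cnj (char_fun (of_int m) \<omega>)) = l2_inner lborel \<phi> (ltrans (lattice_pt (0, 0, m)) \<phi>)" for m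
    proof -
      have "(LINT \<omega>|torus. of_real (cmod (J \<omega>)) * cnj (char_fun (of_int m) \<omega>)) = (LINT \<omega>|torus. J \<omega> * cnj (char_fun (of_int m) \<omega>))"
        using real by (intro integral_cong_AE) (measurable, auto elim!: AE_mp)
      then show ?thesis
        using P(3)[of m] unfolding central_translate_ltrans[of m 0 0 \<phi>, unfolded eq] by (rule trans)
    qed
  qed simp
qed

lemma G_periodic: "G \<phi> k l (\<omega> + 1) = G \<phi> k l \<omega>"
proof -
  have "bij_betw (\<lambda>r::int. r + 1) UNIV UNIV" by (rule bij_betw_byWitness[where f'="\<lambda>r. r - 1"]) auto
  from infsum_reindex_bij_betw[OF this, of "\<lambda>r. hs_inner (gft \<phi> (\<omega> + of_int r)) (gft (ltrans (lattice_pt (k, l, 0)) \<phi>) (\<omega> + of_int r)) *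
        of_real (\<bar>\<omega> + of_int r\<bar> ^ CARD('a))"]
  show ?thesis unfolding G_def by (simp add: add_ac)
qed

section \<open>Uniform boundedness and multiplication operators\<close>

text \<open>A direct construction: if the norms were unbounded, a vector could be assembled from
  multiples of rapidly growing members whose pairings with those members are unbounded.\<close>

theorem l2_uniform_boundedness:
  assumes b: "\<And>i. i \<in> S \<Longrightarrow> b i \<in> L2 M"
    and bdd: "\<And>c. c \<in> L2 M \<Longrightarrow> \<exists>C. \<forall>i\<in>S. cmod (l2_inner M c (b i)) \<le> C"
  shows "\<exists>C. \<forall>i\<in>S. l2_norm M (b i) \<le> C"
proof (rule ccontr)
  assume "\<not> ?thesis"
  then have "\<exists>i. i \<in> S \<and> l2_norm M (b i) > C" for C by (meson not_le)
  \<comment> \<open>At the end a pairing retains 1/2 * 3^-(n+1) times this norm; the factor 2 *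
    3^(n+1) makes the product exceed n.\<close>
  then have "\<forall>n::nat. \<exists>i. i \<in> S \<and> l2_norm M (b i) > 2 * real n * 3 ^ Suc n" by blast
  from choice[OF this] obtain i where i: "\<And>n::nat. i n \<in> S" "\<And>n. l2_norm M (b (i n)) > 2 * real n * 3 ^ Suc n"
    by blast
  have pos: "l2_norm M (b (i n)) > 0" for n
    by (rule le_less_trans[OF _ i(2)]) simp
  define u where "u n x = complex_of_real ((1/3) ^ Suc n / l2_norm M (b (i n))) * b (i n) x" for n x
  have u: "u n \<in> L2 M" for n unfolding u_def[abs_def] by (intro L2_scale b i)
  have nu: "l2_norm M (u n) = (1/3) ^ Suc n" for n
    using pos[of n] unfolding u_def[abs_def] l2_norm_scale norm_of_real by simp
  have iu: "l2_inner M (u n) (b (i n)) = of_real ((1/3) ^ Suc n * l2_norm M (b (i n)))" for n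
    using pos[of n] unfolding u_def[abs_def] l2_inner_scale_left l2_inner_self
    by (simp add: power2_eq_square)
  text \<open>Sokal's argument: the sign of the \<open>n\<close>-th step is chosen so that the \<open>n\<close>-th functional is large.\<close>
  define step where "step n f = (if cmod (l2_inner M f (b (i n)) + l2_inner M (u n) (b (i n))) \<ge> cmod (l2_inner M (u n) (b (i n))) then 1 else - 1 :: complex)" for n f
  define c where "c = rec_nat (\<lambda>x. 0) (\<lambda>n f x. f x + step n f * u n x)"
  have c0: "c 0 = (\<lambda>x. 0)" and cS: "c (Suc n) = (\<lambda>x. c n x + step n (c n) * u n x)" for n
    by (simp_all add: c_def)
  have c: "c n \<in> L2 M" for n
    by (induction n) (auto simp: c0 cS intro!: L2_add L2_scale u)
  have step1: "cmod (step n f) = 1" for n f by (simp add: step_def)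
  have big: "cmod (l2_inner M (c (Suc n)) (b (i n))) \<ge> (1/3) ^ Suc n * l2_norm M (b (i n))" for n
  proof -
    let ?z = "l2_inner M (c n) (b (i n))" and ?w = "l2_inner M (u n) (b (i n))"
    have "l2_inner M (c (Suc n)) (b (i n)) = ?z + step n (c n) * ?w"
      unfolding cS by (simp add: l2_inner_add_left c u L2_scale b i l2_inner_scale_left)
    moreover have "cmod (?z + step n (c n) * ?w) \<ge> cmod ?w"
    proof (cases "cmod (?z + ?w) \<ge> cmod ?w")
      \<comment> \<open>If \<open>?z + ?w\<close> is shorter than \<open>?w\<close>, the triangle
        inequality makes \<open>?z - ?w\<close> at least as long as \<open>?w\<close>.\<close>
      case False
      have "2 * cmod ?w \<le> cmod (?z + ?w) + cmod (?z - ?w)"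
        using norm_triangle_ineq4[of "?z + ?w" "?z - ?w"] by simp
      with False show ?thesis by (simp add: step_def)
    qed (simp add: step_def)
    moreover have "cmod ?w = (1/3) ^ Suc n * l2_norm M (b (i n))"
      unfolding iu norm_of_real by simp
    ultimately show ?thesis by simp
  qed
  \<comment> \<open>All steps after step n together have norm at most half of 3^-(n+1), so they
    destroy at most half of what step n achieved.\<close>
  have tail: "l2_norm M (\<lambda>x. c (n + k) x - c n x) \<le> (1/2) * (1/3) ^ n" for n k
  proof -
    have "c (n + k) x - c n x = (\<Sum>j<k. step (n + j) (c (n + j)) * u (n + j) x)" for x
      by (induction k) (simp_all add: cS)
    then have "l2_norm M (\<lambda>x. c (n + k) x - c n x) \<le> (\<Sum>j<k. l2_norm M (\<lambda>x. step (n + j) (c (n + j)) * u (n + j) x))"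
      by (simp only:) (intro l2_norm_sum L2_scale u)
    also have "\<dots> = (1/3) ^ Suc n * (\<Sum>j<k. (1/3) ^ j)"
      by (simp add: l2_norm_scale step1 nu power_add sum_distrib_left)
    also have "\<dots> \<le> (1/3) ^ Suc n * (3/2)"
      by (intro mult_left_mono) (auto simp: sum_gp_strict)
    finally show ?thesis by simp
  qed
  obtain d where d: "d \<in> L2 M" "(\<lambda>n. l2_norm M (\<lambda>x. c n x - d x)) \<longlonglongrightarrow> 0"
  proof (rule Riesz_Fischer[OF c])
    fix e :: real assume "0 < e"
    then obtain N where N: "(1/3::real) ^ N < e" using real_arch_pow_inv[of e "1/3"] by auto
    have "l2_norm M (\<lambda>x. c m x - c n x) < e" if "m \<ge> N" "n \<ge> N" for m n
      using l2_norm_triangle_diff[OF c[of m] c[of N] c[of n]] tail[of N "m - N"] tail[of N "n - N"]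
        l2_norm_minus_commute[of M "c n" "c N"] that N by simp
    then show "\<exists>N. \<forall>m\<ge>N. \<forall>n\<ge>N. l2_norm M (\<lambda>x. c m x - c n x) < e" by blast
  qed (rule that)
  have dc: "l2_norm M (\<lambda>x. c n x - d x) \<le> (1/2) * (1/3) ^ n" for n
  proof (rule LIMSEQ_le_const)
    have "(\<lambda>k. (1/2) * (1/3) ^ n + l2_norm M (\<lambda>x. c (k + n) x - d x)) \<longlonglongrightarrow> (1/2) * (1/3) ^ n + 0"
      by (intro tendsto_add tendsto_const LIMSEQ_ignore_initial_segment d(2))
    then show "(\<lambda>k. (1/2) * (1/3) ^ n + l2_norm M (\<lambda>x. c (k + n) x - d x)) \<longlonglongrightarrow> (1/2) * (1/3) ^ n" by simp
    have "l2_norm M (\<lambda>x. c n x - d x) \<le> (1/2) * (1/3) ^ n + l2_norm M (\<lambda>x. c (k + n) x - d x)" for k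
      using l2_norm_triangle_diff[OF c[of n] c[of "k + n"] d(1)] tail[of n k] l2_norm_minus_commute[of M "c n" "c (k + n)"]
      by (simp add: add.commute)
    then show "\<exists>N. \<forall>k\<ge>N. l2_norm M (\<lambda>x. c n x - d x) \<le> (1/2) * (1/3) ^ n + l2_norm M (\<lambda>x. c (k + n) x - d x)" by blast
  qed
  obtain C where C: "\<And>n. cmod (l2_inner M d (b (i n))) \<le> C" using bdd[OF d(1)] i(1) by blast
  obtain n :: nat where n: "C < real n" using reals_Archimedean2 by blast
  have "cmod (l2_inner M (c (Suc n)) (b (i n)) - l2_inner M d (b (i n))) \<le> (1/2) * (1/3) ^ Suc n * l2_norm M (b (i n))"
    using l2_Cauchy_Schwarz[OF L2_diff[OF c d(1)] b[OF i(1)], of "Suc n" n] dc[of "Suc n"] pos[of n]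
    by (simp only: l2_inner_diff_left[OF c d(1) b[OF i(1)]]) (meson less_imp_le mult_right_mono order_trans)
  then have "cmod (l2_inner M d (b (i n))) \<ge> (1/2) * (1/3) ^ Suc n * l2_norm M (b (i n))"
    using big[of n] norm_triangle_ineq2[of "l2_inner M (c (Suc n)) (b (i n))" "l2_inner M d (b (i n))"] by linarith
  moreover have "(1/2) * (1/3) ^ Suc n * l2_norm M (b (i n)) > (1/2) * (1/3) ^ Suc n * (2 * real n * 3 ^ Suc n)"
    using i(2)[of n] by (intro mult_strict_left_mono) auto
  moreover have "(1/2) * (1/3) ^ Suc n * (2 * real n * 3 ^ Suc n) = real n"
    by (simp add: power_one_over field_simps)
  ultimately show False using C[of n] n by linarith
qed

section \<open>Square summable sequences as functions on the circle, and multiplication by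
  weights\<close>

abbreviation chi :: "int \<Rightarrow> real \<Rightarrow> complex" where "chi m \<equiv> char_fun (of_int m)"

abbreviation circle :: "real measure" where "circle \<equiv> restrict_space lborel {0<..<1}"

lemma l2_orthonormal_chi: "l2_orthonormal circle UNIV chi"
  using l2_orthonormal_torus[where 'a=real] unfolding l2_orthonormal_def unit_box_real by (simp add: int_vecs_real)

lemma l2_total_chi: "l2_total circle UNIV chi"
proof -
  have "(\<forall>i\<in>(int_vecs::real set). l2_inner circle f (char_fun i) = 0) \<longleftrightarrow> (\<forall>i\<in>UNIV. l2_inner circle f (chi i) = 0)" for f
    by (auto simp: int_vecs_real elim: Ints_cases)
  then show ?thesis using l2_total_torus[where 'a=real] unfolding l2_total_def unit_box_real by simp
qed

lemmas chi_Parseval_inner = Parseval_inner[OF l2_orthonormal_chi l2_total_chi]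
lemmas chi_Parseval_norm = Parseval_norm[OF l2_orthonormal_chi l2_total_chi]
lemmas chi_Riesz_Fischer = Riesz_Fischer_orthonormal[OF l2_orthonormal_chi]
lemmas L2_chi = L2_char_fun_torus[where 'a=real, unfolded unit_box_real]
lemmas L2_circle_integrable = L2_torus_integrable[where 'a=real, unfolded unit_box_real]
lemmas finite_measure_circle = finite_measure_torus[where 'a=real, unfolded unit_box_real]

lemma chi_uniqueness:
  assumes f: "integrable circle f" and g: "integrable circle g"
    and eq: "\<And>m. (LINT x|circle. f x * cnj (chi m x)) = (LINT x|circle. g x * cnj (chi m x))"
  shows "AE x in circle. f x = (g x :: complex)"
proof -
  have i: "integrable circle (\<lambda>x. h x * cnj (chi m x))" if "integrable circle h" for h :: "real \<Rightarrow> complex" and m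
    by (rule Bochner_Integration.integrable_bound[OF that])
      (use that L2_measurable[OF L2_cnj[OF L2_chi]] in \<open>auto simp: norm_mult char_fun_simps(3)\<close>)
  have "AE x in circle. f x - g x = 0"
  proof (rule Fourier_uniqueness_torus[where 'a=real, unfolded unit_box_real])
    show "integrable circle (\<lambda>x. f x - g x)" using f g by simp
    fix v :: real assume "v \<in> int_vecs"
    then obtain m where "v = of_int m" by (auto simp: int_vecs_real elim: Ints_cases)
    then show "(LINT x|circle. (f x - g x) * cnj (char_fun v x)) = 0"
      using eq[of m] i[OF f, of m] i[OF g, of m] by (simp add: left_diff_distrib)
  qed
  then show ?thesis by simp
qed

text \<open>The sequence space is realized as L2 of the circle through Fourier coefficients. Uniform
  boundedness is used twice: for one p over finite truncations, which puts the sequence of p in the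
  space, and then over all p.\<close>

lemma coefficient_uniform_boundedness:
  fixes a :: "'p \<Rightarrow> int \<Rightarrow> complex"
  assumes H: "\<And>c :: int \<Rightarrow> complex. (\<lambda>m. (cmod (c m))\<^sup>2) summable_on UNIV \<Longrightarrow>
      \<exists>g B. \<forall>p\<in>K. ((\<lambda>m. c m * a p m) has_sum g p) UNIV \<and> cmod (g p) \<le> B"
  shows "\<exists>C. \<forall>p\<in>K. (\<lambda>m. (cmod (a p m))\<^sup>2) summable_on UNIV \<and> infsum (\<lambda>m. (cmod (a p m))\<^sup>2) UNIV \<le> C"
proof -
  have sq: "(\<lambda>m. (cmod (l2_inner circle f (chi m)))\<^sup>2) summable_on UNIV" if "f \<in> L2 circle" for f
    by (rule Bessel_summable[OF l2_orthonormal_chi that])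
  have 1: "(\<lambda>m. (cmod (a p m))\<^sup>2) summable_on UNIV" if p: "p \<in> K" for p
  proof -
    \<comment> \<open>Truncations of the functional given by p. Unordered convergence of complex
      series is absolute, so their values on a fixed f are bounded.\<close>
    let ?b = "\<lambda>X x. \<Sum>m\<in>X. cnj (a p m) * chi m x"
    have bL: "?b X \<in> L2 circle" for X by (intro L2_sum L2_scale L2_chi)
    have "\<exists>C. \<forall>X\<in>Collect finite. l2_norm circle (?b X) \<le> C"
    proof (rule l2_uniform_boundedness)
      fix f :: "real \<Rightarrow> complex" assume f: "f \<in> L2 circle"
      let ?c = "\<lambda>m. l2_inner circle f (chi m)"
      have "(\<lambda>m. ?c m * a p m) summable_on UNIV" using H[OF sq[OF f]] p unfolding summable_on_def by blast
      then have s: "(\<lambda>m. cmod (?c m * a p m)) summable_on UNIV"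
        by (simp only: summable_on_iff_abs_summable_on_complex)
      have "cmod (l2_inner circle f (?b X)) \<le> infsum (\<lambda>m. cmod (?c m * a p m)) UNIV" if "finite X" for X
      proof -
        have "l2_inner circle f (?b X) = (\<Sum>m\<in>X. ?c m * a p m)"
          by (subst l2_inner_sum_right) (auto simp: l2_inner_scale_right mult.commute intro: f L2_scale L2_chi)
        also have "cmod \<dots> \<le> (\<Sum>m\<in>X. cmod (?c m * a p m))" by (rule norm_sum)
        also have "\<dots> \<le> infsum (\<lambda>m. cmod (?c m * a p m)) UNIV"
          using that by (intro finite_sum_le_infsum s) auto
        finally show ?thesis .
      qed
      then show "\<exists>C. \<forall>X\<in>Collect finite. cmod (l2_inner circle f (?b X)) \<le> C" by blast
    qed (rule bL)
    then obtain C where C: "\<And>X. finite X \<Longrightarrow> l2_norm circle (?b X) \<le> C" by blast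
    have "(\<Sum>m\<in>X. (cmod (a p m))\<^sup>2) \<le> C\<^sup>2" if "finite X" for X
    proof -
      have "(\<Sum>m\<in>X. (cmod (a p m))\<^sup>2) = (l2_norm circle (?b X))\<^sup>2"
        using orthonormal_sum_norm[OF l2_orthonormal_chi _ that, of "\<lambda>m. cnj (a p m)"] by simp
      also have "\<dots> \<le> C\<^sup>2" by (intro power_mono C that) simp
      finally show ?thesis .
    qed
    then show ?thesis
      by (intro nonneg_bdd_above_summable_on) (auto intro!: bdd_aboveI[where M="C\<^sup>2"])
  qed
  have "\<exists>b. b \<in> L2 circle \<and> (\<forall>m. l2_inner circle b (chi m) = cnj (a p m))" if "p \<in> K" for p
    by (rule chi_Riesz_Fischer[of "\<lambda>m. cnj (a p m)"]) (use 1[OF that] in auto)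
  then obtain b where b: "\<And>p. p \<in> K \<Longrightarrow> b p \<in> L2 circle" "\<And>p m. p \<in> K \<Longrightarrow> l2_inner circle (b p) (chi m) = cnj (a p m)"
    by metis
  \<comment> \<open>With each functional represented by a vector \<open>b p\<close>, the bounds for
    each fixed f become one bound over K.\<close>
  have "\<exists>C. \<forall>p\<in>K. l2_norm circle (b p) \<le> C"
  proof (rule l2_uniform_boundedness)
    fix f :: "real \<Rightarrow> complex" assume f: "f \<in> L2 circle"
    obtain g B where gB: "\<And>p. p \<in> K \<Longrightarrow> ((\<lambda>m. l2_inner circle f (chi m) * a p m) has_sum g p) UNIV \<and> cmod (g p) \<le> B"
      using H[OF sq[OF f]] by blast
    have "l2_inner circle f (b p) = g p" if "p \<in> K" for p
      using chi_Parseval_inner[OF f b(1)[OF that]] gB[OF that] b(2)[OF that] by (auto intro: has_sum_unique)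
    then show "\<exists>C. \<forall>p\<in>K. cmod (l2_inner circle f (b p)) \<le> C" using gB by metis
  qed (rule b(1))
  then obtain C where C: "\<And>p. p \<in> K \<Longrightarrow> l2_norm circle (b p) \<le> C" by blast
  have "infsum (\<lambda>m. (cmod (a p m))\<^sup>2) UNIV \<le> C\<^sup>2" if "p \<in> K" for p
  proof -
    have "infsum (\<lambda>m. (cmod (a p m))\<^sup>2) UNIV = (l2_norm circle (b p))\<^sup>2"
      using chi_Parseval_norm[OF b(1)[OF that]] b(2)[OF that] by (simp add: infsumI)
    also have "\<dots> \<le> C\<^sup>2" by (intro power_mono C that) simp
    finally show ?thesis .
  qed
  with 1 show ?thesis by blast
qed

lemma infsum_ennreal_le:
  fixes f :: "'i \<Rightarrow> real"
  assumes "f summable_on UNIV" "\<And>m. 0 \<le> f m" "infsum f UNIV \<le> C"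
  shows "(\<Sum>\<^sub>\<infinity>m. ennreal (f m)) \<le> ennreal C"
proof -
  have "(\<Sum>m\<in>X. ennreal (f m)) \<le> ennreal C" if "finite X" for X
  proof -
    have "sum f X \<le> infsum f UNIV" using assms that by (intro finite_sum_le_infsum) auto
    then show ?thesis using assms by (simp add: sum_ennreal ennreal_leI)
  qed
  then show ?thesis by (subst nonneg_infsum_complete) (auto intro: SUP_least)
qed

text \<open>Turns limits along finite index sets into limits of symmetric partial sums, to which
  subsequence and Fatou arguments apply.\<close>

lemma filterlim_int_intervals: "filterlim (\<lambda>N::nat. {- int N..int N}) (finite_subsets_at_top UNIV) sequentially"
  unfolding filterlim_finite_subsets_at_top
proof (intro allI impI)
  fix X :: "int set" assume X: "finite X \<and> X \<subseteq> UNIV"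
  define N where "N = (\<Sum>x\<in>X. nat \<bar>x\<bar>)"
  have "\<bar>x\<bar> \<le> int N" if "x \<in> X" for x
  proof -
    have "nat \<bar>x\<bar> \<le> N" unfolding N_def using X that by (intro member_le_sum) auto
    then show ?thesis by simp
  qed
  then have "X \<subseteq> {- int n..int n}" if "n \<ge> N" for n using that by force
  then show "\<forall>\<^sub>F n in sequentially. finite {- int n..int n} \<and> X \<subseteq> {- int n..int n} \<and> {- int n..int n} \<subseteq> UNIV"
    unfolding eventually_sequentially by auto
qed

definition partial_sum :: "(real \<Rightarrow> complex) \<Rightarrow> nat \<Rightarrow> real \<Rightarrow> complex" where
  "partial_sum u N x = (\<Sum>m\<in>{- int N..int N}. l2_inner circle u (chi m) * chi m x)"

lemma partial_sum_L2: "partial_sum u N \<in> L2 circle"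
  unfolding partial_sum_def[abs_def] by (intro L2_sum L2_scale L2_chi)

lemma partial_sum_tendsto:
  assumes "u \<in> L2 circle"
  shows "(\<lambda>N. l2_norm circle (\<lambda>x. partial_sum u N x - u x)) \<longlonglongrightarrow> 0"
  unfolding partial_sum_def
  using filterlim_compose[OF orthonormal_expansion[OF l2_orthonormal_chi l2_total_chi assms] filterlim_int_intervals] .

lemma partial_sum_norm:
  assumes "u \<in> L2 circle"
  shows "l2_norm circle (partial_sum u N) \<le> l2_norm circle u"
proof (rule power2_le_imp_le)
  have "(l2_norm circle (partial_sum u N))\<^sup>2 = (\<Sum>m\<in>{- int N..int N}. (cmod (l2_inner circle u (chi m)))\<^sup>2)"
    unfolding partial_sum_def[abs_def] by (rule orthonormal_sum_norm[OF l2_orthonormal_chi]) auto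
  also have "\<dots> \<le> (l2_norm circle u)\<^sup>2" by (rule Bessel_finite[OF l2_orthonormal_chi _ _ assms]) auto
  finally show "(l2_norm circle (partial_sum u N))\<^sup>2 \<le> (l2_norm circle u)\<^sup>2" .
qed simp

text \<open>Riesz--Fischer provides a square integrable function with these coefficients, and
  uniqueness among integrable functions identifies it with f.\<close>

lemma L2_of_square_summable_coeffs:
  assumes f: "integrable circle f" and s: "(\<lambda>m. (cmod (LINT x|circle. f x * cnj (chi m x)))\<^sup>2) summable_on UNIV"
  shows "f \<in> L2 circle"
proof -
  obtain g where g: "g \<in> L2 circle" "\<And>m. l2_inner circle g (chi m) = (LINT x|circle. f x * cnj (chi m x))"
  proof (rule chi_Riesz_Fischer[OF s])
    fix g assume "g \<in> L2 circle" "\<And>m. m \<in> UNIV \<Longrightarrow> l2_inner circle g (chi m) = (LINT x|circle. f x * cnj (chi m x))"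
    then show thesis by (intro that) auto
  qed
  have "AE x in circle. g x = f x"
    using g(2) by (intro chi_uniqueness L2_circle_integrable g(1) f) (simp add: l2_inner_def)
  then show ?thesis by (rule L2_cong_AE[OF g(1) borel_measurable_integrable[OF f]])
qed

lemma L2_indicator_circle:
  assumes "E \<in> sets circle"
  shows "(indicator E :: real \<Rightarrow> complex) \<in> L2 circle"
    "(l2_norm circle (indicator E))\<^sup>2 = measure circle E"
proof -
  interpret finite_measure circle by (rule finite_measure_circle)
  have eq: "(\<lambda>x. (cmod (indicator E x))\<^sup>2) = (indicator E :: real \<Rightarrow> real)" by (auto simp: indicator_def)
  have "integrable circle (indicator E :: real \<Rightarrow> real)" by (intro integrable_real_indicator assms) (simp add: less_top[symmetric] emeasure_finite)
  then show "(indicator E :: real \<Rightarrow> complex) \<in> L2 circle" using assms unfolding L2_def mem_Collect_eq eq by simp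
  have "E \<inter> space circle = E" using sets.sets_into_space[OF assms] by blast
  then show "(l2_norm circle (indicator E :: real \<Rightarrow> complex))\<^sup>2 = measure circle E" unfolding l2_norm_sq eq by simp
qed

text \<open>The hypotheses say that multiplication by \<open>w\<close> satisfies \<open>A\<langle>w p, p\<rangle> \<le> \<parallel>w p\<parallel>\<^sup>2 \<le> B\<langle>w p, p\<rangle>\<close> for trigonometric polynomials \<open>p\<close>.\<close>

lemma weight_bounds:
  fixes w :: "real \<Rightarrow> real"
  assumes wi: "integrable circle w" and w0: "\<And>x. 0 \<le> w x" and A: "0 < A" and B: "0 < B"
    and L: "\<And>c N. (\<lambda>x. of_real (w x) * (\<Sum>m\<in>{- int N..int N}. c m * chi m x)) \<in> L2 circle"
    and lower: "\<And>c N. A * Re (l2_inner circle (\<lambda>x. of_real (w x) * (\<Sum>m\<in>{- int N..int N}. c m * chi m x)) (\<lambda>x. \<Sum>m\<in>{- int N..int N}. c m * chi m x))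
        \<le> (l2_norm circle (\<lambda>x. of_real (w x) * (\<Sum>m\<in>{- int N..int N}. c m * chi m x)))\<^sup>2"
    and upper: "\<And>c N. (l2_norm circle (\<lambda>x. of_real (w x) * (\<Sum>m\<in>{- int N..int N}. c m * chi m x)))\<^sup>2
        \<le> B * Re (l2_inner circle (\<lambda>x. of_real (w x) * (\<Sum>m\<in>{- int N..int N}. c m * chi m x)) (\<lambda>x. \<Sum>m\<in>{- int N..int N}. c m * chi m x))"
  shows "AE x in circle. w x \<le> B" "AE x in circle. w x = 0 \<or> A \<le> w x"
proof -
  have wm[measurable]: "w \<in> borel_measurable circle" using wi by (rule borel_measurable_integrable)
  let ?W = "\<lambda>u x. complex_of_real (w x) * u x"
  have WL: "?W (partial_sum u N) \<in> L2 circle" for u N unfolding partial_sum_def by (rule L)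
  \<comment> \<open>The upper hypothesis and Cauchy--Schwarz give ||w p||^2 \<le> B ||w p|| ||p||;
    one factor is cancelled.\<close>
  have Wn: "l2_norm circle (?W (partial_sum u N)) \<le> B * l2_norm circle (partial_sum u N)" for u N
  proof -
    let ?p = "partial_sum u N"
    have "(l2_norm circle (?W ?p))\<^sup>2 \<le> B * Re (l2_inner circle (?W ?p) ?p)"
      unfolding partial_sum_def by (rule upper)
    also have "\<dots> \<le> B * (l2_norm circle (?W ?p) * l2_norm circle ?p)"
      using l2_Cauchy_Schwarz[OF WL[of u N] partial_sum_L2[of u N]] complex_Re_le_cmod B by (intro mult_left_mono) (auto intro: order_trans)
    finally have le: "l2_norm circle (?W ?p) * l2_norm circle (?W ?p) \<le> l2_norm circle (?W ?p) * (B * l2_norm circle ?p)"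
      by (simp add: power2_eq_square mult_ac)
    show ?thesis
    proof (cases "l2_norm circle (?W ?p) = 0")
      case False
      then have "0 < l2_norm circle (?W ?p)" by (simp add: less_le)
      with le show ?thesis by (rule mult_left_le_imp_le)
    qed (use B in simp)
  qed
  \<comment> \<open>Extends boundedness to all u although w is not yet known to be bounded: partial
    sums converge almost everywhere along a subsequence, and Fatou keeps the norm bound.\<close>
  have Wu: "?W u \<in> L2 circle \<and> l2_norm circle (?W u) \<le> B * l2_norm circle u" if u: "u \<in> L2 circle" for u
  proof -
    obtain r :: "nat \<Rightarrow> nat" where r: "AE x in circle. (\<lambda>n. partial_sum u (r n) x) \<longlonglongrightarrow> u x"
      using l2_AE_subseq[OF partial_sum_L2 u partial_sum_tendsto[OF u]] by blast
    have lim: "AE x in circle. (\<lambda>n. ?W (partial_sum u (r n)) x) \<longlonglongrightarrow> ?W u x"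
      using r by eventually_elim (intro tendsto_intros)
    have b: "l2_norm circle (?W (partial_sum u (r n))) \<le> B * l2_norm circle u" for n
      using Wn[of u "r n"] partial_sum_norm[OF u, of "r n"] B by (meson less_imp_le mult_left_mono order_trans)
    have m: "?W u \<in> borel_measurable circle" using L2_measurable[OF u] by measurable
    show ?thesis using l2_Fatou[OF WL b m lim] by blast
  qed
  have Elow: "{x \<in> space circle. w x > B} \<in> sets circle" by measurable
  show "AE x in circle. w x \<le> B"
  proof -
    \<comment> \<open>On this set w^2 - B^2 is positive, while boundedness of the multiplication
      makes its integral there nonpositive; hence the set is null.\<close>
    let ?E = "{x \<in> space circle. w x > B}"
    let ?u = "indicator ?E :: real \<Rightarrow> complex"
    note u = L2_indicator_circle[OF Elow]
    have "(l2_norm circle (?W ?u))\<^sup>2 \<le> (B * l2_norm circle ?u)\<^sup>2"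
      using Wu[OF u(1)] by (intro power_mono) auto
    then have le: "(LINT x|circle. (cmod (?W ?u x))\<^sup>2) \<le> (LINT x|circle. B\<^sup>2 * (cmod (?u x))\<^sup>2)"
      unfolding l2_norm_sq power_mult_distrib by simp
    have i1: "integrable circle (\<lambda>x. (cmod (?W ?u x))\<^sup>2)" using Wu[OF u(1)] by (intro L2_integrable) auto
    have i2: "integrable circle (\<lambda>x. B\<^sup>2 * (cmod (?u x))\<^sup>2)" by (intro integrable_mult_right L2_integrable u)
    have nn: "0 \<le> (cmod (?W ?u x))\<^sup>2 - B\<^sup>2 * (cmod (?u x))\<^sup>2" for x
      using B by (auto simp: indicator_def norm_mult intro!: power_mono)
    have "(LINT x|circle. (cmod (?W ?u x))\<^sup>2 - B\<^sup>2 * (cmod (?u x))\<^sup>2) = 0"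
    proof (rule antisym)
      show "(LINT x|circle. (cmod (?W ?u x))\<^sup>2 - B\<^sup>2 * (cmod (?u x))\<^sup>2) \<le> 0" using le i1 i2 by simp
    qed (intro integral_nonneg_AE AE_I2 nn)
    then have "AE x in circle. (cmod (?W ?u x))\<^sup>2 - B\<^sup>2 * (cmod (?u x))\<^sup>2 = 0"
      using integral_nonneg_eq_0_iff_AE[OF Bochner_Integration.integrable_diff[OF i1 i2]] nn by simp
    then show ?thesis
      using AE_space
    proof eventually_elim
      case (elim x)
      show ?case
      proof (rule ccontr)
        assume "\<not> w x \<le> B"
        then have "(w x)\<^sup>2 = B\<^sup>2" using elim w0[of x] by (auto simp: indicator_def norm_mult power_mult_distrib)
        then show False using \<open>\<not> w x \<le> B\<close> w0[of x] B by (simp add: power2_eq_iff)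
      qed
    qed
  qed
  \<comment> \<open>Once multiplication by w is continuous on L2, the lower hypothesis passes from
    partial sums to every u, in particular to indicators.\<close>
  have lim2: "A * Re (l2_inner circle (?W u) u) \<le> (l2_norm circle (?W u))\<^sup>2" if u: "u \<in> L2 circle" for u
  proof -
    have t: "(\<lambda>N. l2_norm circle (\<lambda>x. ?W (partial_sum u N) x - ?W u x)) \<longlonglongrightarrow> 0"
    proof (rule Lim_null_comparison)
      have "l2_norm circle (\<lambda>x. ?W (partial_sum u N) x - ?W u x) \<le> B * l2_norm circle (\<lambda>x. partial_sum u N x - u x)" for N
        using Wu[OF L2_diff[OF partial_sum_L2[of u N] u]] by (simp add: right_diff_distrib)
      then show "\<forall>\<^sub>F N in sequentially. norm (l2_norm circle (\<lambda>x. ?W (partial_sum u N) x - ?W u x)) \<le> B * l2_norm circle (\<lambda>x. partial_sum u N x - u x)"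
        by (simp add: always_eventually)
      show "(\<lambda>N. B * l2_norm circle (\<lambda>x. partial_sum u N x - u x)) \<longlonglongrightarrow> 0"
        using tendsto_mult_left[OF partial_sum_tendsto[OF u], of B] by simp
    qed
    have WuL: "?W u \<in> L2 circle" using Wu[OF u] by blast
    have "(\<lambda>N. A * Re (l2_inner circle (?W (partial_sum u N)) (partial_sum u N))) \<longlonglongrightarrow> A * Re (l2_inner circle (?W u) u)"
      by (intro tendsto_mult tendsto_const tendsto_Re tendsto_l2_inner2[OF t partial_sum_tendsto[OF u]] WL WuL partial_sum_L2 u)
    moreover have "(\<lambda>N. (l2_norm circle (?W (partial_sum u N)))\<^sup>2) \<longlonglongrightarrow> (l2_norm circle (?W u))\<^sup>2"
      by (intro tendsto_power tendsto_l2_norm[OF t] always_eventually allI WL WuL)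
    ultimately show ?thesis
      by (rule LIMSEQ_le) (simp only: partial_sum_def[abs_def] lower simp_thms)
  qed
  have Eup: "{x \<in> space circle. 0 < w x \<and> w x < A} \<in> sets circle" by measurable
  show "AE x in circle. w x = 0 \<or> A \<le> w x"
  proof -
    \<comment> \<open>On this set A w - w^2 is positive, while the lower inequality for its
      indicator makes the integral nonpositive.\<close>
    let ?E = "{x \<in> space circle. 0 < w x \<and> w x < A}"
    let ?u = "indicator ?E :: real \<Rightarrow> complex"
    note u = L2_indicator_circle[OF Eup]
    have WuL: "?W ?u \<in> L2 circle" using Wu[OF u(1)] by blast
    have i1: "integrable circle (\<lambda>x. (cmod (?W ?u x))\<^sup>2)" by (intro L2_integrable WuL)
    have eq: "?W ?u x * cnj (?u x) = complex_of_real (w x * indicator ?E x)" for x by (simp add: indicator_def)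
    have i2: "integrable circle (\<lambda>x. w x * indicator ?E x)"
      using L2_inner_integrable[OF WuL u(1)] unfolding eq by (simp only: complex_of_real_integrable_eq)
    have "Re (l2_inner circle (?W ?u) ?u) = (LINT x|circle. w x * indicator ?E x)"
      unfolding l2_inner_def eq integral_complex_of_real by simp
    then have le: "A * (LINT x|circle. w x * indicator ?E x) \<le> (LINT x|circle. (cmod (?W ?u x))\<^sup>2)"
      using lim2[OF u(1)] by (simp only: l2_norm_sq)
    have i3: "integrable circle (\<lambda>x. A * (w x * indicator ?E x))" by (intro integrable_mult_right i2)
    have nn: "0 \<le> A * (w x * indicator ?E x) - (cmod (?W ?u x))\<^sup>2" for x
      by (auto simp: indicator_def norm_mult power2_eq_square mult_right_mono)
    have "(LINT x|circle. A * (w x * indicator ?E x) - (cmod (?W ?u x))\<^sup>2) = 0"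
    proof (rule antisym)
      show "(LINT x|circle. A * (w x * indicator ?E x) - (cmod (?W ?u x))\<^sup>2) \<le> 0"
        using le by (simp only: Bochner_Integration.integral_diff[OF i3 i1] integral_mult_right_zero diff_le_0_iff_le)
    qed (intro integral_nonneg_AE AE_I2 nn)
    then have "AE x in circle. A * (w x * indicator ?E x) - (cmod (?W ?u x))\<^sup>2 = 0"
      using integral_nonneg_eq_0_iff_AE[OF Bochner_Integration.integrable_diff[OF i3 i1]] nn by simp
    then show ?thesis
      using AE_space
    proof eventually_elim
      case (elim x)
      show ?case
      proof (rule ccontr)
        assume *: "\<not> (w x = 0 \<or> A \<le> w x)"
        then have "A * w x = (w x)\<^sup>2" using elim w0[of x] by (auto simp: indicator_def norm_mult power_mult_distrib)
        then show False using * by (simp add: power2_eq_square)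
      qed
    qed
  qed
qed

section \<open>Lattice translates\<close>

lemma countable_int_vec_pairs: "countable (UNIV :: ((int^'n::finite) \<times> (int^'n)) set)"
proof -
  have "countable (UNIV :: ('n \<Rightarrow> int) set)"
    using countable_PiE[of "UNIV :: 'n set" "\<lambda>_. UNIV :: int set"] by (simp add: PiE_UNIV_domain)
  then have "countable (range (vec_lambda :: ('n \<Rightarrow> int) \<Rightarrow> int^'n))" by (rule countable_image)
  moreover have "range (vec_lambda :: ('n \<Rightarrow> int) \<Rightarrow> int^'n) = UNIV" by (metis surjI vec_lambda_eta)
  ultimately have "countable (UNIV :: (int^'n) set)" by simp
  then show ?thesis using countable_SIGMA[of "UNIV :: (int^'n) set" "\<lambda>_. UNIV :: (int^'n) set"] by (simp add: UNIV_Times_UNIV)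
qed

lemma infinite_int_vec_pairs: "infinite (UNIV :: ((int^'n::finite) \<times> (int^'n)) set)"
proof
  assume "finite (UNIV :: ((int^'n) \<times> (int^'n)) set)"
  moreover have "inj (\<lambda>m::int. ((\<chi> i. m) :: int^'n, 0 :: int^'n))" by (auto simp: inj_on_def vec_eq_iff)
  ultimately have "finite (UNIV :: int set)" by (meson finite_imageD finite_subset subset_UNIV)
  then show False by (simp add: infinite_UNIV_int)
qed

text \<open>The factor 2 in the first component cancels the 1/2 of the group law, so the central
  term of a product is an integer and lattice translations compose to lattice translations.\<close>

lemma ltrans_ltrans:
  "ltrans (lattice_pt (k, l, m)) (ltrans (lattice_pt (k', l', m')) f) =
   ltrans (lattice_pt (k + k', l + l', m + m' + (\<Sum>i\<in>UNIV. k' $ i * l $ i - l' $ i * k $ i))) f"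
proof
  fix p :: "'a heis"
  obtain x y t where p: "p = (x, y, t)" by (cases p)
  let ?K = "\<lambda>k :: int^'a. (\<chi> i. 2 * of_int (k $ i)) :: real^'a" and ?L = "\<lambda>l :: int^'a. (\<chi> i. of_int (l $ i)) :: real^'a"
  have add: "?K (k + k') = ?K k + ?K k'" "?L (l + l') = ?L l + ?L l'"
    by (simp_all add: vec_eq_iff)
  have s: "real_of_int (\<Sum>i\<in>UNIV. k' $ i * l $ i - l' $ i * k $ i) = (1/2) * (?L l \<bullet> ?K k' - ?K k \<bullet> ?L l')"
    by (simp add: inner_vec_def sum_subtractf sum_distrib_left right_diff_distrib mult_ac)
  show "ltrans (lattice_pt (k, l, m)) (ltrans (lattice_pt (k', l', m')) f) p =
   ltrans (lattice_pt (k + k', l + l', m + m' + (\<Sum>i\<in>UNIV. k' $ i * l $ i - l' $ i * k $ i))) f p"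
    unfolding p ltrans_lattice_pt add of_int_add s
    by (simp add: inner_simps algebra_simps)
qed

lemma ltrans_central: 
  "ltrans (lattice_pt (0, 0, n)) (ltrans (lattice_pt (k, l, m)) f) = ltrans (lattice_pt (k, l, n + m)) f"
  "ltrans (lattice_pt (k, l, m)) (ltrans (lattice_pt (0, 0, n)) f) = ltrans (lattice_pt (k, l, m + n)) f"
  by (simp_all only: ltrans_ltrans) simp_all

lemma l2_inner_ltrans_same:
  assumes "f \<in> L2 lborel" "h \<in> L2 lborel"
  shows "l2_inner lborel (ltrans (lattice_pt (k, l, m)) f) (ltrans (lattice_pt (k, l, m')) h) = l2_inner lborel f (ltrans (lattice_pt (0, 0, m' - m)) h)"
proof -
  have "ltrans (lattice_pt (k, l, m')) h = ltrans (lattice_pt (k, l, m)) (ltrans (lattice_pt (0, 0, m' - m)) h)"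
    by (simp add: ltrans_central del: lattice_pt.simps)
  then show ?thesis using assms by (simp only: l2_inner_ltrans L2_ltrans)
qed

lemma l2_inner_ltrans_different:
  assumes "f \<in> L2 lborel" "condition_C f" "(k, l) \<noteq> (k', l')"
  shows "l2_inner lborel (ltrans (lattice_pt (k, l, m)) f) (ltrans (lattice_pt (k', l', m')) f) = 0"
proof -
  \<comment> \<open>Composing with the quotient translation shifts the centre by this integer, which
    is therefore subtracted in advance.\<close>
  let ?s = "\<Sum>i\<in>UNIV. (k' - k) $ i * l $ i - (l' - l) $ i * k $ i"
  have "ltrans (lattice_pt (k', l', m')) f = ltrans (lattice_pt (k, l, m)) (ltrans (lattice_pt (k' - k, l' - l, m' - m - ?s)) f)"
    unfolding ltrans_ltrans by simp
  moreover have "(k' - k, l' - l) \<noteq> (0, 0)" using assms(3) by auto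
  ultimately show ?thesis
    using assms condition_C_orthogonal[OF assms(1,2)] by (simp only: l2_inner_ltrans L2_ltrans simp_thms)
qed

section \<open>Finite combinations of central translates and the frame inequality\<close>

lemma integrable_mult_chi:
  assumes "integrable circle f"
  shows "integrable circle (\<lambda>x. f x * chi m x)" "integrable circle (\<lambda>x. f x * cnj (chi m x))"
proof -
  have [measurable]: "f \<in> borel_measurable circle" "chi m \<in> borel_measurable circle" using assms L2_measurable[OF L2_chi] by auto
  show "integrable circle (\<lambda>x. f x * chi m x)"
    by (rule Bochner_Integration.integrable_bound[OF assms]) (auto simp: norm_mult char_fun_simps(3))
  show "integrable circle (\<lambda>x. f x * cnj (chi m x))"
    by (rule Bochner_Integration.integrable_bound[OF assms]) (auto simp: norm_mult char_fun_simps(3))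
qed

lemma chi_diff: "cnj (chi (m' - m) x) = chi m x * cnj (chi m' x)"
  using char_fun_add(2)[of "of_int m" "- of_int m'" x] by (simp add: char_fun_simps(4))

text \<open>Dictionary between a finite combination f and its trigonometric polynomial p: pairing f
  with translates gives Fourier coefficients of w p, and the norm of f is the weighted norm of p. At
  this stage w p is only known to be integrable.\<close>

lemma central_combination:
  fixes \<eta> :: "'n::finite heis \<Rightarrow> complex" and w :: "real \<Rightarrow> real" and c :: "int \<Rightarrow> complex"
  assumes \<eta>: "\<eta> \<in> L2 lborel" and w: "integrable circle w"
    and coeff: "\<And>m. l2_inner lborel \<eta> (ltrans (lattice_pt (0, 0, m)) \<eta>) = (LINT x|circle. of_real (w x) * cnj (chi m x))"
    and S: "finite S"
  defines "f \<equiv> \<lambda>q. \<Sum>m\<in>S. c m * ltrans (lattice_pt (0, 0, m)) \<eta> q" and "p \<equiv> \<lambda>x. \<Sum>m\<in>S. c m * chi m x"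
  shows "f \<in> L2 lborel" "integrable circle (\<lambda>x. of_real (w x) * p x)"
    "l2_inner lborel f (ltrans (lattice_pt (0, 0, m')) \<eta>) = (LINT x|circle. of_real (w x) * p x * cnj (chi m' x))"
    "of_real ((l2_norm lborel f)\<^sup>2) = l2_inner circle (\<lambda>x. of_real (w x) * p x) p"
proof -
  have wi: "integrable circle (\<lambda>x. complex_of_real (w x))" using w by simp
  show f: "f \<in> L2 lborel" unfolding f_def by (intro L2_sum L2_scale L2_ltrans \<eta>)
  have wp: "of_real (w x) * p x = (\<Sum>m\<in>S. c m * (of_real (w x) * chi m x))" for x
    by (simp add: p_def sum_distrib_left mult_ac)
  show wpi: "integrable circle (\<lambda>x. of_real (w x) * p x)"
    unfolding wp by (intro Bochner_Integration.integrable_sum integrable_mult_right integrable_mult_chi wi)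
  show co: "l2_inner lborel f (ltrans (lattice_pt (0, 0, m')) \<eta>) = (LINT x|circle. of_real (w x) * p x * cnj (chi m' x))" for m'
  proof -
    have "l2_inner lborel f (ltrans (lattice_pt (0, 0, m')) \<eta>) = (\<Sum>m\<in>S. c m * l2_inner lborel \<eta> (ltrans (lattice_pt (0, 0, m' - m)) \<eta>))"
      unfolding f_def using \<eta>
      by (subst l2_inner_sum_left) (auto intro: L2_scale L2_ltrans simp: l2_inner_scale_left l2_inner_ltrans_same simp del: lattice_pt.simps)
    also have "\<dots> = (\<Sum>m\<in>S. c m * (LINT x|circle. of_real (w x) * chi m x * cnj (chi m' x)))"
      unfolding coeff chi_diff by (simp add: mult.assoc)
    also have "\<dots> = (LINT x|circle. (\<Sum>m\<in>S. c m * (of_real (w x) * chi m x * cnj (chi m' x))))"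
      by (subst Bochner_Integration.integral_sum) (auto intro!: integrable_mult_right integrable_mult_chi wi)
    also have "\<dots> = (LINT x|circle. of_real (w x) * p x * cnj (chi m' x))"
      unfolding wp by (simp add: sum_distrib_right mult.assoc)
    finally show ?thesis .
  qed
  have "of_real ((l2_norm lborel f)\<^sup>2) = l2_inner lborel f f" by (rule l2_inner_self[symmetric])
  also have "\<dots> = (\<Sum>m\<in>S. cnj (c m) * l2_inner lborel f (ltrans (lattice_pt (0, 0, m)) \<eta>))"
    by (subst (2) f_def, subst l2_inner_sum_right) (auto intro: L2_scale L2_ltrans \<eta> f simp: l2_inner_scale_right simp del: lattice_pt.simps)
  also have "\<dots> = (LINT x|circle. (\<Sum>m\<in>S. cnj (c m) * (of_real (w x) * p x * cnj (chi m x))))"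
    unfolding co by (subst Bochner_Integration.integral_sum) (auto intro!: integrable_mult_right integrable_mult_chi wpi)
  also have "\<dots> = l2_inner circle (\<lambda>x. of_real (w x) * p x) p"
  proof -
    have cp: "cnj (p x) = (\<Sum>m\<in>S. cnj (c m) * cnj (chi m x))" for x by (simp add: p_def cnj_sum)
    show ?thesis unfolding l2_inner_def cp by (simp add: sum_distrib_left mult_ac)
  qed
  finally show "of_real ((l2_norm lborel f)\<^sup>2) = l2_inner circle (\<lambda>x. of_real (w x) * p x) p" .
qed

lemma subspace_sum:
  assumes V: "l2_closed_subspace M V" and f: "\<And>i. i \<in> S \<Longrightarrow> f i \<in> V"
  shows "(\<lambda>x. \<Sum>i\<in>S. c i * f i x) \<in> V"
  using f
proof (induction S rule: infinite_finite_induct)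
  case (insert i S)
  have "(\<lambda>x. c i * f i x) \<in> V" "(\<lambda>x. \<Sum>i\<in>S. c i * f i x) \<in> V"
    using V insert unfolding l2_closed_subspace_def by auto
  moreover have add: "\<forall>f\<in>V. \<forall>g\<in>V. (\<lambda>x. f x + g x) \<in> V"
    using V unfolding l2_closed_subspace_def by simp
  ultimately have "(\<lambda>x. c i * f i x + (\<Sum>i\<in>S. c i * f i x)) \<in> V"
    using bspec[OF bspec[OF add]] by fast
  then show ?case using insert by simp
qed (use V in \<open>auto simp: l2_closed_subspace_def\<close>)

lemma infsum_ennreal_finiteD:
  fixes f :: "'i \<Rightarrow> real"
  assumes "(\<Sum>\<^sub>\<infinity>m. ennreal (f m)) < \<infinity>" "\<And>m. 0 \<le> f m"
  shows "f summable_on UNIV" "(\<Sum>\<^sub>\<infinity>m. ennreal (f m)) = ennreal (infsum f UNIV)"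
proof -
  obtain C where C: "(\<Sum>\<^sub>\<infinity>m. ennreal (f m)) = ennreal C" "0 \<le> C"
    using assms(1) by (cases "\<Sum>\<^sub>\<infinity>m. ennreal (f m)") auto
  have le: "sum f X \<le> C" if "finite X" for X
  proof -
    have "(\<Sum>m\<in>X. ennreal (f m)) \<le> (\<Sum>\<^sub>\<infinity>m. ennreal (f m))"
      using that by (subst nonneg_infsum_complete) (auto intro: SUP_upper)
    then show ?thesis using C assms(2) by (simp add: sum_ennreal)
  qed
  show s: "f summable_on UNIV"
    by (rule nonneg_bdd_above_summable_on) (auto intro!: bdd_aboveI[where M=C] le assms)
  have "infsum f UNIV \<le> C" by (rule infsum_le_finite_sums[OF s]) (use le in auto)
  then have "ennreal C \<ge> ennreal (infsum f UNIV)" by (rule ennreal_leI)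
  moreover have "(\<Sum>\<^sub>\<infinity>m. ennreal (f m)) \<le> ennreal (infsum f UNIV)"
    by (rule infsum_ennreal_le[OF s assms(2)]) simp
  ultimately show "(\<Sum>\<^sub>\<infinity>m. ennreal (f m)) = ennreal (infsum f UNIV)" unfolding C(1) by (rule antisym[rotated])
qed

text \<open>The frame inequality is tested on finite combinations of central translates. Condition C
  removes every term with (k, l) nonzero from the frame sum, and what is left is the norm of w
  p.\<close>

lemma frame_weight:
  fixes \<eta> :: "'n::finite heis \<Rightarrow> complex"
  assumes V: "l2_closed_subspace lborel V" and \<eta>: "\<eta> \<in> L2 lborel" and C: "condition_C \<eta>"
    and frame: "l2_frame lborel V (\<lambda>j. ltrans (lattice_pt j) \<eta>)"
  obtains w :: "real \<Rightarrow> real" and A B where "0 < A" "0 < B" "integrable circle w" "\<And>x. 0 \<le> w x" "\<And>x. w x \<le> B"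
    "AE x in circle. Re (G \<eta> 0 0 x) = w x" "AE x in circle. w x = 0 \<or> A \<le> w x"
    "\<And>m. l2_inner lborel \<eta> (ltrans (lattice_pt (0, 0, m)) \<eta>) = (LINT x|circle. of_real (w x) * cnj (chi m x))"
proof -
  obtain w :: "real \<Rightarrow> real" where w: "integrable circle w" "\<And>x. 0 \<le> w x" "AE x in circle. Re (G \<eta> 0 0 x) = w x"
    and coeff: "\<And>m. (LINT x|circle. of_real (w x) * cnj (chi m x)) = l2_inner lborel \<eta> (ltrans (lattice_pt (0, 0, m)) \<eta>)"
    by (rule G_00_weight[OF \<eta>, unfolded unit_box_real]) (rule that)
  obtain A B where AB: "0 < A" "0 < B" and fr: "\<And>f. f \<in> V \<Longrightarrow>
        ennreal (A * (l2_norm lborel f)\<^sup>2) \<le> (\<Sum>\<^sub>\<infinity>j. ennreal ((cmod (l2_inner lborel f (ltrans (lattice_pt j) \<eta>)))\<^sup>2)) \<and>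
        (\<Sum>\<^sub>\<infinity>j. ennreal ((cmod (l2_inner lborel f (ltrans (lattice_pt j) \<eta>)))\<^sup>2)) \<le> ennreal (B * (l2_norm lborel f)\<^sup>2)"
    and inV: "\<And>j. ltrans (lattice_pt j) \<eta> \<in> V"
    using frame unfolding l2_frame_def by blast
  have main: "(\<lambda>x. of_real (w x) * p x) \<in> L2 circle \<and>
      A * Re (l2_inner circle (\<lambda>x. of_real (w x) * p x) p) \<le> (l2_norm circle (\<lambda>x. of_real (w x) * p x))\<^sup>2 \<and>
      (l2_norm circle (\<lambda>x. of_real (w x) * p x))\<^sup>2 \<le> B * Re (l2_inner circle (\<lambda>x. of_real (w x) * p x) p)"
    if p: "p = (\<lambda>x. \<Sum>m\<in>{- int N..int N}. c m * chi m x)" for p c N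
  proof -
    let ?S = "{- int N..int N}"
    define f where "f q = (\<Sum>m\<in>?S. c m * ltrans (lattice_pt (0, 0, m)) \<eta> q)" for q
    have px: "p x = (\<Sum>m\<in>?S. c m * chi m x)" for x by (simp add: p)
    note cc = central_combination[OF \<eta> w(1) coeff[symmetric], of ?S c, folded f_def[abs_def] px, OF finite_atLeastAtMost_int]
    let ?g = "\<lambda>x. of_real (w x) * p x"
    have fV: "f \<in> V" unfolding f_def[abs_def] by (intro subspace_sum[OF V] inV)
    have nf: "(l2_norm lborel f)\<^sup>2 = Re (l2_inner circle ?g p)" using arg_cong[OF cc(4), of Re] by simp
    have zero: "l2_inner lborel f (ltrans (lattice_pt (k, l, m')) \<eta>) = 0" if "(k, l) \<noteq> (0, 0)" for k l m'
      unfolding f_def[abs_def] using \<eta> C that[symmetric]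
      by (subst l2_inner_sum_left) (auto intro!: L2_scale L2_ltrans sum.neutral simp: l2_inner_scale_left l2_inner_ltrans_different simp del: lattice_pt.simps)
    have inj: "inj (\<lambda>m::int. (0::int^'n, 0::int^'n, m))" by (auto simp: inj_on_def)
    have "(\<Sum>\<^sub>\<infinity>j. ennreal ((cmod (l2_inner lborel f (ltrans (lattice_pt j) \<eta>)))\<^sup>2))
      = (\<Sum>\<^sub>\<infinity>j\<in>range (\<lambda>m::int. (0::int^'n, 0::int^'n, m)). ennreal ((cmod (l2_inner lborel f (ltrans (lattice_pt j) \<eta>)))\<^sup>2))"
    proof (rule infsum_cong_neutral)
      fix j assume j: "j \<in> UNIV - range (\<lambda>m::int. (0::int^'n, 0::int^'n, m))"
      obtain k l m where [simp]: "j = (k, l, m)" by (cases j)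
      from j have "(k, l) \<noteq> (0, 0)" by auto
      from zero[OF this] show "ennreal ((cmod (l2_inner lborel f (ltrans (lattice_pt j) \<eta>)))\<^sup>2) = 0" by (simp del: lattice_pt.simps)
    qed auto
    also have "\<dots> = (\<Sum>\<^sub>\<infinity>m. ennreal ((cmod (LINT x|circle. ?g x * cnj (chi m x)))\<^sup>2))"
      unfolding infsum_reindex[OF inj] o_def cc(3) ..
    finally have eq: "(\<Sum>\<^sub>\<infinity>j. ennreal ((cmod (l2_inner lborel f (ltrans (lattice_pt j) \<eta>)))\<^sup>2)) = (\<Sum>\<^sub>\<infinity>m. ennreal ((cmod (LINT x|circle. ?g x * cnj (chi m x)))\<^sup>2))" .
    have fin: "(\<Sum>\<^sub>\<infinity>m. ennreal ((cmod (LINT x|circle. ?g x * cnj (chi m x)))\<^sup>2)) < \<infinity>"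
      using fr[OF fV] unfolding eq by (auto intro: order_le_less_trans)
    note fd = infsum_ennreal_finiteD[OF fin zero_le_power2]
    \<comment> \<open>Finiteness of the frame sum makes the coefficients of the integrable function
      w p square summable, which puts it in L2.\<close>
    have gL: "?g \<in> L2 circle" by (rule L2_of_square_summable_coeffs[OF cc(2) fd(1)])
    have "(\<Sum>\<^sub>\<infinity>m. (cmod (LINT x|circle. ?g x * cnj (chi m x)))\<^sup>2) = (l2_norm circle ?g)\<^sup>2"
      using chi_Parseval_norm[OF gL] unfolding l2_inner_def by (rule infsumI)
    then have "ennreal (A * (l2_norm lborel f)\<^sup>2) \<le> ennreal ((l2_norm circle ?g)\<^sup>2)" "ennreal ((l2_norm circle ?g)\<^sup>2) \<le> ennreal (B * (l2_norm lborel f)\<^sup>2)"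
      using fr[OF fV] unfolding eq fd(2) by auto
    then have "A * (l2_norm lborel f)\<^sup>2 \<le> (l2_norm circle ?g)\<^sup>2" "(l2_norm circle ?g)\<^sup>2 \<le> B * (l2_norm lborel f)\<^sup>2"
      using AB by simp_all
    with gL show ?thesis unfolding nf by blast
  qed
  note wb = weight_bounds[OF w(1,2) AB main[OF refl, THEN conjunct1] main[OF refl, THEN conjunct2, THEN conjunct1] main[OF refl, THEN conjunct2, THEN conjunct2]]
  \<comment> \<open>Capping changes w on a null set only and makes the upper bound hold at every
    point.\<close>
  let ?w = "\<lambda>x. min (w x) B"
  have wm[measurable]: "w \<in> borel_measurable circle" using w(1) by (rule borel_measurable_integrable)
  have eq: "AE x in circle. w x = ?w x" using wb(1) by eventually_elim auto
  show thesis
  proof (rule that[of A B ?w])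
    show "integrable circle ?w" using w(1) by (rule integrable_cong_AE_imp) (use eq in auto)
    show "AE x in circle. Re (G \<eta> 0 0 x) = ?w x" using w(3) eq by eventually_elim simp
    show "AE x in circle. ?w x = 0 \<or> A \<le> ?w x" using wb(2) eq by eventually_elim simp
    show "l2_inner lborel \<eta> (ltrans (lattice_pt (0, 0, m)) \<eta>) = (LINT x|circle. of_real (?w x) * cnj (chi m x))" for m
    proof -
      have [measurable]: "chi m \<in> borel_measurable circle" by (rule L2_measurable[OF L2_chi])
      show ?thesis
        unfolding coeff[symmetric] using eq by (intro integral_cong_AE) (measurable, auto elim!: AE_mp)
    qed
  qed (use AB w(2) in auto)
qed

lemma continuous_AE_zero:
  fixes g :: "'a::euclidean_space \<Rightarrow> complex"
  assumes g: "continuous_on UNIV g" and z: "AE x in lborel. g x = 0"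
  shows "g x = 0"
proof -
  have "open {x. g x \<noteq> 0}"
    using open_vimage[OF open_delete[OF open_UNIV] g, of 0] by (simp add: vimage_def)
  moreover have "{x. g x \<noteq> 0} \<in> null_sets lborel"
    using z calculation by (subst (asm) AE_iff_null) auto
  then have "negligible {x. g x \<noteq> 0}"
    by (simp add: negligible_iff_null_sets null_sets_completionI)
  ultimately have "{x. g x \<noteq> 0} = {}" using open_not_negligible by blast
  then show ?thesis by blast
qed

text \<open>Almost every real has an integer translate in the open unit interval, and countably many
  translates of an exceptional set are still null.\<close>

lemma AE_periodic:
  assumes AE: "AE x in circle. R x" and per: "\<And>x. R (x + 1) \<longleftrightarrow> R (x :: real)"
  shows "AE x in lborel. R x"
proof -
  have nat: "R (x + real n) \<longleftrightarrow> R x" for x n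
  proof (induction n)
    case (Suc n)
    have "R (x + real (Suc n)) \<longleftrightarrow> R (x + real n + 1)" by (simp add: add_ac)
    then show ?case using per[of "x + real n"] Suc by simp
  qed simp
  have int: "R (x + of_int r) \<longleftrightarrow> R x" for x r
    using nat[of x "nat r"] nat[of "x + of_int r" "nat (- r)"] by (cases "0 \<le> r") auto
  have "AE x in lborel. x \<in> {0<..<1} \<longrightarrow> R x" using AE by (subst (asm) AE_restrict_space_iff) auto
  from AE_all_int_translates[OF this] AE_unique_unit_box_translate[where 'a=real]
  show ?thesis
  proof eventually_elim
    case (elim x)
    then obtain v where v: "v \<in> int_vecs" "x + v \<in> unit_box" by blast
    then obtain r where r: "v = of_int r" by (auto simp: int_vecs_real elim: Ints_cases)
    have "R (x + of_int r)" using elim(1)[rule_format, of r] v(2) unfolding r unit_box_real .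
    then show ?case using int by blast
  qed
qed

section \<open>Fourier series of the samples\<close>

lemma infsum_ennreal_suminf:
  fixes f :: "nat \<Rightarrow> ennreal"
  shows "infsum f UNIV = (\<Sum>n. f n)"
proof -
  have "(f has_sum infsum f UNIV) UNIV" by (intro has_sum_infsum nonneg_summable_on_complete) simp
  then show ?thesis using has_sum_imp_sums sums_unique by blast
qed

lemma chi_exp: "exp (2 * of_real pi * \<i> * of_int m * of_real x) = chi m x"
  by (simp add: char_fun_def cis_conv_exp mult_ac)

lemma fourier_series_sum_exists:
  assumes "(\<lambda>m. (cmod (a m))\<^sup>2) summable_on UNIV"
  obtains P where "fourier_series_sum a P" "P \<in> L2 circle" "\<And>m. l2_inner circle P (chi m) = a m"
proof -
  obtain Q where Q: "Q \<in> L2 circle" "((\<lambda>J. l2_norm circle (\<lambda>x. (\<Sum>m\<in>J. a m * chi m x) - Q x)) \<longlongrightarrow> 0) (finite_subsets_at_top UNIV)"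
    "\<And>m. m \<in> UNIV \<Longrightarrow> l2_inner circle Q (chi m) = a m"
    by (rule chi_Riesz_Fischer[OF assms]) (rule that)
  \<comment> \<open>\<open>fourier_series_sum\<close> asks for periodicity at every point; composing
    with \<open>frac\<close> provides it and changes nothing on the open interval.\<close>
  define P where "P x = Q (frac x)" for x
  have eq: "P x = Q x" if "x \<in> space circle" for x
  proof -
    have "frac x = x" using that by (subst frac_eq) (auto simp: space_restrict_space)
    then show ?thesis by (simp add: P_def)
  qed
  have PL: "P \<in> L2 circle"
  proof -
    have "P \<in> borel_measurable circle \<longleftrightarrow> Q \<in> borel_measurable circle" by (rule measurable_cong) (rule eq)
    moreover have "integrable circle (\<lambda>x. (cmod (P x))\<^sup>2) \<longleftrightarrow> integrable circle (\<lambda>x. (cmod (Q x))\<^sup>2)"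
      by (rule Bochner_Integration.integrable_cong) (simp_all only: eq)
    ultimately show ?thesis using Q(1) unfolding L2_def mem_Collect_eq by simp
  qed
  have Pin: "l2_inner circle P (chi m) = a m" for m
  proof -
    have "l2_inner circle P (chi m) = l2_inner circle Q (chi m)"
      unfolding l2_inner_def by (rule Bochner_Integration.integral_cong) (simp_all only: eq)
    then show ?thesis using Q(3)[of m] by simp
  qed
  have "l2_norm circle (\<lambda>x. P x - (\<Sum>m\<in>J. a m * chi m x)) = l2_norm circle (\<lambda>x. (\<Sum>m\<in>J. a m * chi m x) - Q x)" for J
    unfolding l2_norm_minus_commute[of circle P] unfolding l2_norm_def
    by (rule arg_cong[where f=sqrt], rule Bochner_Integration.integral_cong) (simp_all only: eq)
  then have "fourier_series_sum a P"
    unfolding fourier_series_sum_def l2_has_sum_def chi_exp using PL Q(2) by (simp add: P_def frac_1_eq)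
  then show thesis using PL Pin by (rule that)
qed

declare lattice_pt.simps [simp del]

text \<open>A series of central translates, evaluated at lattice points, is thus a convolution of
  its coefficients with the samples, which corresponds to a product of Fourier series.\<close>

lemma ltrans_central_lattice_pt:
  "ltrans (lattice_pt (0, 0, m)) \<phi> (lattice_pt (k, l, m')) = \<phi> (lattice_pt (k, l, m' - m))"
  unfolding lattice_pt.simps ltrans_def by (simp add: zero_vec_def[symmetric])

lemma weight_mult_L2:
  assumes [measurable]: "w \<in> borel_measurable circle" and w: "\<And>x. 0 \<le> w x" "\<And>x. w x \<le> B" and u: "u \<in> L2 circle"
  shows "(\<lambda>x. complex_of_real (w x) * u x) \<in> L2 circle"
  by (rule L2_bounded_mult[OF u, of _ B]) (use w in auto)

text \<open>Let u be the indicator of the zero set of w. The Fourier coefficients of u P are the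
  values of the limit function g at the lattice points over (k, l), so it is enough to see that g is
  zero.\<close>

lemma Fourier_series_vanishes:
  fixes \<phi> :: "'n::finite heis \<Rightarrow> complex" and w :: "real \<Rightarrow> real"
  assumes \<phi>: "\<phi> \<in> L2 lborel" and w: "integrable circle w" "\<And>x. 0 \<le> w x" "\<And>x. w x \<le> B"
    and coeff: "\<And>m. l2_inner lborel \<phi> (ltrans (lattice_pt (0, 0, m)) \<phi>) = (LINT x|circle. of_real (w x) * cnj (chi m x))"
    and conv: "\<And>c :: int \<Rightarrow> complex. (\<lambda>m. (cmod (c m))\<^sup>2) summable_on UNIV \<Longrightarrow>
           \<exists>g. continuous_on UNIV g \<and> (\<forall>p. ((\<lambda>m. c m * ltrans (lattice_pt (0, 0, m)) \<phi> p) has_sum g p) UNIV)"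
    and P: "P \<in> L2 circle" "\<And>m. l2_inner circle P (chi m) = \<phi> (lattice_pt (k, l, m))"
  shows "AE x in circle. w x = 0 \<longrightarrow> P x = 0"
proof -
  have wm[measurable]: "w \<in> borel_measurable circle" using w(1) by (rule borel_measurable_integrable)
  let ?E = "{x \<in> space circle. w x = 0}"
  define u :: "real \<Rightarrow> complex" where "u = indicator ?E"
  have E: "?E \<in> sets circle" by measurable
  have u: "u \<in> L2 circle" unfolding u_def by (rule L2_indicator_circle(1)[OF E])
  define c where "c m = l2_inner circle u (chi m)" for m
  have "(\<lambda>m. (cmod (c m))\<^sup>2) summable_on UNIV" unfolding c_def by (rule Bessel_summable[OF l2_orthonormal_chi u])
  from conv[OF this] obtain g where g: "continuous_on UNIV g" "\<And>p. ((\<lambda>m. c m * ltrans (lattice_pt (0, 0, m)) \<phi> p) has_sum g p) UNIV"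
    by blast
  define f where "f N q = (\<Sum>m\<in>{- int N..int N}. c m * ltrans (lattice_pt (0, 0, m)) \<phi> q)" for N q
  let ?W = "\<lambda>v x. complex_of_real (w x) * v x"
  have ps: "partial_sum u N = (\<lambda>x. \<Sum>m\<in>{- int N..int N}. c m * chi m x)" for N
    by (simp add: partial_sum_def[abs_def] c_def)
  have fN: "f N = (\<lambda>q. \<Sum>m\<in>{- int N..int N}. c m * ltrans (lattice_pt (0, 0, m)) \<phi> q)" for N
    by (rule ext) (rule f_def)
  have psx: "partial_sum u N x = (\<Sum>m\<in>{- int N..int N}. c m * chi m x)" for N x by (simp add: ps)
  note cc = central_combination[OF \<phi> w(1) coeff, of "{- int N..int N}" c for N, folded fN psx, OF finite_atLeastAtMost_int]
  have fp: "(\<lambda>N. f N q) \<longlonglongrightarrow> g q" for q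
    using filterlim_compose[OF g(2)[of q, unfolded has_sum_def] filterlim_int_intervals] by (simp add: f_def)
  have WL: "?W v \<in> L2 circle" if "v \<in> L2 circle" for v by (rule weight_mult_L2[OF wm w(2,3) that])
  have Wlim: "(\<lambda>N. l2_norm circle (\<lambda>x. ?W (partial_sum u N) x - ?W u x)) \<longlonglongrightarrow> 0"
  proof (rule Lim_null_comparison)
    have B: "0 \<le> B" using w(2,3)[of 0] by linarith
    have "l2_norm circle (?W v) \<le> B * l2_norm circle v" if v: "v \<in> L2 circle" for v
    proof (rule power2_le_imp_le)
      have "(l2_norm circle (?W v))\<^sup>2 \<le> (LINT x|circle. B\<^sup>2 * (cmod (v x))\<^sup>2)"
        unfolding l2_norm_sq using w(2,3)
        by (intro integral_mono L2_integrable[OF WL[OF v]] integrable_mult_right L2_integrable[OF v])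
          (auto simp: norm_mult power_mult_distrib intro!: mult_right_mono power_mono)
      then show "(l2_norm circle (?W v))\<^sup>2 \<le> (B * l2_norm circle v)\<^sup>2"
        by (simp add: power_mult_distrib l2_norm_sq)
    qed (use B in simp)
    from this[OF L2_diff[OF partial_sum_L2 u]]
    show "\<forall>\<^sub>F N in sequentially. norm (l2_norm circle (\<lambda>x. ?W (partial_sum u N) x - ?W u x)) \<le> B * l2_norm circle (\<lambda>x. partial_sum u N x - u x)"
      by (simp add: right_diff_distrib always_eventually)
    show "(\<lambda>N. B * l2_norm circle (\<lambda>x. partial_sum u N x - u x)) \<longlonglongrightarrow> 0"
      using tendsto_mult_left[OF partial_sum_tendsto[OF u], of B] by simp
  qed
  \<comment> \<open>The squared norm of \<open>f N\<close> is the weighted norm of the N-th partial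
    sum of u, and the limit vanishes because w is zero on the support of u.\<close>
  have "(\<lambda>N. l2_inner circle (?W (partial_sum u N)) (partial_sum u N)) \<longlonglongrightarrow> l2_inner circle (?W u) u"
    by (intro tendsto_l2_inner2[OF Wlim partial_sum_tendsto[OF u]] WL partial_sum_L2 u)
  moreover have "l2_inner circle (?W u) u = 0"
  proof -
    have "?W u = (\<lambda>x. 0)" by (rule ext) (simp add: u_def indicator_def)
    then show ?thesis by (simp only: l2_inner_zero)
  qed
  ultimately have "(\<lambda>N. complex_of_real ((l2_norm lborel (f N))\<^sup>2)) \<longlonglongrightarrow> of_real 0"
    unfolding cc(4) by simp
  then have "(\<lambda>N. (l2_norm lborel (f N))\<^sup>2) \<longlonglongrightarrow> 0" by (simp only: tendsto_of_real_iff)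
  from tendsto_real_sqrt[OF this] have "(\<lambda>N. l2_norm lborel (\<lambda>q. f N q - 0)) \<longlonglongrightarrow> 0" by simp
  from l2_AE_subseq[OF cc(1) L2_zero this]
  obtain r :: "nat \<Rightarrow> nat" where r: "strict_mono r" "AE q in lborel. (\<lambda>n. f (r n) q) \<longlonglongrightarrow> 0" by blast
  \<comment> \<open>The norm limit is 0 and the pointwise limit is g; a subsequence converging
    almost everywhere identifies them, and continuity of g then removes the exceptional set.\<close>
  have "AE q in lborel. g q = 0"
    using r(2)
  proof eventually_elim
    case (elim q)
    have "(\<lambda>n. f (r n) q) \<longlonglongrightarrow> g q" using LIMSEQ_subseq_LIMSEQ[OF fp r(1)] by (simp add: o_def)
    with elim show ?case using LIMSEQ_unique by blast
  qed
  then have g0: "g q = 0" for q by (rule continuous_AE_zero[OF g(1)])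
  have "(LINT x|circle. u x * P x * cnj (chi m' x)) = 0" for m'
  proof -
    \<comment> \<open>The conjugated coefficients of \<open>?v\<close> are the samples shifted as in
      the series for g at the lattice point (k, l, m'), so Parseval for u and \<open>?v\<close>
      evaluates that series.\<close>
    let ?v = "\<lambda>x. chi m' x * cnj (P x)"
    have v: "?v \<in> L2 circle"
      by (rule L2_bounded_mult[OF L2_cnj[OF P(1)], of _ 1]) (auto simp: char_fun_simps(3) intro: L2_measurable[OF L2_chi])
    have "cnj (l2_inner circle ?v (chi m)) = \<phi> (lattice_pt (k, l, m' - m))" for m
    proof -
      have "cnj (l2_inner circle ?v (chi m)) = l2_inner circle P (chi (m' - m))"
        unfolding l2_inner_def Bochner_Integration.integral_cnj[symmetric] chi_diff by (simp add: mult_ac)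
      then show ?thesis unfolding P(2) .
    qed
    then have "((\<lambda>m. c m * ltrans (lattice_pt (0, 0, m)) \<phi> (lattice_pt (k, l, m'))) has_sum l2_inner circle u ?v) UNIV"
      using chi_Parseval_inner[OF u v] by (simp add: c_def ltrans_central_lattice_pt)
    from has_sum_unique[OF this g(2)] have "l2_inner circle u ?v = 0" by (simp add: g0)
    then show ?thesis by (simp add: l2_inner_def mult_ac)
  qed
  then have "AE x in circle. u x * P x = 0"
    by (intro chi_uniqueness[where g="\<lambda>x. 0"] L2_mult_integrable[OF u P(1)]) auto
  then show ?thesis
    using AE_space by eventually_elim (auto simp: u_def indicator_def)
qed

text \<open>The series and v are both integrable on the circle and have the same Fourier
  coefficients: the n-th one is the inner product of \<phi> with its central translate by n,
  computed once from the definition of v and once from the expansion in translates of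
  \<psi>.\<close>

lemma weight_identity:
  fixes \<phi> \<psi> :: "'n::finite heis \<Rightarrow> complex" and v w :: "real \<Rightarrow> real" and \<kappa> :: "nat \<Rightarrow> (int^'n) \<times> (int^'n)"
  assumes \<phi>: "\<phi> \<in> L2 lborel" and \<psi>: "\<psi> \<in> L2 lborel" and C: "condition_C \<psi>"
    and v: "integrable circle v" and w: "integrable circle w" "\<And>x. 0 \<le> w x" "\<And>x. w x \<le> B"
    and coeff\<phi>: "\<And>m. l2_inner lborel \<phi> (ltrans (lattice_pt (0, 0, m)) \<phi>) = (LINT x|circle. of_real (v x) * cnj (chi m x))"
    and coeff\<psi>: "\<And>m. l2_inner lborel \<psi> (ltrans (lattice_pt (0, 0, m)) \<psi>) = (LINT x|circle. of_real (w x) * cnj (chi m x))"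
    and expand: "l2_has_sum lborel (\<lambda>j p. a j * ltrans (lattice_pt j) \<psi> p) \<phi>"
    and P: "\<And>k l. P k l \<in> L2 circle" "\<And>k l m. l2_inner circle (P k l) (chi m) = a (k, l, m)"
    and \<kappa>: "bij_betw \<kappa> UNIV UNIV"
  shows "AE x in circle. (\<lambda>i. w x * (cmod (P (fst (\<kappa> i)) (snd (\<kappa> i)) x))\<^sup>2) sums v x"
proof -
  have wm[measurable]: "w \<in> borel_measurable circle" using w(1) by (rule borel_measurable_integrable)
  have [measurable]: "chi m \<in> borel_measurable circle" for m by (rule L2_measurable[OF L2_chi])
  have [measurable]: "P k l \<in> borel_measurable circle" for k l by (rule L2_measurable[OF P(1)])
  let ?W = "\<lambda>u x. complex_of_real (w x) * u x"
  have WL: "?W u \<in> L2 circle" if "u \<in> L2 circle" for u by (rule weight_mult_L2[OF wm w(2,3) that])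
  have cL: "(\<lambda>x. chi n x * u x) \<in> L2 circle" if "u \<in> L2 circle" for u n
    by (rule L2_bounded_mult[OF that, of _ 1]) (auto simp: char_fun_simps(3))
  let ?e = "\<lambda>j. ltrans (lattice_pt j) \<psi>"
  have eL: "?e j \<in> L2 lborel" for j by (rule L2_ltrans[OF \<psi>])
  have sum: "((\<lambda>j. a j * l2_inner lborel (?e j) h) has_sum l2_inner lborel \<phi> h) UNIV" if h: "h \<in> L2 lborel" for h
    unfolding has_sum_def
  proof (rule Lim_transform_eventually)
    have sL: "(\<lambda>p. \<Sum>j\<in>J. a j * ?e j p) \<in> L2 lborel" for J by (intro L2_sum L2_scale eL)
    have "((\<lambda>J. l2_norm lborel (\<lambda>x. (\<Sum>j\<in>J. a j * ?e j x) - \<phi> x)) \<longlongrightarrow> 0) (finite_subsets_at_top UNIV)"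
      using expand unfolding l2_has_sum_def l2_norm_minus_commute[of lborel \<phi>] .
    then show "((\<lambda>J. l2_inner lborel (\<lambda>p. \<Sum>j\<in>J. a j * ?e j p) h) \<longlongrightarrow> l2_inner lborel \<phi> h) (finite_subsets_at_top UNIV)"
      by (rule tendsto_l2_inner[OF _ always_eventually \<phi> h]) (intro allI sL)
    have "l2_inner lborel (\<lambda>p. \<Sum>j\<in>J. a j * ?e j p) h = (\<Sum>j\<in>J. a j * l2_inner lborel (?e j) h)" for J
      by (subst l2_inner_sum_left) (auto intro: L2_scale eL h simp: l2_inner_scale_left)
    then show "\<forall>\<^sub>F J in finite_subsets_at_top UNIV. l2_inner lborel (\<lambda>p. \<Sum>j\<in>J. a j * ?e j p) h = (\<Sum>j\<in>J. a j * l2_inner lborel (?e j) h)"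
      by (simp add: always_eventually)
  qed
  \<comment> \<open>By Condition C only translates of \<psi> with the same (k, l) contribute. Their
    inner products are coefficients of w, and Parseval sums them against the coefficients of
    P.\<close>
  have 1: "l2_inner lborel \<phi> (?e (k, l, m')) = l2_inner circle (?W (P k l)) (chi m')" for k l m'
  proof -
    have inj: "inj (\<lambda>m::int. (k, l, m))" by (auto simp: inj_on_def)
    have "((\<lambda>j. a j * l2_inner lborel (?e j) (?e (k, l, m'))) has_sum l2_inner lborel \<phi> (?e (k, l, m'))) (range (\<lambda>m. (k, l, m)))"
    proof (rule has_sum_cong_neutral[THEN iffD1, OF _ _ _ sum[OF eL]])
      fix j assume j: "j \<in> UNIV - range (\<lambda>m::int. (k, l, m))"
      obtain k2 l2 m2 where [simp]: "j = (k2, l2, m2)" by (cases j)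
      from j have "(k2, l2) \<noteq> (k, l)" by auto
      from l2_inner_ltrans_different[OF \<psi> C this] show "a j * l2_inner lborel (?e j) (?e (k, l, m')) = 0" by simp
    qed auto
    then have h1: "((\<lambda>m. a (k, l, m) * l2_inner lborel (?e (k, l, m)) (?e (k, l, m'))) has_sum l2_inner lborel \<phi> (?e (k, l, m'))) UNIV"
      by (simp only: has_sum_reindex[OF inj] o_def)
    have c: "cnj (l2_inner circle (?W (chi m')) (chi m)) = l2_inner lborel (?e (k, l, m)) (?e (k, l, m'))" for m
      unfolding l2_inner_ltrans_same[OF \<psi> \<psi>] coeff\<psi> chi_diff
      unfolding l2_inner_def Bochner_Integration.integral_cnj[symmetric]
      by (simp add: mult_ac)
    have "((\<lambda>m. a (k, l, m) * l2_inner lborel (?e (k, l, m)) (?e (k, l, m'))) has_sum l2_inner circle (P k l) (?W (chi m'))) UNIV"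
      using chi_Parseval_inner[OF P(1) WL[OF L2_chi], of k l m'] unfolding c P(2) .
    from has_sum_unique[OF h1 this] show ?thesis by (simp add: l2_inner_def mult_ac)
  qed
  \<comment> \<open>The expansion of \<phi> is paired with a central translate of \<phi> and summed
    over m first; each inner sum is the n-th Fourier coefficient of w |P|^2.\<close>
  have 2: "((\<lambda>(k, l). l2_inner circle (P k l) (\<lambda>x. chi n x * ?W (P k l) x)) has_sum l2_inner lborel \<phi> (ltrans (lattice_pt (0, 0, n)) \<phi>)) UNIV" for n
  proof -
    \<comment> \<open>Both arguments are translated back by n in the centre. The previous step then
      gives a coefficient at m - n, which is the coefficient at m after modulation.\<close>
    have t: "l2_inner lborel (?e (k, l, m)) (ltrans (lattice_pt (0, 0, n)) \<phi>) = cnj (l2_inner circle (\<lambda>x. chi n x * ?W (P k l) x) (chi m))" for k l m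
    proof -
      have "?e (k, l, m) = ltrans (lattice_pt (0, 0, n)) (?e (k, l, m - n))" by (simp add: ltrans_central)
      then have "l2_inner lborel (?e (k, l, m)) (ltrans (lattice_pt (0, 0, n)) \<phi>) = l2_inner lborel (?e (k, l, m - n)) \<phi>"
        by (simp only: l2_inner_ltrans eL \<phi>)
      also have "\<dots> = cnj (l2_inner circle (?W (P k l)) (chi (m - n)))"
        unfolding 1[symmetric] by (rule l2_inner_commute)
      also have "l2_inner circle (?W (P k l)) (chi (m - n)) = l2_inner circle (\<lambda>x. chi n x * ?W (P k l) x) (chi m)"
        unfolding l2_inner_def chi_diff by (simp add: mult_ac)
      finally show ?thesis .
    qed
    have bij: "bij_betw (\<lambda>z. (fst (fst z), snd (fst z), snd z)) (UNIV :: (((int^'n) \<times> (int^'n)) \<times> int) set) UNIV"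
      by (rule bij_betw_byWitness[where f'="\<lambda>j. ((fst j, fst (snd j)), snd (snd j))"]) auto
    have "((\<lambda>z. a (fst (fst z), snd (fst z), snd z) * cnj (l2_inner circle (\<lambda>x. chi n x * ?W (P (fst (fst z)) (snd (fst z))) x) (chi (snd z))))
        has_sum l2_inner lborel \<phi> (ltrans (lattice_pt (0, 0, n)) \<phi>)) (Sigma UNIV (\<lambda>_. UNIV))"
      using has_sum_reindex_bij_betw[OF bij, THEN iffD2, OF sum[OF L2_ltrans[OF \<phi>, of "lattice_pt (0, 0, n)"]]] unfolding t by simp
    then show ?thesis
    proof (rule has_sum_SigmaD)
      fix kl :: "(int^'n) \<times> (int^'n)"
      obtain k l where kl: "kl = (k, l)" by (cases kl)
      show "((\<lambda>m. a (fst (fst (kl, m)), snd (fst (kl, m)), snd (kl, m)) * cnj (l2_inner circle (\<lambda>x. chi n x * ?W (P (fst (fst (kl, m))) (snd (fst (kl, m)))) x) (chi (snd (kl, m)))))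
        has_sum (case kl of (k, l) \<Rightarrow> l2_inner circle (P k l) (\<lambda>x. chi n x * ?W (P k l) x))) UNIV"
        using chi_Parseval_inner[OF P(1) cL[OF WL[OF P(1)]], of k l n k l] unfolding P(2) kl by simp
    qed
  qed
  define Q where "Q i = P (fst (\<kappa> i)) (snd (\<kappa> i))" for i
  have QL: "Q i \<in> L2 circle" for i unfolding Q_def by (rule P(1))
  have [measurable]: "Q i \<in> borel_measurable circle" for i by (rule L2_measurable[OF QL])
  define F where "F i x = w x * (cmod (Q i x))\<^sup>2" for i x
  have F0: "0 \<le> F i x" for i x using w(2) by (simp add: F_def)
  have FW: "complex_of_real (F i x) = ?W (Q i) x * cnj (Q i x)" for i x
    unfolding F_def by (simp only: of_real_mult complex_norm_square mult.assoc)
  have Fi: "integrable circle (\<lambda>x. complex_of_real (F i x))" for i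
    unfolding FW by (intro L2_inner_integrable WL QL)
  have 3: "(\<lambda>i. LINT x|circle. complex_of_real (F i x) * cnj (chi n x)) sums l2_inner lborel \<phi> (ltrans (lattice_pt (0, 0, n)) \<phi>)" for n
  proof -
    have "((\<lambda>i. l2_inner circle (Q i) (\<lambda>x. chi n x * ?W (Q i) x)) has_sum l2_inner lborel \<phi> (ltrans (lattice_pt (0, 0, n)) \<phi>)) UNIV"
      using has_sum_reindex_bij_betw[OF \<kappa>, THEN iffD2, OF 2[of n]] unfolding Q_def case_prod_beta .
    moreover have "l2_inner circle (Q i) (\<lambda>x. chi n x * ?W (Q i) x) = (LINT x|circle. complex_of_real (F i x) * cnj (chi n x))" for i
      unfolding l2_inner_def FW by (simp add: mult_ac)
    ultimately show ?thesis using has_sum_imp_sums by fastforce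
  qed
  \<comment> \<open>The case n = 0: the integrals of the nonnegative terms have a finite sum, so the
    series converges almost everywhere and may be integrated term by term.\<close>
  have sumF: "summable (\<lambda>i. LINT x|circle. F i x)"
  proof -
    have "(\<lambda>i. complex_of_real (LINT x|circle. F i x)) sums l2_inner lborel \<phi> (ltrans (lattice_pt (0, 0, 0)) \<phi>)"
      using 3[of 0] by (simp add: char_fun_simps)
    then have "summable (\<lambda>i. complex_of_real (LINT x|circle. F i x))" by (rule sums_summable)
    then show ?thesis by (simp only: summable_of_real_iff)
  qed
  have Fir: "integrable circle (F i)" for i using Fi[of i] by (simp only: complex_of_real_integrable_eq)
  have AEs: "AE x in circle. summable (\<lambda>i. F i x)"
  proof -
    have Fm: "(\<lambda>x. ennreal (F i x)) \<in> borel_measurable circle" for i using Fir[of i] by measurable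
    have "(\<integral>\<^sup>+x. (\<Sum>i. ennreal (F i x)) \<partial>circle) = (\<Sum>i. \<integral>\<^sup>+x. ennreal (F i x) \<partial>circle)" by (rule nn_integral_suminf[OF Fm])
    also have "\<dots> = (\<Sum>i. ennreal (LINT x|circle. F i x))" by (simp only: nn_integral_eq_integral[OF Fir AE_I2[OF F0]])
    also have "\<dots> = ennreal (\<Sum>i. LINT x|circle. F i x)"
      by (rule suminf_ennreal2[OF _ sumF]) (intro integral_nonneg_AE AE_I2 F0)
    finally have "(\<integral>\<^sup>+x. (\<Sum>i. ennreal (F i x)) \<partial>circle) \<noteq> \<infinity>" by simp
    then have "AE x in circle. (\<Sum>i. ennreal (F i x)) \<noteq> \<infinity>"
      by (intro nn_integral_PInf_AE borel_measurable_suminf_order Fm) auto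
    then show ?thesis by eventually_elim (rule summable_suminf_not_top[OF F0], simp)
  qed
  have n1: "norm (complex_of_real (F i x)) = F i x" for i x using F0 by simp
  have "integrable circle (\<lambda>x. \<Sum>i. complex_of_real (F i x))"
    by (rule integrable_suminf[OF Fi]) (use AEs sumF in \<open>simp_all only: n1\<close>)
  moreover have "(LINT x|circle. (\<Sum>i. complex_of_real (F i x)) * cnj (chi n x)) = (LINT x|circle. of_real (v x) * cnj (chi n x))" for n
  proof -
    have Fc: "integrable circle (\<lambda>x. complex_of_real (F i x) * cnj (chi n x))" for i by (rule integrable_mult_chi(2)[OF Fi])
    have n2: "norm (complex_of_real (F i x) * cnj (chi n x)) = F i x" for i x using F0 by (simp add: norm_mult char_fun_simps(3))
    have "(LINT x|circle. (\<Sum>i. complex_of_real (F i x)) * cnj (chi n x)) = (LINT x|circle. (\<Sum>i. complex_of_real (F i x) * cnj (chi n x)))"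
    proof (rule integral_cong_AE)
      show "(\<lambda>x. (\<Sum>i. complex_of_real (F i x)) * cnj (chi n x)) \<in> borel_measurable circle"
        by (rule borel_measurable_integrable[OF integrable_mult_chi(2)[OF calculation]])
      show "(\<lambda>x. \<Sum>i. complex_of_real (F i x) * cnj (chi n x)) \<in> borel_measurable circle"
        by (rule borel_measurable_suminf) (rule borel_measurable_integrable[OF Fc])
      show "AE x in circle. (\<Sum>i. complex_of_real (F i x)) * cnj (chi n x) = (\<Sum>i. complex_of_real (F i x) * cnj (chi n x))"
        using AEs by eventually_elim (rule suminf_mult2, simp only: summable_of_real_iff)
    qed
    also have "\<dots> = (\<Sum>i. LINT x|circle. complex_of_real (F i x) * cnj (chi n x))"
      by (rule integral_suminf[OF Fc]) (use AEs sumF in \<open>simp_all only: n2\<close>)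
    also have "\<dots> = l2_inner lborel \<phi> (ltrans (lattice_pt (0, 0, n)) \<phi>)" using 3[of n] by (rule sums_unique[symmetric])
    finally show ?thesis by (simp only: coeff\<phi>)
  qed
  ultimately have "AE x in circle. (\<Sum>i. complex_of_real (F i x)) = of_real (v x)"
    by (intro chi_uniqueness) (use v in simp_all)
  with AEs show ?thesis
  proof eventually_elim
    case (elim x)
    have "(\<Sum>i. complex_of_real (F i x)) = of_real (\<Sum>i. F i x)" by (rule suminf_of_real[OF elim(1), symmetric])
    then have "(\<Sum>i. F i x) = v x" using elim(2) by (metis of_real_eq_iff)
    then have "(\<lambda>i. F i x) sums v x" using summable_sums[OF elim(1)] by simp
    then show ?case by (simp only: F_def Q_def)
  qed
qed

section \<open>The sampling theorem\<close>

lemma unit_cube_subset: "unit_cube \<subseteq> cbox (0 :: 'n::finite heis) (1, 1, 1)"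
proof
  fix p :: "'n heis" assume p: "p \<in> unit_cube"
  obtain x y t where [simp]: "p = (x, y, t)" by (cases p)
  from p show "p \<in> cbox 0 (1, 1, 1)"
    by (auto simp: unit_cube_def zero_prod_def cbox_Pair_eq mem_box_cart less_imp_le)
qed

text \<open>The sum of the f i is the quotient v / w. Positivity of v excludes w = 0, so the lower
  bound A' for w becomes available.\<close>

lemma frame_sum_bound:
  fixes v w :: real and f :: "nat \<Rightarrow> real"
  assumes s: "(\<lambda>i. w * f i) sums v" and v: "0 < v" and w: "0 \<le> w" and f: "\<And>i. 0 \<le> f i"
    and vb: "A \<le> v" "v \<le> B" and wb: "w = 0 \<or> A' \<le> w" "w \<le> B'" and pos: "0 < A" "0 < A'" "0 < B'"
  shows "ennreal (A / B') \<le> (\<Sum>i. ennreal (f i))" "(\<Sum>i. ennreal (f i)) \<le> ennreal (B / A')"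
proof -
  have "w \<noteq> 0"
  proof
    assume "w = 0"
    then have "(\<lambda>i. 0) sums v" using s by simp
    then show False using v sums_unique2[OF sums_zero] by fastforce
  qed
  then have w': "0 < w" "A' \<le> w" using w wb by auto
  have "(\<lambda>i. f i) sums (v / w)" using sums_divide[OF s, of w] w' by simp
  then have eq: "(\<Sum>i. ennreal (f i)) = ennreal (v / w)" using f by (intro suminf_ennreal_eq)
  have "A / B' \<le> v / w" using vb w' wb pos by (intro frac_le) auto
  then show "ennreal (A / B') \<le> (\<Sum>i. ennreal (f i))" unfolding eq by (rule ennreal_leI)
  have "v / w \<le> B / A'" using vb w' v pos by (intro frac_le) auto
  then show "(\<Sum>i. ennreal (f i)) \<le> ennreal (B / A')" unfolding eq by (rule ennreal_leI)
qed

theorem theorem3p1: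
  fixes V0 :: "('n::finite heis \<Rightarrow> complex) set"
    and \<phi> \<psi> :: "'n heis \<Rightarrow> complex"
    and ev :: "('n heis \<Rightarrow> complex) \<Rightarrow> 'n heis \<Rightarrow> complex"
  assumes "l2_closed_subspace lborel V0"
    and "\<phi> \<in> L2 lborel" and "condition_C \<phi>"
    and "l2_frame lborel V0 (\<lambda>j. ltrans (lattice_pt j) \<phi>)"
    and "\<And>k l (c :: int \<Rightarrow> complex). (\<lambda>m. (cmod (c m))\<^sup>2) summable_on UNIV \<Longrightarrow>
           \<exists>g. continuous_on UNIV g \<and>
             (\<forall>p. ((\<lambda>m. c m * ltrans (lattice_pt (k, l, m)) \<phi> p) has_sum g p) UNIV)"
    and "\<psi> \<in> L2 lborel" and "condition_C \<psi>"
    and "l2_frame lborel V0 (\<lambda>j. ltrans (lattice_pt j) \<psi>)"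
    and "lattice_values V0 ev"
    and "\<And>f. f \<in> V0 \<Longrightarrow>
           l2_has_sum lborel (\<lambda>j p. ev f (lattice_pt j) * ltrans (lattice_pt j) \<psi> p) f"
  shows "continuous_on UNIV \<phi> \<and>
    (\<forall>k l. (SUP p\<in>unit_cube.
           \<Sum>\<^sub>\<infinity>m::int. ennreal ((cmod (ltrans (lattice_pt (k, l, m)) \<phi> p))\<^sup>2)) < \<infinity>) \<and>
    (\<exists>P :: int^'n \<Rightarrow> int^'n \<Rightarrow> real \<Rightarrow> complex.
           (\<forall>k l. fourier_series_sum (\<lambda>m. \<phi> (lattice_pt (k, l, m))) (P k l)) \<and>
           (\<exists>A>0. \<exists>B>0. AE \<omega> in lborel.
              ennreal (A * indicator (Omega \<phi>) \<omega>)
                \<le> (\<Sum>\<^sub>\<infinity>(k, l). ennreal ((cmod (P k l \<omega>))\<^sup>2)) \<and>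
              (\<Sum>\<^sub>\<infinity>(k, l). ennreal ((cmod (P k l \<omega>))\<^sup>2))
                \<le> ennreal (B * indicator (Omega \<phi>) \<omega>)))"
proof -
  note V = assms(1) and \<phi> = assms(2) and \<psi> = assms(6)
  have \<phi>V: "\<phi> \<in> V0"
  proof -
    have "ltrans (lattice_pt (0, 0, 0)) \<phi> \<in> V0" using assms(4) unfolding l2_frame_def by blast
    then show ?thesis by (simp only: ltrans_lattice_pt_zero)
  qed
  have cont: "continuous_on UNIV \<phi>"
  proof -
    \<comment> \<open>With a single nonzero coefficient the series is \<phi> itself, so the limit
      function of the hypothesis is \<phi>.\<close>
    let ?c = "\<lambda>m::int. if m = 0 then 1 else 0 :: complex"
    have "((\<lambda>m. (cmod (?c m))\<^sup>2) has_sum (\<Sum>m\<in>{0}. (cmod (?c m))\<^sup>2)) UNIV"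
      by (rule has_sum_finite_neutralI[of "{0}"]) auto
    then have "(\<lambda>m. (cmod (?c m))\<^sup>2) summable_on UNIV" by (rule has_sum_imp_summable)
    from assms(5)[OF this, of 0 0] obtain g where g: "continuous_on UNIV g"
      "\<And>p. ((\<lambda>m. ?c m * ltrans (lattice_pt (0, 0, m)) \<phi> p) has_sum g p) UNIV" by blast
    have "g p = \<phi> p" for p
    proof (rule has_sum_unique[OF g(2)])
      have "((\<lambda>m. ?c m * ltrans (lattice_pt (0, 0, m)) \<phi> p) has_sum (\<Sum>m\<in>{0}. ?c m * ltrans (lattice_pt (0, 0, m)) \<phi> p)) UNIV"
        by (rule has_sum_finite_neutralI[of "{0}"]) auto
      then show "((\<lambda>m. ?c m * ltrans (lattice_pt (0, 0, m)) \<phi> p) has_sum \<phi> p) UNIV"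
        by (simp add: ltrans_lattice_pt_zero)
    qed
    then have "g = \<phi>" by (rule ext)
    with g(1) show ?thesis by simp
  qed
  have ii: "(SUP p\<in>unit_cube. \<Sum>\<^sub>\<infinity>m::int. ennreal ((cmod (ltrans (lattice_pt (k, l, m)) \<phi> p))\<^sup>2)) < \<infinity>" for k l
  proof -
    have "\<exists>C. \<forall>p\<in>unit_cube. (\<lambda>m. (cmod (ltrans (lattice_pt (k, l, m)) \<phi> p))\<^sup>2) summable_on UNIV \<and>
        infsum (\<lambda>m. (cmod (ltrans (lattice_pt (k, l, m)) \<phi> p))\<^sup>2) UNIV \<le> C"
    proof (rule coefficient_uniform_boundedness)
      fix c :: "int \<Rightarrow> complex" assume "(\<lambda>m. (cmod (c m))\<^sup>2) summable_on UNIV"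
      from assms(5)[OF this, of k l] obtain g where g: "continuous_on UNIV g"
        "\<And>p. ((\<lambda>m. c m * ltrans (lattice_pt (k, l, m)) \<phi> p) has_sum g p) UNIV" by blast
      \<comment> \<open>The half-open cube lies in a compact one, where the continuous sum is
        bounded; this bound depends on c, and uniform boundedness makes it independent of c.\<close>
      have "compact (g ` cbox 0 (1, 1, 1))"
        by (intro compact_continuous_image compact_cbox continuous_on_subset[OF g(1)]) simp
      then obtain B where "\<And>p. p \<in> cbox 0 (1, 1, 1) \<Longrightarrow> cmod (g p) \<le> B"
        using compact_imp_bounded bounded_iff by (metis imageI)
      then show "\<exists>g B. \<forall>p\<in>unit_cube. ((\<lambda>m. c m * ltrans (lattice_pt (k, l, m)) \<phi> p) has_sum g p) UNIV \<and> cmod (g p) \<le> B"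
        using g(2) unit_cube_subset by blast
    qed
    then obtain C where C: "\<And>p. p \<in> unit_cube \<Longrightarrow> (\<lambda>m. (cmod (ltrans (lattice_pt (k, l, m)) \<phi> p))\<^sup>2) summable_on UNIV"
        "\<And>p. p \<in> unit_cube \<Longrightarrow> infsum (\<lambda>m. (cmod (ltrans (lattice_pt (k, l, m)) \<phi> p))\<^sup>2) UNIV \<le> C" by blast
    have "(SUP p\<in>unit_cube. \<Sum>\<^sub>\<infinity>m::int. ennreal ((cmod (ltrans (lattice_pt (k, l, m)) \<phi> p))\<^sup>2)) \<le> ennreal C"
      by (intro SUP_least infsum_ennreal_le C) auto
    then show ?thesis by (rule order_le_less_trans) simp
  qed
  \<comment> \<open>Uniform boundedness at a single lattice point: the central translates evaluated
    at (k, l, 0) are the samples in reversed order of m.\<close>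
  have sq: "(\<lambda>m. (cmod (\<phi> (lattice_pt (k, l, m))))\<^sup>2) summable_on UNIV" for k l
  proof -
    have "\<exists>C. \<forall>p\<in>{lattice_pt (k, l, 0)}. (\<lambda>m. (cmod (ltrans (lattice_pt (0, 0, m)) \<phi> p))\<^sup>2) summable_on UNIV \<and>
        infsum (\<lambda>m. (cmod (ltrans (lattice_pt (0, 0, m)) \<phi> p))\<^sup>2) UNIV \<le> C"
    proof (rule coefficient_uniform_boundedness)
      fix c :: "int \<Rightarrow> complex" assume "(\<lambda>m. (cmod (c m))\<^sup>2) summable_on UNIV"
      from assms(5)[OF this, of 0 0] show "\<exists>g B. \<forall>p\<in>{lattice_pt (k, l, 0)}. ((\<lambda>m. c m * ltrans (lattice_pt (0, 0, m)) \<phi> p) has_sum g p) UNIV \<and> cmod (g p) \<le> B"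
        by blast
    qed
    then have "(\<lambda>m. (cmod (\<phi> (lattice_pt (k, l, - m))))\<^sup>2) summable_on UNIV"
      by (simp add: ltrans_central_lattice_pt)
    moreover have "bij_betw (uminus :: int \<Rightarrow> int) UNIV UNIV" by (rule bij_uminus)
    ultimately show ?thesis
      using summable_on_reindex_bij_betw[of uminus UNIV UNIV "\<lambda>m. (cmod (\<phi> (lattice_pt (k, l, m))))\<^sup>2"] by blast
  qed
  obtain v A\<phi> B\<phi> where A\<phi>: "0 < A\<phi>" "0 < B\<phi>" and v: "integrable circle v" "\<And>x. 0 \<le> v x" "\<And>x. v x \<le> B\<phi>"
    "AE x in circle. Re (G \<phi> 0 0 x) = v x" "AE x in circle. v x = 0 \<or> A\<phi> \<le> v x"
    and coeff\<phi>: "\<And>m. l2_inner lborel \<phi> (ltrans (lattice_pt (0, 0, m)) \<phi>) = (LINT x|circle. of_real (v x) * cnj (chi m x))"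
    by (rule frame_weight[OF V \<phi> assms(3,4)]) (rule that)
  obtain w A\<psi> B\<psi> where A\<psi>: "0 < A\<psi>" "0 < B\<psi>" and w: "integrable circle w" "\<And>x. 0 \<le> w x" "\<And>x. w x \<le> B\<psi>"
    "AE x in circle. w x = 0 \<or> A\<psi> \<le> w x"
    and coeff\<psi>: "\<And>m. l2_inner lborel \<psi> (ltrans (lattice_pt (0, 0, m)) \<psi>) = (LINT x|circle. of_real (w x) * cnj (chi m x))"
    by (rule frame_weight[OF V \<psi> assms(7,8)]) (rule that)
  have "\<exists>P. fourier_series_sum (\<lambda>m. \<phi> (lattice_pt (k, l, m))) P \<and> P \<in> L2 circle \<and> (\<forall>m. l2_inner circle P (chi m) = \<phi> (lattice_pt (k, l, m)))" for k l
    using fourier_series_sum_exists[OF sq[of k l]] by metis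
  then obtain P where P: "\<And>k l. fourier_series_sum (\<lambda>m. \<phi> (lattice_pt (k, l, m))) (P k l)" "\<And>k l. P k l \<in> L2 circle"
    "\<And>k l m. l2_inner circle (P k l) (chi m) = \<phi> (lattice_pt (k, l, m))"
    by metis
  \<comment> \<open>An enumeration of the pairs (k, l), so that the exceptional sets of all pairs
    together remain null.\<close>
  define \<kappa> :: "nat \<Rightarrow> (int^'n) \<times> (int^'n)" where "\<kappa> = from_nat_into UNIV"
  have \<kappa>: "bij_betw \<kappa> UNIV UNIV"
    unfolding \<kappa>_def by (rule bij_betw_from_nat_into[OF countable_int_vec_pairs infinite_int_vec_pairs])
  have expand: "l2_has_sum lborel (\<lambda>j p. \<phi> (lattice_pt j) * ltrans (lattice_pt j) \<psi> p) \<phi>"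
  proof -
    \<comment> \<open>Continuity of \<phi>, proved above, forces the prescribed values of its class
      to be its own.\<close>
    have "ev \<phi> (lattice_pt j) = \<phi> (lattice_pt j)" for j
      using assms(9) \<phi>V cont unfolding lattice_values_def by blast
    then show ?thesis using assms(10)[OF \<phi>V] by simp
  qed
  have id: "AE x in circle. (\<lambda>i. w x * (cmod (P (fst (\<kappa> i)) (snd (\<kappa> i)) x))\<^sup>2) sums v x"
    by (rule weight_identity[OF \<phi> \<psi> assms(7) v(1) w(1-3) coeff\<phi> coeff\<psi> expand P(2,3) \<kappa>])
  have van: "AE x in circle. \<forall>i. v x = 0 \<longrightarrow> P (fst (\<kappa> i)) (snd (\<kappa> i)) x = 0"
    unfolding AE_all_countable
    by (intro allI Fourier_series_vanishes[OF \<phi> v(1-3) coeff\<phi> assms(5) P(2,3)])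
  let ?S = "\<lambda>x. \<Sum>\<^sub>\<infinity>(k, l). ennreal ((cmod (P k l x))\<^sup>2)"
  have S: "?S x = (\<Sum>i. ennreal ((cmod (P (fst (\<kappa> i)) (snd (\<kappa> i)) x))\<^sup>2))" for x
    unfolding infsum_ennreal_suminf[symmetric] case_prod_beta
    by (rule infsum_reindex_bij_betw[OF \<kappa>, symmetric])
  let ?R = "\<lambda>x. ennreal (A\<phi> / B\<psi> * indicator (Omega \<phi>) x) \<le> ?S x \<and> ?S x \<le> ennreal (B\<phi> / A\<psi> * indicator (Omega \<phi>) x)"
  have "AE x in circle. ?R x"
    using v(4,5) w(4) id van
  proof eventually_elim
    case (elim x)
    show ?case
    proof (cases "v x = 0")
      case True
      then have "x \<notin> Omega \<phi>" using elim(1) by (simp add: Omega_def)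
      moreover have "?S x = 0" unfolding S using elim(5) True by simp
      ultimately show ?thesis by simp
    next
      case False
      then have pos: "0 < v x" using v(2)[of x] by simp
      then have ind: "indicator (Omega \<phi>) x = (1 :: real)" using elim(1) by (simp add: Omega_def)
      have "A\<phi> \<le> v x" using elim(2) False by simp
      from frame_sum_bound[OF elim(4) pos w(2) zero_le_power2 this v(3) elim(3) w(3) A\<phi>(1) A\<psi>]
      show ?thesis unfolding S ind mult_1_right by (rule conjI)
    qed
  qed
  moreover have "?R (x + 1) \<longleftrightarrow> ?R x" for x
  proof -
    have "P k l (x + 1) = P k l x" for k l using P(1)[of k l] unfolding fourier_series_sum_def by blast
    moreover have "indicator (Omega \<phi>) (x + 1) = (indicator (Omega \<phi>) x :: real)"
      by (simp add: Omega_def indicator_def G_periodic)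
    ultimately show ?thesis by simp
  qed
  ultimately have "AE x in lborel. ?R x" by (rule AE_periodic)
  moreover have "0 < A\<phi> / B\<psi>" "0 < B\<phi> / A\<psi>" using A\<phi> A\<psi> by simp_all
  ultimately show ?thesis using cont ii P(1) by blast
qed

end
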